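(* Let $E=(E^0,E^1,r,s)$ be a directed graph and let $c:E^1\to(0,\infty)$ be such that $c(e)>1$ for all $e\in E^1$, with associated one-parameter automorphism group $\sigma$ of $C^*(E)$. Then restriction to $C_0(E^0)$ gives a bijective correspondence between $\sigma$-ground states $\phi$ on $C^*(E)$ and tracial states $\tau$ on $C_0(E^0)$ such that $\mathrm{supp}(\tau)\subseteq\{v\in E^0: v\text{ is singular}\}$.
   Context: A directed graph $E=(E^0,E^1,r,s)$ consists of nonempty sets $E^0$ (vertices), $E^1$ (edges) and functions $r,s:E^1\to E^0$ (range, source); no countability or finiteness is assumed. A vertex $v$ is singular if $r^{-1}(v)$ is empty or infinite. $C^*(E)$ is the universal C*-algebra generated by mutually orthogonal projections $\{p_v\}_{v\in E^0}$ and partial isometries $\{s_e\}_{e\in E^1}$ with mutually orthogonal ranges such that (1) $s_e^*s_e=p_{s(e)}$; (2) $s_es_e^*\le p_{r(e)}$ for every $e\in E^1$; (3) $p_v=\sum_{e\in r^{-1}(v)}s_es_e^*$ whenever $0<|r^{-1}(v)|<\infty$. $C_0(E^0)$ ($E^0$ discrete) is identified with $\overline{\mathrm{span}}\{p_v\}_{v\in E^0}\subseteq C^*(E)$; the support of a state $\tau$ on $C_0(E^0)$ is $\{v\in E^0:\tau(p_v)\ne0\}$. The strongly continuous action $\sigma=\sigma^c:\mathbb R\to\mathrm{Aut}(C^*(E))$ is given by $\sigma_t(p_v)=p_v$ for $v\in E^0$ and $\sigma_t(s_e)=c(e)^{it}s_e$ for $e\in E^1$. Let $C^*(E)^a$ be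 the set of (entire) analytic elements for $\sigma$. A state $\phi$ on $C^*(E)$ is a $\sigma$-ground state if for all $a,b\in C^*(E)^a$ the entire analytic function $\zeta\mapsto\phi(a\sigma_\zeta(b))$ is uniformly bounded in the region $\{\zeta\in\mathbb C:\mathrm{Im}(\zeta)\ge0\}$. *)

theory Defs
  imports
    "HOL-Analysis.Analysis"
    "HOL-Algebra.Module"
    "HOL-Library.Poly_Mapping"
begin

section \<open>C*-algebras\<close>

text \<open>
  C*-algebras are not assumed to be unital.  They are carried by the module records of HOL-Algebra,
  whose field \<open>one\<close> is never used here.
\<close>

record 'a cstar = "(complex, 'a) module" +
  adj :: "'a \<Rightarrow> 'a"
  cnorm :: "'a \<Rightarrow> real"

locale cstar_algebra = abelian_group A for A :: "'a cstar" (structure) +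
  assumes mult_closed: "x \<in> carrier A \<Longrightarrow> y \<in> carrier A \<Longrightarrow> x \<otimes> y \<in> carrier A"
    and mult_assoc: "x \<in> carrier A \<Longrightarrow> y \<in> carrier A \<Longrightarrow> z \<in> carrier A \<Longrightarrow>
          (x \<otimes> y) \<otimes> z = x \<otimes> (y \<otimes> z)"
    and mult_add_left: "x \<in> carrier A \<Longrightarrow> y \<in> carrier A \<Longrightarrow> z \<in> carrier A \<Longrightarrow>
          (x \<oplus> y) \<otimes> z = x \<otimes> z \<oplus> y \<otimes> z"
    and mult_add_right: "x \<in> carrier A \<Longrightarrow> y \<in> carrier A \<Longrightarrow> z \<in> carrier A \<Longrightarrow>
          z \<otimes> (x \<oplus> y) = z \<otimes> x \<oplus> z \<otimes> y"
    and scale_closed: "x \<in> carrier A \<Longrightarrow> a \<odot> x \<in> carrier A"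
    and scale_add: "x \<in> carrier A \<Longrightarrow> y \<in> carrier A \<Longrightarrow> a \<odot> (x \<oplus> y) = a \<odot> x \<oplus> a \<odot> y"
    and add_scale: "x \<in> carrier A \<Longrightarrow> (a + b) \<odot> x = a \<odot> x \<oplus> b \<odot> x"
    and scale_scale: "x \<in> carrier A \<Longrightarrow> a \<odot> (b \<odot> x) = (a * b) \<odot> x"
    and scale_one: "x \<in> carrier A \<Longrightarrow> 1 \<odot> x = x"
    and scale_mult_left: "x \<in> carrier A \<Longrightarrow> y \<in> carrier A \<Longrightarrow> (a \<odot> x) \<otimes> y = a \<odot> (x \<otimes> y)"
    and scale_mult_right: "x \<in> carrier A \<Longrightarrow> y \<in> carrier A \<Longrightarrow> x \<otimes> (a \<odot> y) = a \<odot> (x \<otimes> y)"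
    and adj_closed: "x \<in> carrier A \<Longrightarrow> adj A x \<in> carrier A"
    and adj_adj: "x \<in> carrier A \<Longrightarrow> adj A (adj A x) = x"
    and adj_add: "x \<in> carrier A \<Longrightarrow> y \<in> carrier A \<Longrightarrow> adj A (x \<oplus> y) = adj A x \<oplus> adj A y"
    and adj_scale: "x \<in> carrier A \<Longrightarrow> adj A (a \<odot> x) = cnj a \<odot> adj A x"
    and adj_mult: "x \<in> carrier A \<Longrightarrow> y \<in> carrier A \<Longrightarrow> adj A (x \<otimes> y) = adj A y \<otimes> adj A x"
    and norm_nonneg: "x \<in> carrier A \<Longrightarrow> 0 \<le> cnorm A x"
    and norm_eq_zero: "x \<in> carrier A \<Longrightarrow> cnorm A x = 0 \<longleftrightarrow> x = \<zero>"
    and norm_triangle: "x \<in> carrier A \<Longrightarrow> y \<in> carrier A \<Longrightarrow> cnorm A (x \<oplus> y) \<le> cnorm A x + cnorm A y"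
    and norm_scale: "x \<in> carrier A \<Longrightarrow> cnorm A (a \<odot> x) = cmod a * cnorm A x"
    and norm_mult: "x \<in> carrier A \<Longrightarrow> y \<in> carrier A \<Longrightarrow> cnorm A (x \<otimes> y) \<le> cnorm A x * cnorm A y"
    and cstar_identity: "x \<in> carrier A \<Longrightarrow> cnorm A (adj A x \<otimes> x) = (cnorm A x)\<^sup>2"
    and complete: "(\<And>n. X n \<in> carrier A) \<Longrightarrow>
          (\<And>\<epsilon>. \<epsilon> > 0 \<Longrightarrow> \<exists>M. \<forall>m\<ge>M. \<forall>n\<ge>M. cnorm A (X m \<ominus> X n) < \<epsilon>) \<Longrightarrow>
          \<exists>L\<in>carrier A. (\<lambda>n. cnorm A (X n \<ominus> L)) \<longlonglongrightarrow> 0"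

definition star_hom :: "'a cstar \<Rightarrow> 'b cstar \<Rightarrow> ('a \<Rightarrow> 'b) \<Rightarrow> bool" where
  "star_hom A B f \<longleftrightarrow> f \<in> carrier A \<rightarrow> carrier B \<and>
     (\<forall>x\<in>carrier A. \<forall>y\<in>carrier A. f (x \<oplus>\<^bsub>A\<^esub> y) = f x \<oplus>\<^bsub>B\<^esub> f y) \<and>
     (\<forall>x\<in>carrier A. \<forall>y\<in>carrier A. f (x \<otimes>\<^bsub>A\<^esub> y) = f x \<otimes>\<^bsub>B\<^esub> f y) \<and>
     (\<forall>a. \<forall>x\<in>carrier A. f (a \<odot>\<^bsub>A\<^esub> x) = a \<odot>\<^bsub>B\<^esub> f x) \<and>
     (\<forall>x\<in>carrier A. f (adj A x) = adj B (f x))"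

text \<open>An isomorphism of C*-algebras is automatically isometric, so the last clause is harmless.\<close>

definition star_automorphism :: "'a cstar \<Rightarrow> ('a \<Rightarrow> 'a) \<Rightarrow> bool" where
  "star_automorphism A f \<longleftrightarrow> star_hom A A f \<and> bij_betw f (carrier A) (carrier A) \<and>
     (\<forall>x\<in>carrier A. cnorm A (f x) = cnorm A x)"

definition projection :: "'a cstar \<Rightarrow> 'a \<Rightarrow> bool" where
  "projection A p \<longleftrightarrow> p \<in> carrier A \<and> adj A p = p \<and> p \<otimes>\<^bsub>A\<^esub> p = p"

inductive_set lin_span :: "'a cstar \<Rightarrow> 'a set \<Rightarrow> 'a set" for A :: "'a cstar" and S :: "'a set" where
  zero: "\<zero>\<^bsub>A\<^esub> \<in> lin_span A S"
| add_scaled: "x \<in> S \<Longrightarrow> y \<in> lin_span A S \<Longrightarrow> (a \<odot>\<^bsub>A\<^esub> x) \<oplus>\<^bsub>A\<^esub> y \<in> lin_span A S"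

definition closed_span :: "'a cstar \<Rightarrow> 'a set \<Rightarrow> 'a set" where
  "closed_span A S =
     {x \<in> carrier A. \<forall>\<epsilon>>0. \<exists>y\<in>lin_span A S. cnorm A (x \<ominus>\<^bsub>A\<^esub> y) < \<epsilon>}"

subsection \<open>States\<close>

text \<open>
  Functionals on \<open>A\<close> are extensional HOL functions, so that functionals which agree on
  \<open>carrier A\<close> are equal.
\<close>

definition linear_functional :: "'a cstar \<Rightarrow> ('a \<Rightarrow> complex) \<Rightarrow> bool" where
  "linear_functional A \<phi> \<longleftrightarrow> \<phi> \<in> extensional (carrier A) \<and>
     (\<forall>x\<in>carrier A. \<forall>y\<in>carrier A. \<phi> (x \<oplus>\<^bsub>A\<^esub> y) = \<phi> x + \<phi> y) \<and>
     (\<forall>a. \<forall>x\<in>carrier A. \<phi> (a \<odot>\<^bsub>A\<^esub> x) = a * \<phi> x)"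

definition state :: "'a cstar \<Rightarrow> ('a \<Rightarrow> complex) \<Rightarrow> bool" where
  "state A \<phi> \<longleftrightarrow> linear_functional A \<phi> \<and>
     (\<forall>x\<in>carrier A. \<phi> (adj A x \<otimes>\<^bsub>A\<^esub> x) \<in> \<real>\<^sub>\<ge>\<^sub>0) \<and>
     bdd_above {cmod (\<phi> x) |x. x \<in> carrier A \<and> cnorm A x \<le> 1} \<and>
     Sup {cmod (\<phi> x) |x. x \<in> carrier A \<and> cnorm A x \<le> 1} = 1"

definition tracial_state :: "'a cstar \<Rightarrow> ('a \<Rightarrow> complex) \<Rightarrow> bool" where
  "tracial_state A \<tau> \<longleftrightarrow> state A \<tau> \<and>
     (\<forall>x\<in>carrier A. \<forall>y\<in>carrier A. \<tau> (x \<otimes>\<^bsub>A\<^esub> y) = \<tau> (y \<otimes>\<^bsub>A\<^esub> x))"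

subsection \<open>One-parameter groups, analytic elements and ground states\<close>

definition one_parameter_group :: "'a cstar \<Rightarrow> (real \<Rightarrow> 'a \<Rightarrow> 'a) \<Rightarrow> bool" where
  "one_parameter_group A \<sigma> \<longleftrightarrow>
     (\<forall>t. star_automorphism A (\<sigma> t)) \<and>
     (\<forall>x\<in>carrier A. \<sigma> 0 x = x) \<and>
     (\<forall>t u. \<forall>x\<in>carrier A. \<sigma> (t + u) x = \<sigma> t (\<sigma> u x)) \<and>
     (\<forall>x\<in>carrier A. \<forall>t. ((\<lambda>u. cnorm A (\<sigma> u x \<ominus>\<^bsub>A\<^esub> \<sigma> t x)) \<longlongrightarrow> 0) (at t))"

definition entire_into :: "'a cstar \<Rightarrow> (complex \<Rightarrow> 'a) \<Rightarrow> bool" where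
  "entire_into A F \<longleftrightarrow> (\<forall>z. F z \<in> carrier A) \<and>
     (\<forall>z. \<exists>d\<in>carrier A.
        ((\<lambda>w. cnorm A (inverse (w - z) \<odot>\<^bsub>A\<^esub> (F w \<ominus>\<^bsub>A\<^esub> F z) \<ominus>\<^bsub>A\<^esub> d)) \<longlongrightarrow> 0) (at z))"

text \<open>
  \<open>F\<close> is the entire function \<open>\<zeta> \<mapsto> \<sigma>\<^sub>\<zeta>(b)\<close>; by the identity theorem there is at most one such \<open>F\<close>.
\<close>

definition entire_extension :: "'a cstar \<Rightarrow> (real \<Rightarrow> 'a \<Rightarrow> 'a) \<Rightarrow> 'a \<Rightarrow> (complex \<Rightarrow> 'a) \<Rightarrow> bool" where
  "entire_extension A \<sigma> b F \<longleftrightarrow> entire_into A F \<and> (\<forall>t. F (complex_of_real t) = \<sigma> t b)"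

definition analytic_elements :: "'a cstar \<Rightarrow> (real \<Rightarrow> 'a \<Rightarrow> 'a) \<Rightarrow> 'a set" where
  "analytic_elements A \<sigma> = {b \<in> carrier A. \<exists>F. entire_extension A \<sigma> b F}"

definition ground_state :: "'a cstar \<Rightarrow> (real \<Rightarrow> 'a \<Rightarrow> 'a) \<Rightarrow> ('a \<Rightarrow> complex) \<Rightarrow> bool" where
  "ground_state A \<sigma> \<phi> \<longleftrightarrow> state A \<phi> \<and>
     (\<forall>a\<in>analytic_elements A \<sigma>. \<forall>b\<in>analytic_elements A \<sigma>. \<forall>F. entire_extension A \<sigma> b F \<longrightarrow>
        (\<exists>K. \<forall>\<zeta>. Im \<zeta> \<ge> 0 \<longrightarrow> cmod (\<phi> (a \<otimes>\<^bsub>A\<^esub> F \<zeta>)) \<le> K))"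

section \<open>Universal C*-algebras\<close>

subsection \<open>The free *-algebra\<close>

text \<open>
  A word is a list of letters \<open>(g, False)\<close>, standing for the generator \<open>g\<close>, and \<open>(g, True)\<close>,
  standing for its adjoint.  With concatenation as addition of exponents, the type of finitely
  supported functions on words is the free unital *-algebra; the free (non-unital) *-algebra
  consists of the elements in which the empty word does not occur.
\<close>

datatype 'g word = Word (letters: "('g \<times> bool) list")

instantiation word :: (type) monoid_add
begin

definition zero_word :: "'a word" where
  "0 = Word []"

definition plus_word :: "'a word \<Rightarrow> 'a word \<Rightarrow> 'a word" where
  "u + w = Word (letters u @ letters w)"

instance
  by standard (auto simp: zero_word_def plus_word_def)

end

type_synonym 'g free = "'g word \<Rightarrow>\<^sub>0 complex"

definition word_adj :: "'g word \<Rightarrow> 'g word" where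
  "word_adj w = Word (rev (map (\<lambda>(g, b). (g, \<not> b)) (letters w)))"

definition free_adj :: "'g free \<Rightarrow> 'g free" where
  "free_adj x = Poly_Mapping.map_key word_adj (Poly_Mapping.map cnj x)"

definition free_scale :: "complex \<Rightarrow> 'g free \<Rightarrow> 'g free" where
  "free_scale a x = Poly_Mapping.map ((*) a) x"

definition free_algebra :: "'g free set" where
  "free_algebra = {x. 0 \<notin> Poly_Mapping.keys x}"

definition free_gen :: "'g \<Rightarrow> 'g free" where
  "free_gen g = Poly_Mapping.single (Word [(g, False)]) 1"

subsection \<open>Completion with respect to a C*-seminorm\<close>

definition cstar_seminorm :: "('g free \<Rightarrow> real) \<Rightarrow> bool" where
  "cstar_seminorm N \<longleftrightarrow>
     (\<forall>x\<in>free_algebra. 0 \<le> N x) \<and>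
     (\<forall>x\<in>free_algebra. \<forall>y\<in>free_algebra. N (x + y) \<le> N x + N y) \<and>
     (\<forall>a. \<forall>x\<in>free_algebra. N (free_scale a x) = cmod a * N x) \<and>
     (\<forall>x\<in>free_algebra. \<forall>y\<in>free_algebra. N (x * y) \<le> N x * N y) \<and>
     (\<forall>x\<in>free_algebra. N (free_adj x * x) = (N x)\<^sup>2)"

definition cauchy_seqs :: "('g free \<Rightarrow> real) \<Rightarrow> (nat \<Rightarrow> 'g free) set" where
  "cauchy_seqs N = {X. (\<forall>n. X n \<in> free_algebra) \<and>
     (\<forall>\<epsilon>>0. \<exists>M. \<forall>m\<ge>M. \<forall>n\<ge>M. N (X m - X n) < \<epsilon>)}"

definition null_rel :: "('g free \<Rightarrow> real) \<Rightarrow> ((nat \<Rightarrow> 'g free) \<times> (nat \<Rightarrow> 'g free)) set" where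
  "null_rel N = {(X, Y). X \<in> cauchy_seqs N \<and> Y \<in> cauchy_seqs N \<and> (\<lambda>n. N (X n - Y n)) \<longlonglongrightarrow> 0}"

text \<open>
  The Hausdorff completion of the free *-algebra: Cauchy sequences modulo null sequences, with
  the operations induced by the termwise ones.
\<close>

definition free_completion :: "('g free \<Rightarrow> real) \<Rightarrow> (nat \<Rightarrow> 'g free) set cstar" where
  "free_completion N =
     \<lparr> carrier = cauchy_seqs N // null_rel N,
       mult = (\<lambda>A B. \<Union>X\<in>A. \<Union>Y\<in>B. null_rel N `` {\<lambda>n. X n * Y n}),
       one = undefined,
       zero = null_rel N `` {\<lambda>n. 0},
       add = (\<lambda>A B. \<Union>X\<in>A. \<Union>Y\<in>B. null_rel N `` {\<lambda>n. X n + Y n}),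
       smult = (\<lambda>a A. \<Union>X\<in>A. null_rel N `` {\<lambda>n. free_scale a (X n)}),
       adj = (\<lambda>A. \<Union>X\<in>A. null_rel N `` {\<lambda>n. free_adj (X n)}),
       cnorm = (\<lambda>A. the_elem ((\<lambda>X. lim (\<lambda>n. N (X n))) ` A)) \<rparr>"

text \<open>
  The universal C*-algebra on generators \<open>'g\<close> subject to the relations \<open>x = 0\<close> for \<open>x \<in> R\<close>.  Every
  family in a C*-algebra which satisfies the relations yields an admissible seminorm on the free
  *-algebra, and conversely; the supremum is finite whenever the relations bound the generators.
\<close>

definition admissible_seminorms :: "'g free set \<Rightarrow> ('g free \<Rightarrow> real) set" where
  "admissible_seminorms R = {N. cstar_seminorm N \<and> (\<forall>x\<in>R. N x = 0)}"

definition universal_seminorm :: "'g free set \<Rightarrow> 'g free \<Rightarrow> real" where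
  "universal_seminorm R x = (SUP N\<in>admissible_seminorms R. N x)"

definition universal_cstar :: "'g free set \<Rightarrow> (nat \<Rightarrow> 'g free) set cstar" where
  "universal_cstar R = free_completion (universal_seminorm R)"

definition universal_gen :: "'g free set \<Rightarrow> 'g \<Rightarrow> (nat \<Rightarrow> 'g free) set" where
  "universal_gen R g = null_rel (universal_seminorm R) `` {\<lambda>n. free_gen g}"

section \<open>Graph C*-algebras\<close>

text \<open>The sets of vertices and edges are the (nonempty, otherwise arbitrary) types \<open>'v\<close> and \<open>'e\<close>.\<close>

record ('v, 'e) graph =
  rng :: "'e \<Rightarrow> 'v"
  src :: "'e \<Rightarrow> 'v"

definition singular_vertex :: "('v, 'e) graph \<Rightarrow> 'v \<Rightarrow> bool" where
  "singular_vertex E v \<longleftrightarrow> {e. rng E e = v} = {} \<or> infinite {e. rng E e = v}"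

text \<open>For projections, \<open>q \<le> p\<close> is expressed as \<open>p q = q\<close>.\<close>

definition graph_family ::
  "('v, 'e) graph \<Rightarrow> 'a cstar \<Rightarrow> ('v \<Rightarrow> 'a) \<Rightarrow> ('e \<Rightarrow> 'a) \<Rightarrow> bool" where
  "graph_family E A p s \<longleftrightarrow>
     (\<forall>v. projection A (p v)) \<and>
     (\<forall>v w. v \<noteq> w \<longrightarrow> p v \<otimes>\<^bsub>A\<^esub> p w = \<zero>\<^bsub>A\<^esub>) \<and>
     (\<forall>e. s e \<in> carrier A \<and> s e \<otimes>\<^bsub>A\<^esub> adj A (s e) \<otimes>\<^bsub>A\<^esub> s e = s e) \<and>
     (\<forall>e f. e \<noteq> f \<longrightarrow> (s e \<otimes>\<^bsub>A\<^esub> adj A (s e)) \<otimes>\<^bsub>A\<^esub> (s f \<otimes>\<^bsub>A\<^esub> adj A (s f)) = \<zero>\<^bsub>A\<^esub>) \<and>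
     (\<forall>e. adj A (s e) \<otimes>\<^bsub>A\<^esub> s e = p (src E e)) \<and>
     (\<forall>e. p (rng E e) \<otimes>\<^bsub>A\<^esub> (s e \<otimes>\<^bsub>A\<^esub> adj A (s e)) = s e \<otimes>\<^bsub>A\<^esub> adj A (s e)) \<and>
     (\<forall>v. \<not> singular_vertex E v \<longrightarrow>
        p v = (\<Oplus>\<^bsub>A\<^esub>e\<in>{e. rng E e = v}. s e \<otimes>\<^bsub>A\<^esub> adj A (s e)))"

abbreviation free_p :: "'v \<Rightarrow> ('v + 'e) free" where
  "free_p v \<equiv> free_gen (Inl v)"

abbreviation free_s :: "'e \<Rightarrow> ('v + 'e) free" where
  "free_s e \<equiv> free_gen (Inr e)"

definition graph_relations :: "('v, 'e) graph \<Rightarrow> ('v + 'e) free set" where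
  "graph_relations E =
     {free_adj (free_p v) - free_p v |v. True} \<union>
     {free_p v * free_p v - free_p v |v. True} \<union>
     {free_p v * free_p w |v w. v \<noteq> w} \<union>
     {free_s e * free_adj (free_s e) * free_s e - free_s e |e. True} \<union>
     {(free_s e * free_adj (free_s e)) * (free_s f * free_adj (free_s f)) |e f. e \<noteq> f} \<union>
     {free_adj (free_s e) * free_s e - free_p (src E e) |e. True} \<union>
     {free_p (rng E e) * (free_s e * free_adj (free_s e)) - free_s e * free_adj (free_s e) |e. True} \<union>
     {free_p v - (\<Sum>e\<in>{e. rng E e = v}. free_s e * free_adj (free_s e)) |v. \<not> singular_vertex E v}"

definition graph_cstar :: "('v, 'e) graph \<Rightarrow> (nat \<Rightarrow> ('v + 'e) free) set cstar" where
  "graph_cstar E = universal_cstar (graph_relations E)"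

definition vertex_proj :: "('v, 'e) graph \<Rightarrow> 'v \<Rightarrow> (nat \<Rightarrow> ('v + 'e) free) set" where
  "vertex_proj E v = universal_gen (graph_relations E) (Inl v)"

definition edge_isom :: "('v, 'e) graph \<Rightarrow> 'e \<Rightarrow> (nat \<Rightarrow> ('v + 'e) free) set" where
  "edge_isom E e = universal_gen (graph_relations E) (Inr e)"

definition vertex_algebra :: "('v, 'e) graph \<Rightarrow> (nat \<Rightarrow> ('v + 'e) free) set cstar" where
  "vertex_algebra E =
     (graph_cstar E)\<lparr>carrier := closed_span (graph_cstar E) (range (vertex_proj E))\<rparr>"

definition vertex_support ::
  "('v, 'e) graph \<Rightarrow> ((nat \<Rightarrow> ('v + 'e) free) set \<Rightarrow> complex) \<Rightarrow> 'v set" where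
  "vertex_support E \<tau> = {v. \<tau> (vertex_proj E v) \<noteq> 0}"

definition graph_action ::
  "('v, 'e) graph \<Rightarrow> ('e \<Rightarrow> real) \<Rightarrow>
     (real \<Rightarrow> (nat \<Rightarrow> ('v + 'e) free) set \<Rightarrow> (nat \<Rightarrow> ('v + 'e) free) set) \<Rightarrow> bool" where
  "graph_action E c \<sigma> \<longleftrightarrow> one_parameter_group (graph_cstar E) \<sigma> \<and>
     (\<forall>t v. \<sigma> t (vertex_proj E v) = vertex_proj E v) \<and>
     (\<forall>t e. \<sigma> t (edge_isom E e) =
        (complex_of_real (c e) powr (\<i> * complex_of_real t)) \<odot>\<^bsub>graph_cstar E\<^esub> edge_isom E e)"

section \<open>The universal property of graph C*-algebras\<close>

text \<open>
  The construction above is justified as follows: \<open>graph_cstar E\<close> is a C*-algebra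
  (\<open>cstar_algebra_graph\<close>), \<open>vertex_proj E\<close> and \<open>edge_isom E\<close> satisfy the defining relations
  (\<open>graph_family_graph\<close>) and generate (\<open>graph_induct\<close>), every family satisfying the relations
  in an arbitrary C*-algebra is the image of this one under a *-homomorphism
  (\<open>graph_universal_property\<close>), and the action \<open>\<sigma>\<^sup>c\<close> exists (\<open>graph_action_exists\<close>).
\<close>

subsection \<open>The free *-algebra\<close>

lemma letters_simps [simp]: "letters 0 = []" "letters (u + w) = letters u @ letters w"
  by (auto simp: zero_word_def plus_word_def)

lemma word_eq_iff: "u = w \<longleftrightarrow> letters u = letters w"
  by (cases u; cases w) auto

lemma word_adj_simps [simp]:
  "word_adj (word_adj w) = w" "word_adj (u + w) = word_adj w + word_adj u"
  "word_adj 0 = 0"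
  by (auto simp: word_adj_def word_eq_iff rev_map comp_def case_prod_unfold)

lemma inj_word_adj: "inj word_adj"
  by (metis injI word_adj_simps(1))

lemma add_word_eq_0 [simp]: "u + w = 0 \<longleftrightarrow> u = 0 \<and> w = (0 :: 'g word)"
  by (auto simp: word_eq_iff)

lemma word_adj_eq_0 [simp]: "word_adj w = 0 \<longleftrightarrow> w = 0"
  by (metis word_adj_simps(1,3))

lemma lookup_free_adj [simp]:
  "Poly_Mapping.lookup (free_adj x) w = cnj (Poly_Mapping.lookup x (word_adj w))"
  unfolding free_adj_def
  by (simp add: Poly_Mapping.map_key.rep_eq[OF inj_word_adj] Poly_Mapping.map.rep_eq when_def)

lemma free_scale_eq: "free_scale a x = Poly_Mapping.single 0 a * x"
  unfolding free_scale_def by (rule mult_map_scale_conv_mult)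

lemma lookup_free_scale [simp]:
  "Poly_Mapping.lookup (free_scale a x) w = a * Poly_Mapping.lookup x w"
  unfolding free_scale_def by (simp add: Poly_Mapping.map.rep_eq when_def)

lemma poly_mapping_induct [case_names zero single_add]:
  fixes x :: "'a \<Rightarrow>\<^sub>0 'b :: comm_monoid_add"
  assumes "P 0" and "\<And>w a x. P x \<Longrightarrow> P (Poly_Mapping.single w a + x)"
  shows "P x"
proof (induction x rule: update_induct)
  case const
  show ?case by (fact assms(1))
next
  case (update f a b)
  have "Poly_Mapping.update a b f = Poly_Mapping.single a b + f"
    using update(1)
    by (intro poly_mapping_eqI) (auto simp: lookup_update lookup_add lookup_single when_def in_keys_iff)
  then show ?case using assms(2) update(3) by simp
qed

lemma free_adj_simps [simp]:
  "free_adj (x + y) = free_adj x + free_adj y"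
  "free_adj (x - y) = free_adj x - free_adj y"
  "free_adj 0 = 0"
  "free_adj (free_adj x) = x"
  "free_adj (Poly_Mapping.single w a) = Poly_Mapping.single (word_adj w) (cnj a)"
  by (intro poly_mapping_eqI; auto simp: lookup_add lookup_minus lookup_single when_def)+

lemma free_adj_mult [simp]: "free_adj (x * y) = free_adj y * free_adj x"
proof (induction x rule: poly_mapping_induct)
  case (single_add w a x)
  have "free_adj (Poly_Mapping.single w a * y) = free_adj y * free_adj (Poly_Mapping.single w a)"
  proof (induction y rule: poly_mapping_induct)
    case (single_add v b y)
    then show ?case by (simp add: distrib_left distrib_right mult_single mult.commute)
  qed simp
  then show ?case using single_add by (simp add: distrib_left distrib_right)
qed simp

lemma free_adj_scale [simp]: "free_adj (free_scale a x) = free_scale (cnj a) (free_adj x)"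
  by (intro poly_mapping_eqI) simp

lemma free_scale_simps:
  "free_scale a (x + y) = free_scale a x + free_scale a y"
  "free_scale a (x - y) = free_scale a x - free_scale a y"
  "free_scale (a + b) x = free_scale a x + free_scale b x"
  "free_scale a (free_scale b x) = free_scale (a * b) x"
  "free_scale 1 x = x"
  "free_scale (-1) x = - x"
  "free_scale 0 x = 0"
  by (intro poly_mapping_eqI; simp add: lookup_add lookup_minus algebra_simps)+

lemma free_scale_mult_left: "free_scale a x * y = free_scale a (x * y)"
  by (simp add: free_scale_eq mult.assoc)

lemma free_scale_mult_right: "x * free_scale a y = free_scale a (x * y)"
proof (induction x rule: poly_mapping_induct)
  case (single_add w b x)
  have "Poly_Mapping.single w b * free_scale a y = free_scale a (Poly_Mapping.single w b * y)"
    by (simp add: free_scale_eq mult.assoc[symmetric] mult_single mult.commute)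
  then show ?case using single_add by (simp add: distrib_right free_scale_simps)
qed (simp add: free_scale_eq)

lemma free_algebra_iff: "x \<in> free_algebra \<longleftrightarrow> Poly_Mapping.lookup x 0 = 0"
  by (simp add: free_algebra_def in_keys_iff)

lemma free_algebra_closed [simp, intro]:
  "0 \<in> free_algebra"
  "x \<in> free_algebra \<Longrightarrow> y \<in> free_algebra \<Longrightarrow> x + y \<in> free_algebra"
  "x \<in> free_algebra \<Longrightarrow> y \<in> free_algebra \<Longrightarrow> x - y \<in> free_algebra"
  "x \<in> free_algebra \<Longrightarrow> - x \<in> free_algebra"
  "x \<in> free_algebra \<Longrightarrow> free_scale a x \<in> free_algebra"
  "x \<in> free_algebra \<Longrightarrow> free_adj x \<in> free_algebra"
  by (auto simp: free_algebra_iff lookup_add lookup_minus)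

lemma free_gen_closed [simp, intro]: "free_gen g \<in> free_algebra"
  by (auto simp: free_algebra_iff free_gen_def lookup_single when_def zero_word_def)

lemma free_algebra_mult [simp, intro]:
  assumes "x \<in> free_algebra" "y \<in> free_algebra"
  shows "x * y \<in> free_algebra"
  using assms keys_mult[of x y] unfolding free_algebra_def by (fastforce dest: sym)

lemma free_algebra_sum [intro]:
  "(\<And>i. i \<in> I \<Longrightarrow> f i \<in> free_algebra) \<Longrightarrow> sum f I \<in> free_algebra"
  by (induction I rule: infinite_finite_induct) auto

lemma free_algebra_induct [consumes 1, case_names gen adj_gen mult zero add scale]:
  assumes "x \<in> free_algebra"
    and gen: "\<And>g. P (free_gen g)" and adj: "\<And>g. P (free_adj (free_gen g))"
    and mult: "\<And>x y. x \<in> free_algebra \<Longrightarrow> y \<in> free_algebra \<Longrightarrow> P x \<Longrightarrow> P y \<Longrightarrow> P (x * y)"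
    and zero: "P 0"
    and add: "\<And>x y. x \<in> free_algebra \<Longrightarrow> y \<in> free_algebra \<Longrightarrow> P x \<Longrightarrow> P y \<Longrightarrow> P (x + y)"
    and scale: "\<And>a x. x \<in> free_algebra \<Longrightarrow> P x \<Longrightarrow> P (free_scale a x)"
  shows "P x"
proof -
  have letter: "P (Poly_Mapping.single (Word [l]) 1)" for l :: "'a \<times> bool"
  proof (cases l)
    case (Pair g b)
    then show ?thesis
      using gen[of g] adj[of g] by (cases b) (simp_all add: free_gen_def word_adj_def)
  qed
  have mem: "Poly_Mapping.single w a \<in> free_algebra" if "w \<noteq> 0" for w :: "'a word" and a
    using that by (simp add: free_algebra_iff lookup_single when_def)
  have word: "P (Poly_Mapping.single (Word (l # ls)) 1)" for l and ls :: "('a \<times> bool) list"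
  proof (induction ls arbitrary: l)
    case Nil
    then show ?case by (rule letter)
  next
    case (Cons l' ls)
    have "Poly_Mapping.single (Word (l # l' # ls)) (1 :: complex) =
        Poly_Mapping.single (Word [l]) 1 * Poly_Mapping.single (Word (l' # ls)) 1"
      by (simp add: mult_single plus_word_def)
    also have "P \<dots>"
      by (intro mult letter Cons mem) (auto simp: zero_word_def)
    finally show ?case .
  qed
  have single: "P (Poly_Mapping.single w a)" if w0: "w \<noteq> 0" for w a
  proof -
    obtain l ls where "w = Word (l # ls)"
      using w0 by (cases w; cases "letters w") (auto simp: zero_word_def)
    then have "P (free_scale a (Poly_Mapping.single w 1))"
      using word mem[OF w0] by (intro scale) auto
    then show ?thesis by (simp add: free_scale_eq mult_single)
  qed
  show ?thesis using assms(1)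
  proof (induction x rule: update_induct)
    case const
    show ?case by (fact zero)
  next
    case (update f w a)
    have eq: "Poly_Mapping.update w a f = Poly_Mapping.single w a + f"
      using update(1)
      by (intro poly_mapping_eqI) (auto simp: lookup_update lookup_add lookup_single when_def in_keys_iff)
    have "w \<noteq> 0" using update(2,4) by (auto simp: free_algebra_iff lookup_update)
    moreover have "f \<in> free_algebra"
      using update(4) \<open>w \<noteq> 0\<close> by (auto simp: free_algebra_iff lookup_update)
    ultimately show ?case unfolding eq using update(3) mem single by (intro add) auto
  qed
qed

lemma cstar_seminormD:
  assumes "cstar_seminorm N"
  shows "x \<in> free_algebra \<Longrightarrow> 0 \<le> N x"
    and "x \<in> free_algebra \<Longrightarrow> y \<in> free_algebra \<Longrightarrow> N (x + y) \<le> N x + N y"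
    and "x \<in> free_algebra \<Longrightarrow> N (free_scale a x) = cmod a * N x"
    and "x \<in> free_algebra \<Longrightarrow> y \<in> free_algebra \<Longrightarrow> N (x * y) \<le> N x * N y"
    and "x \<in> free_algebra \<Longrightarrow> N (free_adj x * x) = (N x)\<^sup>2"
  using assms unfolding cstar_seminorm_def by blast+

locale cstar_seminormed =
  fixes N :: "'g free \<Rightarrow> real"
  assumes N: "cstar_seminorm N"
begin

lemmas N_nonneg = cstar_seminormD(1)[OF N]
lemmas N_add = cstar_seminormD(2)[OF N]
lemmas N_scale = cstar_seminormD(3)[OF N]
lemmas N_mult = cstar_seminormD(4)[OF N]
lemmas N_square = cstar_seminormD(5)[OF N]

lemma N_zero [simp]: "N 0 = 0"
  using N_scale[of 0 0] by (simp add: free_scale_simps)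

lemma N_minus: "x \<in> free_algebra \<Longrightarrow> N (- x) = N x"
  using N_scale[of x "-1"] by (simp add: free_scale_simps)

lemma N_diff_commute: "x \<in> free_algebra \<Longrightarrow> y \<in> free_algebra \<Longrightarrow> N (x - y) = N (y - x)"
  using N_minus[of "x - y"] by simp

lemma N_diff: "x \<in> free_algebra \<Longrightarrow> y \<in> free_algebra \<Longrightarrow> N (x - y) \<le> N x + N y"
  using N_add[of x "- y"] N_minus[of y] by simp

lemma N_tri: "x \<in> free_algebra \<Longrightarrow> y \<in> free_algebra \<Longrightarrow> z \<in> free_algebra \<Longrightarrow>
    N (x - z) \<le> N (x - y) + N (y - z)"
  using N_add[of "x - y" "y - z"] by simp

lemma N_abs_diff:
  assumes "x \<in> free_algebra" "y \<in> free_algebra"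
  shows "\<bar>N x - N y\<bar> \<le> N (x - y)"
  using N_add[of "x - y" y] N_add[of "y - x" x] N_diff_commute[of x y] assms by simp

lemma N_adj:
  assumes x: "x \<in> free_algebra"
  shows "N (free_adj x) = N x"
proof -
  have "N y \<le> N (free_adj y)" if y: "y \<in> free_algebra" for y
  proof (cases "N y = 0")
    case True
    then show ?thesis using N_nonneg y by simp
  next
    case False
    have "(N y)\<^sup>2 \<le> N (free_adj y) * N y"
      using N_square[OF y] N_mult[of "free_adj y" y] y by simp
    then show ?thesis using False N_nonneg[OF y]
      by (simp add: power2_eq_square)
  qed
  from this[of x] this[of "free_adj x"] x show ?thesis by simp
qed

lemma N_mult_diff:
  assumes "x \<in> free_algebra" "y \<in> free_algebra" "x' \<in> free_algebra" "y' \<in> free_algebra"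
  shows "N (x * y - x' * y') \<le> N (x - x') * N y + N x' * N (y - y')"
proof -
  have "x * y - x' * y' = (x - x') * y + x' * (y - y')" by (simp add: algebra_simps)
  then have "N (x * y - x' * y') \<le> N ((x - x') * y) + N (x' * (y - y'))"
    using assms by (auto intro!: N_add)
  also have "\<dots> \<le> N (x - x') * N y + N x' * N (y - y')"
    using assms by (intro add_mono N_mult) auto
  finally show ?thesis .
qed

lemma csD:
  assumes "X \<in> cauchy_seqs N"
  shows "X n \<in> free_algebra"
    and "\<epsilon> > 0 \<Longrightarrow> \<exists>M. \<forall>m\<ge>M. \<forall>n\<ge>M. N (X m - X n) < \<epsilon>"
  using assms unfolding cauchy_seqs_def by blast+

lemma csI:
  assumes "\<And>n. X n \<in> free_algebra"
    and "\<And>\<epsilon>. \<epsilon> > 0 \<Longrightarrow> \<exists>M. \<forall>m\<ge>M. \<forall>n\<ge>M. N (X m - X n) < \<epsilon>"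
  shows "X \<in> cauchy_seqs N"
  using assms unfolding cauchy_seqs_def by blast

lemma cs_const [simp, intro]: "x \<in> free_algebra \<Longrightarrow> (\<lambda>n. x) \<in> cauchy_seqs N"
  by (rule csI) auto

lemma cs_conv:
  assumes X: "X \<in> cauchy_seqs N"
  shows "(\<lambda>n. N (X n)) \<longlonglongrightarrow> lim (\<lambda>n. N (X n))"
proof -
  have "Cauchy (\<lambda>n. N (X n))"
  proof (rule metric_CauchyI)
    fix e :: real assume "0 < e"
    then obtain M where "\<forall>m\<ge>M. \<forall>n\<ge>M. N (X m - X n) < e" using csD(2)[OF X] by blast
    then show "\<exists>M. \<forall>m\<ge>M. \<forall>n\<ge>M. dist (N (X m)) (N (X n)) < e"
      using N_abs_diff[OF csD(1)[OF X] csD(1)[OF X]] unfolding dist_real_def by (meson le_less_trans)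
  qed
  then show ?thesis using Cauchy_convergent_iff convergent_LIMSEQ_iff by blast
qed

lemma cs_bounded:
  assumes X: "X \<in> cauchy_seqs N"
  obtains K where "K > 0" "\<And>n. N (X n) \<le> K"
proof -
  have "Bseq (\<lambda>n. N (X n))"
    using cs_conv[OF X] convergent_imp_Bseq convergentI by blast
  then obtain K where "K > 0" "\<And>n. \<bar>N (X n)\<bar> \<le> K" unfolding Bseq_def by auto
  then show ?thesis using that by (meson abs_le_D1)
qed

lemma cs_op:
  assumes "X \<in> cauchy_seqs N" "Y \<in> cauchy_seqs N"
    and "\<And>n. Z n \<in> free_algebra"
    and "\<And>m n. N (Z m - Z n) \<le> a * N (X m - X n) + b * N (Y m - Y n)"
    and "a \<ge> 0" "b \<ge> 0"
  shows "Z \<in> cauchy_seqs N"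
proof (rule csI)
  fix \<epsilon> :: real assume e: "\<epsilon> > 0"
  define \<delta> where "\<delta> = \<epsilon> / (a + b + 1)"
  have d: "\<delta> > 0" "a * \<delta> + b * \<delta> < \<epsilon>"
  proof -
    show d: "\<delta> > 0" using e assms(5,6) by (simp add: \<delta>_def add_nonneg_pos)
    have "(a + b + 1) * \<delta> = \<epsilon>" using assms(5,6) by (simp add: \<delta>_def)
    then show "a * \<delta> + b * \<delta> < \<epsilon>" using d by (simp add: algebra_simps)
  qed
  obtain M1 M2 where M: "\<forall>m\<ge>M1. \<forall>n\<ge>M1. N (X m - X n) < \<delta>"
    "\<forall>m\<ge>M2. \<forall>n\<ge>M2. N (Y m - Y n) < \<delta>"
    using csD(2)[OF assms(1) d(1)] csD(2)[OF assms(2) d(1)] by blast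
  have "N (Z m - Z n) < \<epsilon>" if "m \<ge> max M1 M2" "n \<ge> max M1 M2" for m n
  proof -
    have "N (X m - X n) \<le> \<delta>" "N (Y m - Y n) \<le> \<delta>" using M that by (simp_all add: less_imp_le)
    then have "a * N (X m - X n) + b * N (Y m - Y n) \<le> a * \<delta> + b * \<delta>"
      using assms(5,6) by (intro add_mono mult_left_mono)
    then show ?thesis using assms(4)[of m n] d(2) by linarith
  qed
  then show "\<exists>M. \<forall>m\<ge>M. \<forall>n\<ge>M. N (Z m - Z n) < \<epsilon>" by blast
qed (use assms in auto)

lemma cs_add [intro]:
  assumes "X \<in> cauchy_seqs N" "Y \<in> cauchy_seqs N"
  shows "(\<lambda>n. X n + Y n) \<in> cauchy_seqs N"
proof (rule cs_op[where a = 1 and b = 1, OF assms])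
  show "N (X m + Y m - (X n + Y n)) \<le> 1 * N (X m - X n) + 1 * N (Y m - Y n)" for m n
    using N_add[of "X m - X n" "Y m - Y n"] csD(1) assms by (simp add: algebra_simps)
qed (use csD(1) assms in auto)

lemma cs_scale [intro]:
  assumes "X \<in> cauchy_seqs N"
  shows "(\<lambda>n. free_scale a (X n)) \<in> cauchy_seqs N"
proof (rule cs_op[where a = "cmod a" and b = 0, OF assms assms])
  show "N (free_scale a (X m) - free_scale a (X n)) \<le> cmod a * N (X m - X n) + 0 * N (X m - X n)" for m n
    using N_scale[of "X m - X n" a] csD(1) assms by (simp add: free_scale_simps)
qed (use csD(1) assms in auto)

lemma cs_adj [intro]:
  assumes "X \<in> cauchy_seqs N"
  shows "(\<lambda>n. free_adj (X n)) \<in> cauchy_seqs N"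
proof (rule cs_op[where a = 1 and b = 0, OF assms assms])
  show "N (free_adj (X m) - free_adj (X n)) \<le> 1 * N (X m - X n) + 0 * N (X m - X n)" for m n
    using N_adj[of "X m - X n"] csD(1) assms by simp
qed (use csD(1) assms in auto)

lemma cs_mult [intro]:
  assumes "X \<in> cauchy_seqs N" "Y \<in> cauchy_seqs N"
  shows "(\<lambda>n. X n * Y n) \<in> cauchy_seqs N"
proof -
  obtain K L where K: "K > 0" "\<And>n. N (X n) \<le> K" and L: "L > 0" "\<And>n. N (Y n) \<le> L"
    using cs_bounded assms by metis
  note F = csD(1)[OF assms(1)] csD(1)[OF assms(2)]
  show ?thesis
  proof (rule cs_op[where a = L and b = K, OF assms])
    show "N (X m * Y m - X n * Y n) \<le> L * N (X m - X n) + K * N (Y m - Y n)" for m n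
    proof -
      have "N (X m * Y m - X n * Y n) \<le> N (X m - X n) * N (Y m) + N (X n) * N (Y m - Y n)"
        using F by (intro N_mult_diff)
      also have "\<dots> \<le> N (X m - X n) * L + K * N (Y m - Y n)"
        using F K L N_nonneg by (intro add_mono mult_mono) auto
      finally show ?thesis by (simp add: mult.commute)
    qed
  qed (use F K L in auto)
qed

end

subsection \<open>The completion is a C*-algebra\<close>

context cstar_seminormed begin

lemma null_rel_iff: "(X, Y) \<in> null_rel N \<longleftrightarrow>
    X \<in> cauchy_seqs N \<and> Y \<in> cauchy_seqs N \<and> (\<lambda>n. N (X n - Y n)) \<longlonglongrightarrow> 0"
  by (simp add: null_rel_def)

lemma equiv_null: "equiv (cauchy_seqs N) (null_rel N)"
proof (rule equivI)
  show "null_rel N \<subseteq> cauchy_seqs N \<times> cauchy_seqs N" by (auto simp: null_rel_def)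
  show "refl_on (cauchy_seqs N) (null_rel N)"
    by (auto simp: refl_on_def null_rel_def)
  show "sym (null_rel N)"
  proof (rule symI)
    fix X Y assume XY: "(X, Y) \<in> null_rel N"
    then have "N (X n - Y n) = N (Y n - X n)" for n
      using csD(1) by (intro N_diff_commute) (auto simp: null_rel_iff)
    then show "(Y, X) \<in> null_rel N" using XY by (simp add: null_rel_iff)
  qed
  show "trans (null_rel N)"
  proof (rule transI)
    fix X Y Z assume "(X, Y) \<in> null_rel N" "(Y, Z) \<in> null_rel N"
    then have cs: "X \<in> cauchy_seqs N" "Y \<in> cauchy_seqs N" "Z \<in> cauchy_seqs N"
      and "(\<lambda>n. N (X n - Y n) + N (Y n - Z n)) \<longlonglongrightarrow> 0"
      by (auto simp: null_rel_def intro: tendsto_add_zero)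
    then have "(\<lambda>n. N (X n - Z n)) \<longlonglongrightarrow> 0"
    proof (elim Lim_null_comparison[rotated], intro always_eventually allI)
      fix n
      show "norm (N (X n - Z n)) \<le> N (X n - Y n) + N (Y n - Z n)"
        using N_tri[of "X n" "Y n" "Z n"] N_nonneg[of "X n - Z n"] cs csD(1) by simp
    qed
    then show "(X, Z) \<in> null_rel N" using cs by (simp add: null_rel_def)
  qed
qed

lemma null_op:
  assumes "(X, X') \<in> null_rel N" "(Y, Y') \<in> null_rel N"
    and "Z \<in> cauchy_seqs N" "Z' \<in> cauchy_seqs N"
    and "\<And>n. N (Z n - Z' n) \<le> a * N (X n - X' n) + b * N (Y n - Y' n)"
  shows "(Z, Z') \<in> null_rel N"
proof -
  have "(\<lambda>n. a * N (X n - X' n) + b * N (Y n - Y' n)) \<longlonglongrightarrow> 0"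
    using assms(1,2) unfolding null_rel_iff by (intro tendsto_add_zero tendsto_mult_right_zero) auto
  then have "(\<lambda>n. N (Z n - Z' n)) \<longlonglongrightarrow> 0"
  proof (elim Lim_null_comparison[rotated], intro always_eventually allI)
    fix n
    show "norm (N (Z n - Z' n)) \<le> a * N (X n - X' n) + b * N (Y n - Y' n)"
      using assms(5)[of n] N_nonneg[of "Z n - Z' n"] csD(1)[OF assms(3)] csD(1)[OF assms(4)] by simp
  qed
  then show ?thesis using assms by (simp add: null_rel_iff)
qed

definition "cls X = null_rel N `` {X}"

lemma cls_eq_iff: "X \<in> cauchy_seqs N \<Longrightarrow> Y \<in> cauchy_seqs N \<Longrightarrow>
    cls X = cls Y \<longleftrightarrow> (\<lambda>n. N (X n - Y n)) \<longlonglongrightarrow> 0"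
  unfolding cls_def using eq_equiv_class_iff[OF equiv_null] by (simp add: null_rel_iff)

lemma carrier_completion: "carrier (free_completion N) = cls ` cauchy_seqs N"
  by (auto simp: free_completion_def quotient_def cls_def)

lemma cls_in [simp, intro]: "X \<in> cauchy_seqs N \<Longrightarrow> cls X \<in> carrier (free_completion N)"
  by (simp add: carrier_completion)

lemma zero_completion: "\<zero>\<^bsub>free_completion N\<^esub> = cls (\<lambda>n. 0)"
  by (simp add: free_completion_def cls_def)

lemma add_completion:
  assumes "X \<in> cauchy_seqs N" "Y \<in> cauchy_seqs N"
  shows "cls X \<oplus>\<^bsub>free_completion N\<^esub> cls Y = cls (\<lambda>n. X n + Y n)"
proof -
  have "congruent2 (null_rel N) (null_rel N) (\<lambda>X Y. null_rel N `` {\<lambda>n. X n + Y n})"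
  proof (intro congruent2I' equiv_class_eq[OF equiv_null])
    fix X X' Y Y' assume *: "(X, X') \<in> null_rel N" "(Y, Y') \<in> null_rel N"
    have "N (X n + Y n - (X' n + Y' n)) \<le> 1 * N (X n - X' n) + 1 * N (Y n - Y' n)" for n
      using N_add[of "X n - X' n" "Y n - Y' n"] * csD(1) by (simp add: algebra_simps null_rel_iff)
    then show "((\<lambda>n. X n + Y n), (\<lambda>n. X' n + Y' n)) \<in> null_rel N"
      using * by (intro null_op[where a = 1 and b = 1, OF *]) (auto simp: null_rel_iff)
  qed
  from UN_equiv_class2[OF equiv_null equiv_null this assms] show ?thesis
    by (simp add: free_completion_def cls_def)
qed

lemma mult_completion:
  assumes "X \<in> cauchy_seqs N" "Y \<in> cauchy_seqs N"
  shows "cls X \<otimes>\<^bsub>free_completion N\<^esub> cls Y = cls (\<lambda>n. X n * Y n)"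
proof -
  have "congruent2 (null_rel N) (null_rel N) (\<lambda>X Y. null_rel N `` {\<lambda>n. X n * Y n})"
  proof (intro congruent2I' equiv_class_eq[OF equiv_null])
    fix X X' Y Y' assume *: "(X, X') \<in> null_rel N" "(Y, Y') \<in> null_rel N"
    then have cs: "X \<in> cauchy_seqs N" "X' \<in> cauchy_seqs N" "Y \<in> cauchy_seqs N" "Y' \<in> cauchy_seqs N"
      by (auto simp: null_rel_iff)
    obtain K L where K: "K > 0" "\<And>n. N (X' n) \<le> K" and L: "L > 0" "\<And>n. N (Y n) \<le> L"
      using cs_bounded cs by metis
    have "N (X n * Y n - (X' n * Y' n)) \<le> L * N (X n - X' n) + K * N (Y n - Y' n)" for n
    proof -
      have "N (X n * Y n - X' n * Y' n) \<le> N (X n - X' n) * N (Y n) + N (X' n) * N (Y n - Y' n)"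
        using cs csD(1) by (intro N_mult_diff) auto
      also have "\<dots> \<le> N (X n - X' n) * L + K * N (Y n - Y' n)"
        using cs csD(1) K L N_nonneg by (intro add_mono mult_mono) auto
      finally show ?thesis by (simp add: mult.commute)
    qed
    then show "((\<lambda>n. X n * Y n), (\<lambda>n. X' n * Y' n)) \<in> null_rel N"
      using cs by (intro null_op[where a = L and b = K, OF *]) auto
  qed
  from UN_equiv_class2[OF equiv_null equiv_null this assms] show ?thesis
    by (simp add: free_completion_def cls_def)
qed

lemma scale_completion:
  assumes "X \<in> cauchy_seqs N"
  shows "a \<odot>\<^bsub>free_completion N\<^esub> cls X = cls (\<lambda>n. free_scale a (X n))"
proof -
  have "congruent (null_rel N) (\<lambda>X. null_rel N `` {\<lambda>n. free_scale a (X n)})"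
  proof (intro congruentI equiv_class_eq[OF equiv_null])
    fix X X' assume *: "(X, X') \<in> null_rel N"
    have "N (free_scale a (X n) - free_scale a (X' n)) \<le> cmod a * N (X n - X' n) + 0 * N (X n - X' n)" for n
      using N_scale[of "X n - X' n" a] * csD(1) by (simp add: null_rel_iff free_scale_simps)
    then show "((\<lambda>n. free_scale a (X n)), (\<lambda>n. free_scale a (X' n))) \<in> null_rel N"
      using * by (intro null_op[where a = "cmod a" and b = 0, OF * *]) (auto simp: null_rel_iff)
  qed
  from UN_equiv_class[OF equiv_null this assms] show ?thesis
    by (simp add: free_completion_def cls_def)
qed

lemma adj_completion:
  assumes "X \<in> cauchy_seqs N"
  shows "adj (free_completion N) (cls X) = cls (\<lambda>n. free_adj (X n))"
proof -
  have "congruent (null_rel N) (\<lambda>X. null_rel N `` {\<lambda>n. free_adj (X n)})"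
  proof (intro congruentI equiv_class_eq[OF equiv_null])
    fix X X' assume *: "(X, X') \<in> null_rel N"
    have "N (free_adj (X n) - free_adj (X' n)) \<le> 1 * N (X n - X' n) + 0 * N (X n - X' n)" for n
      using N_adj[of "X n - X' n"] * csD(1) by (simp add: null_rel_iff)
    then show "((\<lambda>n. free_adj (X n)), (\<lambda>n. free_adj (X' n))) \<in> null_rel N"
      using * by (intro null_op[where a = 1 and b = 0, OF * *]) (auto simp: null_rel_iff)
  qed
  from UN_equiv_class[OF equiv_null this assms] show ?thesis
    by (simp add: free_completion_def cls_def)
qed

lemma norm_completion:
  assumes X: "X \<in> cauchy_seqs N"
  shows "cnorm (free_completion N) (cls X) = lim (\<lambda>n. N (X n))"
proof -
  have "lim (\<lambda>n. N (Y n)) = lim (\<lambda>n. N (X n))" if "(X, Y) \<in> null_rel N" for Y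
  proof (rule limI)
    have Y: "Y \<in> cauchy_seqs N" and l: "(\<lambda>n. N (X n - Y n)) \<longlonglongrightarrow> 0"
      using that by (auto simp: null_rel_iff)
    have "(\<lambda>n. N (Y n) - N (X n)) \<longlonglongrightarrow> 0"
    proof (rule Lim_null_comparison[OF _ l], intro always_eventually allI)
      fix n
      show "norm (N (Y n) - N (X n)) \<le> N (X n - Y n)"
        using N_abs_diff[OF csD(1)[OF X] csD(1)[OF Y], of n n] by (simp add: abs_minus_commute)
    qed
    from tendsto_add[OF this cs_conv[OF X]] show "(\<lambda>n. N (Y n)) \<longlonglongrightarrow> lim (\<lambda>n. N (X n))" by simp
  qed
  note lim_eq = this
  have "(\<lambda>X. lim (\<lambda>n. N (X n))) ` cls X = {lim (\<lambda>n. N (X n))}"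
  proof (intro equalityI subsetI)
    fix l assume "l \<in> (\<lambda>X. lim (\<lambda>n. N (X n))) ` cls X"
    then show "l \<in> {lim (\<lambda>n. N (X n))}" using lim_eq by (auto simp: cls_def)
  next
    fix l assume "l \<in> {lim (\<lambda>n. N (X n))}"
    moreover have "X \<in> cls X" using equiv_class_self[OF equiv_null X] by (simp add: cls_def)
    ultimately show "l \<in> (\<lambda>X. lim (\<lambda>n. N (X n))) ` cls X" by blast
  qed
  then show ?thesis by (simp add: free_completion_def)
qed

lemma norm_completion_tendsto:
  "X \<in> cauchy_seqs N \<Longrightarrow> (\<lambda>n. N (X n)) \<longlonglongrightarrow> cnorm (free_completion N) (cls X)"
  using cs_conv norm_completion by simp

lemma abelian_completion: "abelian_group (free_completion N)"
proof (rule abelian_groupI; (unfold carrier_completion)?)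
  fix A assume "A \<in> cls ` cauchy_seqs N"
  then obtain X where X: "X \<in> cauchy_seqs N" "A = cls X" by auto
  have "(\<lambda>n. free_scale (-1) (X n)) \<in> cauchy_seqs N" using X by blast
  then show "\<exists>B\<in>cls ` cauchy_seqs N. B \<oplus>\<^bsub>free_completion N\<^esub> A = \<zero>\<^bsub>free_completion N\<^esub>"
    using X by (intro bexI[of _ "cls (\<lambda>n. free_scale (-1) (X n))"])
      (auto simp: add_completion zero_completion free_scale_simps)
qed (auto simp: add_completion zero_completion cs_add ac_simps)

lemma minus_completion:
  assumes X: "X \<in> cauchy_seqs N" and Y: "Y \<in> cauchy_seqs N"
  shows "cls X \<ominus>\<^bsub>free_completion N\<^esub> cls Y = cls (\<lambda>n. X n - Y n)"
    and "(\<lambda>n. X n - Y n) \<in> cauchy_seqs N"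
proof -
  interpret abelian_group "free_completion N" by (rule abelian_completion)
  have Y': "(\<lambda>n. - Y n) \<in> cauchy_seqs N"
    using cs_scale[OF Y, of "-1"] by (simp add: free_scale_simps)
  have "\<ominus>\<^bsub>free_completion N\<^esub> cls Y = cls (\<lambda>n. - Y n)"
    using Y Y' by (intro minus_equality) (auto simp: add_completion zero_completion)
  then show "cls X \<ominus>\<^bsub>free_completion N\<^esub> cls Y = cls (\<lambda>n. X n - Y n)"
    using X Y' by (simp add: a_minus_def add_completion)
  show "(\<lambda>n. X n - Y n) \<in> cauchy_seqs N"
    using cs_add[OF X Y'] by simp
qed

lemma complete_completion:
  assumes carr: "\<And>n. A n \<in> carrier (free_completion N)"
    and cau: "\<And>\<epsilon>. \<epsilon> > 0 \<Longrightarrow>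
        \<exists>M. \<forall>m\<ge>M. \<forall>n\<ge>M. cnorm (free_completion N) (A m \<ominus>\<^bsub>free_completion N\<^esub> A n) < \<epsilon>"
  shows "\<exists>L\<in>carrier (free_completion N).
    (\<lambda>n. cnorm (free_completion N) (A n \<ominus>\<^bsub>free_completion N\<^esub> L)) \<longlonglongrightarrow> 0"
proof -
  let ?C = "free_completion N"
  obtain X where X: "\<And>n. X n \<in> cauchy_seqs N" "\<And>n. A n = cls (X n)"
    using carr unfolding carrier_completion image_iff by metis
  have "\<exists>i. \<forall>m\<ge>i. \<forall>n\<ge>i. N (X k m - X k n) < 1 / (real k + 1)" for k
    by (intro csD(2)[OF X(1)]) auto
  then obtain i where i: "\<And>k m n. m \<ge> i k \<Longrightarrow> n \<ge> i k \<Longrightarrow> N (X k m - X k n) < 1 / (real k + 1)"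
    by metis
  define Y where "Y k = X k (i k)" for k
  have F: "Y k \<in> free_algebra" "X k n \<in> free_algebra" for k n
    unfolding Y_def using csD(1)[OF X(1)] by auto
  have close: "N (X k n - Y k) < 1 / (real k + 1)" if "n \<ge> i k" for k n
    unfolding Y_def using i that by auto
  have Yd: "N (Y k - Y l) \<le> 1 / (real k + 1) + cnorm ?C (A k \<ominus>\<^bsub>?C\<^esub> A l) + 1 / (real l + 1)" for k l
  proof -
    have lim: "(\<lambda>n. N (X k n - X l n)) \<longlonglongrightarrow> cnorm ?C (A k \<ominus>\<^bsub>?C\<^esub> A l)"
      using norm_completion_tendsto[OF minus_completion(2)[OF X(1) X(1)]] X
      by (simp add: minus_completion(1))
    show ?thesis
    proof (rule LIMSEQ_le_const)
      show "(\<lambda>n. 1 / (real k + 1) + N (X k n - X l n) + 1 / (real l + 1)) \<longlonglongrightarrow>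
          1 / (real k + 1) + cnorm ?C (A k \<ominus>\<^bsub>?C\<^esub> A l) + 1 / (real l + 1)"
        by (intro tendsto_intros lim)
      have "N (Y k - Y l) \<le> 1 / (real k + 1) + N (X k n - X l n) + 1 / (real l + 1)"
        if n: "n \<ge> max (i k) (i l)" for n
      proof -
        have "N (Y k - Y l) \<le> N (Y k - X k n) + (N (X k n - X l n) + N (X l n - Y l))"
          using N_tri[of "Y k" "X k n" "Y l"] N_tri[of "X k n" "X l n" "Y l"] F by force
        moreover have "N (Y k - X k n) < 1 / (real k + 1)" "N (X l n - Y l) < 1 / (real l + 1)"
          using close n N_diff_commute[OF F(1) F(2)] by auto
        ultimately show ?thesis by linarith
      qed
      then show "\<exists>M. \<forall>n\<ge>M. N (Y k - Y l) \<le> 1 / (real k + 1) + N (X k n - X l n) + 1 / (real l + 1)"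
        by blast
    qed
  qed
  have small: "\<exists>M. \<forall>n\<ge>M. 1 / (real n + 1) < \<epsilon>" if "\<epsilon> > 0" for \<epsilon> :: real
  proof -
    obtain M where M: "inverse (real (Suc M)) < \<epsilon>" using reals_Archimedean \<open>\<epsilon> > 0\<close> by blast
    have "1 / (real n + 1) < \<epsilon>" if "n \<ge> M" for n
    proof -
      have "1 / (real n + 1) \<le> inverse (real (Suc M))"
        using that by (simp add: inverse_eq_divide frac_le)
      then show ?thesis using M by linarith
    qed
    then show ?thesis by blast
  qed
  have Y: "Y \<in> cauchy_seqs N"
  proof (rule csI)
    fix \<epsilon> :: real assume e: "\<epsilon> > 0"
    then have e3: "\<epsilon> / 3 > 0" by simp
    obtain M1 where M1: "\<forall>m\<ge>M1. \<forall>n\<ge>M1. cnorm ?C (A m \<ominus>\<^bsub>?C\<^esub> A n) < \<epsilon> / 3"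
      using cau[OF e3] by blast
    obtain M2 where M2: "\<forall>n\<ge>M2. 1 / (real n + 1) < \<epsilon> / 3" using small[OF e3] by blast
    have "N (Y m - Y n) < \<epsilon>" if "m \<ge> max M1 M2" "n \<ge> max M1 M2" for m n
    proof -
      have "cnorm ?C (A m \<ominus>\<^bsub>?C\<^esub> A n) < \<epsilon> / 3" "1 / (real m + 1) < \<epsilon> / 3" "1 / (real n + 1) < \<epsilon> / 3"
        using M1 M2 that by auto
      then show ?thesis using Yd[of m n] by linarith
    qed
    then show "\<exists>M. \<forall>m\<ge>M. \<forall>n\<ge>M. N (Y m - Y n) < \<epsilon>" by blast
  qed (rule F)
  show ?thesis
  proof (intro bexI[of _ "cls Y"] LIMSEQ_I)
    fix r :: real assume r: "0 < r"
    then have r3: "r / 3 > 0" by simp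
    obtain M1 where M1: "\<forall>n\<ge>M1. 1 / (real n + 1) < r / 3" using small[OF r3] by blast
    obtain M2 where M2: "\<forall>m\<ge>M2. \<forall>n\<ge>M2. N (Y m - Y n) < r / 3" using csD(2)[OF Y r3] by blast
    have "norm (cnorm ?C (A k \<ominus>\<^bsub>?C\<^esub> cls Y) - 0) < r" if k: "k \<ge> max M1 M2" for k
    proof -
      have lim: "(\<lambda>n. N (X k n - Y n)) \<longlonglongrightarrow> cnorm ?C (A k \<ominus>\<^bsub>?C\<^esub> cls Y)"
        using norm_completion_tendsto[OF minus_completion(2)[OF X(1) Y]] X Y
        by (simp add: minus_completion(1))
      have "N (X k n - Y n) \<le> 2 * r / 3" if n: "n \<ge> max (i k) M2" for n
      proof -
        have "N (X k n - Y n) \<le> N (X k n - Y k) + N (Y k - Y n)" using N_tri F by blast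
        moreover have "N (X k n - Y k) < 1 / (real k + 1)" using close n by simp
        moreover have "1 / (real k + 1) < r / 3" "N (Y k - Y n) < r / 3" using M1 M2 k n by auto
        ultimately show ?thesis by linarith
      qed
      then have "cnorm ?C (A k \<ominus>\<^bsub>?C\<^esub> cls Y) \<le> 2 * r / 3"
        by (intro LIMSEQ_le_const2[OF lim]) blast
      moreover have "0 \<le> cnorm ?C (A k \<ominus>\<^bsub>?C\<^esub> cls Y)"
        by (rule LIMSEQ_le_const[OF lim]) (use F N_nonneg in auto)
      ultimately show ?thesis using r by simp
    qed
    then show "\<exists>no. \<forall>n\<ge>no. norm (cnorm ?C (A n \<ominus>\<^bsub>?C\<^esub> cls Y) - 0) < r" by blast
  qed (use Y in auto)
qed

end

context cstar_seminormed begin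

theorem cstar_completion: "cstar_algebra (free_completion N)"
proof -
  note simps = add_completion mult_completion scale_completion adj_completion
    cs_add cs_mult cs_scale cs_adj
  note free = distrib_left distrib_right mult.assoc free_scale_simps
      free_scale_mult_left free_scale_mult_right
  show ?thesis
  proof (rule cstar_algebra.intro[OF abelian_completion], rule cstar_algebra_axioms.intro, goal_cases)
    case (17 x)
    then obtain X where X: "X \<in> cauchy_seqs N" "x = cls X" unfolding carrier_completion by auto
    show ?case unfolding X(2)
      by (rule LIMSEQ_le_const[OF norm_completion_tendsto[OF X(1)]])
         (use csD(1) N_nonneg X in auto)
  next
    case (18 x)
    then obtain X where X: "X \<in> cauchy_seqs N" "x = cls X" unfolding carrier_completion by auto
    have "cls X = \<zero>\<^bsub>free_completion N\<^esub> \<longleftrightarrow> (\<lambda>n. N (X n)) \<longlonglongrightarrow> 0"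
      using X by (simp add: zero_completion cls_eq_iff)
    then show ?case unfolding X(2)
      using norm_completion_tendsto[OF X(1)] LIMSEQ_unique by metis
  next
    case (19 x y)
    then obtain X Y where X: "X \<in> cauchy_seqs N" "x = cls X" and Y: "Y \<in> cauchy_seqs N" "y = cls Y"
      unfolding carrier_completion by auto
    show ?case unfolding X(2) Y(2) add_completion[OF X(1) Y(1)]
      by (rule LIMSEQ_le[OF norm_completion_tendsto[OF cs_add[OF X(1) Y(1)]]
            tendsto_add[OF norm_completion_tendsto[OF X(1)] norm_completion_tendsto[OF Y(1)]]])
         (use csD(1) N_add X Y in auto)
  next
    case (20 x a)
    then obtain X where X: "X \<in> cauchy_seqs N" "x = cls X" unfolding carrier_completion by auto
    have "(\<lambda>n. N (free_scale a (X n))) \<longlonglongrightarrow> cmod a * cnorm (free_completion N) (cls X)"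
      using tendsto_mult_left[OF norm_completion_tendsto[OF X(1)]] csD(1)[OF X(1)]
      by (simp add: N_scale)
    then show ?case unfolding X(2) scale_completion[OF X(1)]
      using norm_completion_tendsto[OF cs_scale[OF X(1)]] LIMSEQ_unique by blast
  next
    case (21 x y)
    then obtain X Y where X: "X \<in> cauchy_seqs N" "x = cls X" and Y: "Y \<in> cauchy_seqs N" "y = cls Y"
      unfolding carrier_completion by auto
    show ?case unfolding X(2) Y(2) mult_completion[OF X(1) Y(1)]
      by (rule LIMSEQ_le[OF norm_completion_tendsto[OF cs_mult[OF X(1) Y(1)]]
            tendsto_mult[OF norm_completion_tendsto[OF X(1)] norm_completion_tendsto[OF Y(1)]]])
         (use csD(1) N_mult X Y in auto)
  next
    case (22 x)
    then obtain X where X: "X \<in> cauchy_seqs N" "x = cls X" unfolding carrier_completion by auto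
    have "(\<lambda>n. N (free_adj (X n) * X n)) \<longlonglongrightarrow> (cnorm (free_completion N) (cls X))\<^sup>2"
      using tendsto_power[OF norm_completion_tendsto[OF X(1)], of 2] csD(1)[OF X(1)]
      by (simp add: N_square)
    then show ?case unfolding X(2) adj_completion[OF X(1)] mult_completion[OF cs_adj[OF X(1)] X(1)]
      using norm_completion_tendsto[OF cs_mult[OF cs_adj[OF X(1)] X(1)]] LIMSEQ_unique by blast
  next
    case (23 X)
    then show ?case by (intro complete_completion) auto
  qed (unfold carrier_completion, (elim imageE; simp add: simps; simp add: free; fail)+)
qed

lemma cls_finsum:
  assumes "finite I" "\<And>i. i \<in> I \<Longrightarrow> f i \<in> free_algebra"
  shows "(\<Oplus>\<^bsub>free_completion N\<^esub>i\<in>I. cls (\<lambda>n. f i)) = cls (\<lambda>n. sum f I)"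
proof -
  interpret abelian_group "free_completion N" by (rule abelian_completion)
  show ?thesis using assms
  proof (induction I rule: finite_induct)
    case empty
    then show ?case by (simp add: zero_completion)
  next
    case (insert i I)
    have "(\<Oplus>\<^bsub>free_completion N\<^esub>j\<in>insert i I. cls (\<lambda>n. f j)) =
        cls (\<lambda>n. f i) \<oplus>\<^bsub>free_completion N\<^esub> (\<Oplus>\<^bsub>free_completion N\<^esub>j\<in>I. cls (\<lambda>n. f j))"
      using insert by (intro finsum_insert) auto
    also have "\<dots> = cls (\<lambda>n. f i + sum f I)"
      using insert by (simp add: add_completion free_algebra_sum)
    finally show ?case using insert by simp
  qed
qed

end

lemma free_algebra_induct_single [consumes 1, case_names zero single_add]:
  assumes "x \<in> free_algebra" and zero: "P 0"
    and add: "\<And>w a x. w \<noteq> 0 \<Longrightarrow> x \<in> free_algebra \<Longrightarrow> P x \<Longrightarrow> P (Poly_Mapping.single w a + x)"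
  shows "P x"
  using assms(1)
proof (induction x rule: update_induct)
  case const
  show ?case by (fact zero)
next
  case (update f w a)
  have eq: "Poly_Mapping.update w a f = Poly_Mapping.single w a + f"
    using update(1)
    by (intro poly_mapping_eqI) (auto simp: lookup_update lookup_add lookup_single when_def in_keys_iff)
  have w0: "w \<noteq> 0" using update(2,4) by (auto simp: free_algebra_iff lookup_update)
  have "f \<in> free_algebra"
    using update(4) w0 by (auto simp: free_algebra_iff lookup_update)
  then show ?case unfolding eq using update(3) w0 by (intro add) auto
qed

subsection \<open>Limits in a C*-algebra\<close>

context cstar_algebra
begin

lemma scale_zero [simp]: "x \<in> carrier A \<Longrightarrow> 0 \<odot> x = \<zero>"
  using add_scale[of x 0 0] scale_closed[of x 0] add.r_cancel_one'[of "0 \<odot> x" "0 \<odot> x"] by simp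

lemma scale_minus: "x \<in> carrier A \<Longrightarrow> (-1) \<odot> x = \<ominus> x"
  using add_scale[of x "-1" 1] scale_closed[of x "-1"]
  by (intro minus_equality[symmetric]) (auto simp: scale_one)

lemma scale_minus_distrib: "x \<in> carrier A \<Longrightarrow> y \<in> carrier A \<Longrightarrow> a \<odot> (x \<ominus> y) = a \<odot> x \<ominus> a \<odot> y"
  unfolding a_minus_def scale_minus[symmetric]
  by (simp add: scale_minus[symmetric] scale_closed scale_add scale_scale)

lemma mult_zero [simp]: "x \<in> carrier A \<Longrightarrow> \<zero> \<otimes> x = \<zero>" "x \<in> carrier A \<Longrightarrow> x \<otimes> \<zero> = \<zero>"
  using scale_mult_left[of \<zero> x 0] scale_mult_right[of x \<zero> 0] by (auto simp: mult_closed)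

lemma mult_minus_left: "x \<in> carrier A \<Longrightarrow> y \<in> carrier A \<Longrightarrow> z \<in> carrier A \<Longrightarrow>
    (x \<ominus> y) \<otimes> z = x \<otimes> z \<ominus> y \<otimes> z"
  by (simp add: a_minus_def scale_minus[symmetric] scale_closed mult_closed mult_add_left scale_mult_left)

lemma mult_minus_right: "x \<in> carrier A \<Longrightarrow> y \<in> carrier A \<Longrightarrow> z \<in> carrier A \<Longrightarrow>
    z \<otimes> (x \<ominus> y) = z \<otimes> x \<ominus> z \<otimes> y"
  by (simp add: a_minus_def scale_minus[symmetric] scale_closed mult_closed mult_add_right scale_mult_right)

lemma adj_minus: "x \<in> carrier A \<Longrightarrow> y \<in> carrier A \<Longrightarrow> adj A (x \<ominus> y) = adj A x \<ominus> adj A y"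
  by (simp add: a_minus_def scale_minus[symmetric] scale_closed adj_closed adj_add adj_scale)

lemma adj_zero [simp]: "adj A \<zero> = \<zero>"
  using adj_scale[of \<zero> 0] by (simp add: adj_closed)

lemma norm_zero [simp]: "cnorm A \<zero> = 0"
  by (simp add: norm_eq_zero)

lemma norm_minus_commute: "x \<in> carrier A \<Longrightarrow> y \<in> carrier A \<Longrightarrow> cnorm A (x \<ominus> y) = cnorm A (y \<ominus> x)"
  using norm_scale[of "y \<ominus> x" "-1"]
  by (simp add: scale_minus a_minus_def minus_add minus_minus a_comm)

lemma add_diff_add: "\<lbrakk>x \<in> carrier A; y \<in> carrier A; x' \<in> carrier A; y' \<in> carrier A\<rbrakk> \<Longrightarrow>
    (x \<oplus> y) \<ominus> (x' \<oplus> y') = (x \<ominus> x') \<oplus> (y \<ominus> y')"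
  by (simp add: a_minus_def minus_add a_ac)

lemma diff_add_diff: "\<lbrakk>x \<in> carrier A; y \<in> carrier A; z \<in> carrier A\<rbrakk> \<Longrightarrow>
    (x \<ominus> y) \<oplus> (y \<ominus> z) = x \<ominus> z"
  using a_assoc[of "\<ominus> y" y "\<ominus> z"] by (simp add: a_minus_def a_assoc l_neg)

lemma norm_diff_triangle: "\<lbrakk>x \<in> carrier A; y \<in> carrier A; z \<in> carrier A\<rbrakk> \<Longrightarrow>
    cnorm A (x \<ominus> z) \<le> cnorm A (x \<ominus> y) + cnorm A (y \<ominus> z)"
  using norm_triangle[of "x \<ominus> y" "y \<ominus> z"] by (simp add: diff_add_diff)

lemma diff_self: "x \<in> carrier A \<Longrightarrow> x \<ominus> x = \<zero>"
  by (simp add: a_minus_def r_neg)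

lemma diff_zero: "x \<in> carrier A \<Longrightarrow> x \<ominus> \<zero> = x"
  using minus_equality[of \<zero> \<zero>] by (simp add: a_minus_def)

lemma diff_eq_zero: "x \<in> carrier A \<Longrightarrow> y \<in> carrier A \<Longrightarrow> x \<ominus> y = \<zero> \<Longrightarrow> x = y"
  using minus_equality[of x "\<ominus> y"] by (simp add: a_minus_def minus_minus)

lemma norm_abs_diff: "\<lbrakk>x \<in> carrier A; y \<in> carrier A\<rbrakk> \<Longrightarrow> \<bar>cnorm A x - cnorm A y\<bar> \<le> cnorm A (x \<ominus> y)"
  using norm_diff_triangle[of x y \<zero>] norm_diff_triangle[of y x \<zero>] norm_minus_commute[of x y]
  by (simp add: diff_zero)

lemma norm_adj: "x \<in> carrier A \<Longrightarrow> cnorm A (adj A x) = cnorm A x"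
proof -
  have le: "cnorm A y \<le> cnorm A (adj A y)" if y: "y \<in> carrier A" for y
  proof (cases "cnorm A y = 0")
    case True
    then show ?thesis using norm_nonneg[of "adj A y"] y adj_closed by simp
  next
    case False
    have "(cnorm A y)\<^sup>2 \<le> cnorm A (adj A y) * cnorm A y"
      using cstar_identity[OF y] norm_mult[OF adj_closed[OF y] y] by simp
    then show ?thesis using False norm_nonneg[OF y] by (simp add: power2_eq_square)
  qed
  show "x \<in> carrier A \<Longrightarrow> cnorm A (adj A x) = cnorm A x"
    using le[of x] le[of "adj A x"] by (simp add: adj_closed adj_adj)
qed

definition tends :: "('b \<Rightarrow> 'a) \<Rightarrow> 'a \<Rightarrow> 'b filter \<Rightarrow> bool" where
  "tends X L F \<longleftrightarrow> (\<forall>n. X n \<in> carrier A) \<and> L \<in> carrier A \<and> ((\<lambda>n. cnorm A (X n \<ominus> L)) \<longlongrightarrow> 0) F"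

lemma tendsD: "tends X L F \<Longrightarrow> X n \<in> carrier A" "tends X L F \<Longrightarrow> L \<in> carrier A"
  "tends X L F \<Longrightarrow> ((\<lambda>n. cnorm A (X n \<ominus> L)) \<longlongrightarrow> 0) F"
  by (auto simp: tends_def)

lemma tendsI:
  assumes "\<And>n. X n \<in> carrier A" "L \<in> carrier A" "\<And>n. cnorm A (X n \<ominus> L) \<le> f n" "(f \<longlongrightarrow> 0) F"
  shows "tends X L F"
  unfolding tends_def
proof (intro conjI allI)
  show "((\<lambda>n. cnorm A (X n \<ominus> L)) \<longlongrightarrow> 0) F"
  proof (rule Lim_null_comparison[OF _ assms(4)], intro always_eventually allI)
    fix n
    show "norm (cnorm A (X n \<ominus> L)) \<le> f n"
      using assms(3)[of n] norm_nonneg[of "X n \<ominus> L"] assms(1)[of n] assms(2) by simp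
  qed
qed (use assms in auto)

lemma tends_norm:
  assumes "tends X L F"
  shows "((\<lambda>n. cnorm A (X n)) \<longlongrightarrow> cnorm A L) F"
proof -
  have "((\<lambda>n. cnorm A (X n) - cnorm A L) \<longlongrightarrow> 0) F"
  proof (rule Lim_null_comparison[OF _ tendsD(3)[OF assms]], intro always_eventually allI)
    fix n
    show "norm (cnorm A (X n) - cnorm A L) \<le> cnorm A (X n \<ominus> L)"
      using norm_abs_diff[OF tendsD(1)[OF assms] tendsD(2)[OF assms]] by simp
  qed
  then show ?thesis by (subst Lim_null)
qed

lemma tends_const: "x \<in> carrier A \<Longrightarrow> tends (\<lambda>n. x) x F"
  by (auto simp: tends_def diff_self)

lemma tends_unique:
  assumes "tends X L F" "tends X M F" "F \<noteq> bot"
  shows "L = M"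
proof -
  note d = tendsD[OF assms(1)] tendsD[OF assms(2)]
  have "((\<lambda>n. cnorm A (X n \<ominus> L) + cnorm A (X n \<ominus> M)) \<longlongrightarrow> 0 + 0) F"
    by (intro tendsto_add d)
  moreover have "cnorm A (L \<ominus> M) \<le> cnorm A (X n \<ominus> L) + cnorm A (X n \<ominus> M)" for n
    using norm_diff_triangle[of L "X n" M] norm_minus_commute[of L "X n"] d by simp
  ultimately have "cnorm A (L \<ominus> M) \<le> 0"
    by (intro tendsto_lowerbound[where F = F and x = 0, OF _ _ assms(3)] always_eventually allI) auto
  then have "cnorm A (L \<ominus> M) = 0" using norm_nonneg[of "L \<ominus> M"] d by simp
  then show ?thesis using norm_eq_zero[of "L \<ominus> M"] diff_eq_zero[of L M] d by simp
qed

lemma tends_add: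
  assumes "tends X L F" "tends Y M F"
  shows "tends (\<lambda>n. X n \<oplus> Y n) (L \<oplus> M) F"
proof (rule tendsI)
  note d = tendsD[OF assms(1)] tendsD[OF assms(2)]
  show "((\<lambda>n. cnorm A (X n \<ominus> L) + cnorm A (Y n \<ominus> M)) \<longlongrightarrow> 0) F"
    using tendsto_add[OF d(3) d(6)] by simp
  show "cnorm A (X n \<oplus> Y n \<ominus> (L \<oplus> M)) \<le> cnorm A (X n \<ominus> L) + cnorm A (Y n \<ominus> M)" for n
    using norm_triangle[of "X n \<ominus> L" "Y n \<ominus> M"] d by (simp add: add_diff_add)
qed (use tendsD[OF assms(1)] tendsD[OF assms(2)] in auto)

lemma tends_scale:
  assumes "tends X L F"
  shows "tends (\<lambda>n. a \<odot> X n) (a \<odot> L) F"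
proof (rule tendsI)
  note d = tendsD[OF assms(1)]
  show "((\<lambda>n. cmod a * cnorm A (X n \<ominus> L)) \<longlongrightarrow> 0) F"
    using tendsto_mult_left[OF d(3), of "cmod a"] by simp
  show "cnorm A (a \<odot> X n \<ominus> a \<odot> L) \<le> cmod a * cnorm A (X n \<ominus> L)" for n
    using norm_scale[of "X n \<ominus> L" a] d by (simp add: scale_minus_distrib)
qed (use tendsD[OF assms(1)] scale_closed in auto)

lemma tends_adj:
  assumes "tends X L F"
  shows "tends (\<lambda>n. adj A (X n)) (adj A L) F"
proof (rule tendsI)
  note d = tendsD[OF assms(1)]
  show "((\<lambda>n. cnorm A (X n \<ominus> L)) \<longlongrightarrow> 0) F" by (rule d)
  show "cnorm A (adj A (X n) \<ominus> adj A L) \<le> cnorm A (X n \<ominus> L)" for n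
    using norm_adj[of "X n \<ominus> L"] d by (simp add: adj_minus)
qed (use tendsD[OF assms(1)] adj_closed in auto)

lemma tends_mult:
  assumes "tends X L F" "tends Y M F"
  shows "tends (\<lambda>n. X n \<otimes> Y n) (L \<otimes> M) F"
proof (rule tendsI)
  note d = tendsD[OF assms(1)] tendsD[OF assms(2)]
  show "((\<lambda>n. cnorm A (X n \<ominus> L) * cnorm A (Y n) + cnorm A L * cnorm A (Y n \<ominus> M)) \<longlongrightarrow> 0) F"
    using tendsto_add[OF tendsto_mult[OF d(3) tends_norm[OF assms(2)]]
        tendsto_mult_left[OF d(6), of "cnorm A L"]] by simp
  fix n
  have "X n \<otimes> Y n \<ominus> L \<otimes> M = (X n \<ominus> L) \<otimes> Y n \<oplus> L \<otimes> (Y n \<ominus> M)"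
    using d by (simp add: mult_minus_left mult_minus_right mult_closed diff_add_diff)
  then have "cnorm A (X n \<otimes> Y n \<ominus> L \<otimes> M) \<le> cnorm A ((X n \<ominus> L) \<otimes> Y n) + cnorm A (L \<otimes> (Y n \<ominus> M))"
    using d by (auto intro!: norm_triangle mult_closed)
  also have "\<dots> \<le> cnorm A (X n \<ominus> L) * cnorm A (Y n) + cnorm A L * cnorm A (Y n \<ominus> M)"
    using d by (intro add_mono norm_mult) auto
  finally show "cnorm A (X n \<otimes> Y n \<ominus> L \<otimes> M) \<le>
      cnorm A (X n \<ominus> L) * cnorm A (Y n) + cnorm A L * cnorm A (Y n \<ominus> M)" .
qed (use tendsD[OF assms(1)] tendsD[OF assms(2)] mult_closed in auto)

end

subsection \<open>Evaluation of free elements in a C*-algebra\<close>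

locale evaluation = cstar_algebra B for B :: "'b cstar" (structure) +
  fixes q :: "'g \<Rightarrow> 'b"
  assumes q: "q g \<in> carrier B"
begin

definition val :: "'g \<times> bool \<Rightarrow> 'b" where
  "val l = (if snd l then adj B (q (fst l)) else q (fst l))"

fun wval :: "('g \<times> bool) list \<Rightarrow> 'b" where
  "wval [] = \<zero>"
| "wval [l] = val l"
| "wval (l # l' # ls) = val l \<otimes> wval (l' # ls)"

definition ev :: "'g free \<Rightarrow> 'b" where
  "ev x = (\<Oplus>w\<in>Poly_Mapping.keys x. Poly_Mapping.lookup x w \<odot> wval (letters w))"

lemma val_closed [simp]: "val l \<in> carrier B"
  by (simp add: val_def q adj_closed)

lemma wval_closed [simp]: "wval ls \<in> carrier B"
  by (induction ls rule: wval.induct) (auto simp: mult_closed)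

lemma wval_Cons: "ls \<noteq> [] \<Longrightarrow> wval (l # ls) = val l \<otimes> wval ls"
  by (cases ls) auto

lemma wval_append: "xs \<noteq> [] \<Longrightarrow> ys \<noteq> [] \<Longrightarrow> wval (xs @ ys) = wval xs \<otimes> wval ys"
proof (induction xs)
  case (Cons l xs)
  then show ?case by (cases "xs = []") (simp_all add: wval_Cons mult_assoc)
qed auto

lemma val_flip: "val (case l of (g, b) \<Rightarrow> (g, \<not> b)) = adj B (val l)"
  by (cases l) (auto simp: val_def adj_adj q)

lemma wval_adj: "wval (rev (map (\<lambda>(g, b). (g, \<not> b)) ls)) = adj B (wval ls)"
proof (induction ls)
  case (Cons l ls)
  then show ?case
    by (cases "ls = []") (simp_all add: wval_append wval_Cons val_flip adj_mult)
qed simp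

lemma term_closed [simp]: "a \<odot> wval ls \<in> carrier B"
  by (simp add: scale_closed)

lemma ev_superset:
  assumes "finite S" "Poly_Mapping.keys x \<subseteq> S"
  shows "ev x = (\<Oplus>w\<in>S. Poly_Mapping.lookup x w \<odot> wval (letters w))"
  unfolding ev_def
  by (rule add.finprod_mono_neutral_cong_left[OF assms]) (auto simp: in_keys_iff)

lemma ev_closed [simp]: "ev x \<in> carrier B"
  unfolding ev_def by (intro finsum_closed) auto

lemma ev_add: "ev (x + y) = ev x \<oplus> ev y"
proof -
  let ?S = "Poly_Mapping.keys x \<union> Poly_Mapping.keys y"
  have "ev (x + y) = (\<Oplus>w\<in>?S. Poly_Mapping.lookup (x + y) w \<odot> wval (letters w))"
    by (rule ev_superset) (auto simp: keys_add)
  also have "\<dots> = (\<Oplus>w\<in>?S. Poly_Mapping.lookup x w \<odot> wval (letters w) \<oplus> Poly_Mapping.lookup y w \<odot> wval (letters w))"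
    by (simp add: lookup_add add_scale)
  also have "\<dots> = ev x \<oplus> ev y"
    by (subst finsum_addf) (auto simp: ev_superset[of ?S])
  finally show ?thesis .
qed

lemma ev_zero [simp]: "ev 0 = \<zero>"
  by (simp add: ev_def)

lemma ev_single: "ev (Poly_Mapping.single w a) = a \<odot> wval (letters w)"
  by (subst ev_superset[of "{w}"]) (auto simp: finsum_singleton)

lemma ev_single_mult_single:
  assumes "u \<noteq> 0" "w \<noteq> 0"
  shows "ev (Poly_Mapping.single u a * Poly_Mapping.single w b) =
    ev (Poly_Mapping.single u a) \<otimes> ev (Poly_Mapping.single w b)"
proof -
  have "letters u \<noteq> []" "letters w \<noteq> []" using assms by (auto simp: word_eq_iff)
  then show ?thesis
    by (simp add: mult_single ev_single wval_append scale_mult_left scale_mult_right scale_scale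
        mult_closed mult.commute)
qed

lemma ev_mult:
  assumes "x \<in> free_algebra" "y \<in> free_algebra"
  shows "ev (x * y) = ev x \<otimes> ev y"
  using assms(1)
proof (induction x rule: free_algebra_induct_single)
  case (single_add w a x)
  have "ev (Poly_Mapping.single w a * y) = ev (Poly_Mapping.single w a) \<otimes> ev y"
    using assms(2)
  proof (induction y rule: free_algebra_induct_single)
    case (single_add v b y)
    then show ?case using ev_single_mult_single[OF \<open>w \<noteq> 0\<close>]
      by (simp add: distrib_left ev_add mult_add_right)
  qed simp
  then show ?case using single_add by (simp add: distrib_right ev_add mult_add_left)
qed (simp add: assms)

lemma ev_scale: "ev (free_scale a x) = a \<odot> ev x"
proof (induction x rule: poly_mapping_induct)
  case zero
  show ?case using scale_scale[of \<zero> a 0] by (simp add: free_scale_eq)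
next
  case (single_add w b x)
  have "ev (free_scale a (Poly_Mapping.single w b)) = a \<odot> ev (Poly_Mapping.single w b)"
    by (simp add: free_scale_eq mult_single ev_single scale_scale)
  then show ?case using single_add by (simp add: free_scale_simps ev_add scale_add)
qed

lemma ev_adj: "ev (free_adj x) = adj B (ev x)"
proof (induction x rule: poly_mapping_induct)
  case (single_add w b x)
  have "ev (free_adj (Poly_Mapping.single w b)) = adj B (ev (Poly_Mapping.single w b))"
    by (simp add: ev_single word_adj_def wval_adj adj_scale)
  then show ?case using single_add by (simp add: ev_add adj_add)
qed simp

lemma ev_gen [simp]: "ev (free_gen g) = q g"
  by (simp add: free_gen_def ev_single val_def scale_one q)

lemma ev_uminus: "ev (- x) = \<ominus> ev x"
  using ev_scale[of "-1" x] by (simp add: free_scale_simps scale_minus)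

lemma ev_diff: "ev (x - y) = ev x \<ominus> ev y"
  using ev_add[of x "- y"] by (simp add: ev_uminus a_minus_def)

lemma ev_sum: "finite I \<Longrightarrow> ev (sum f I) = (\<Oplus>i\<in>I. ev (f i))"
  by (induction I rule: finite_induct) (auto simp: ev_add Pi_def)

lemma seminorm_ev: "cstar_seminorm (\<lambda>x. cnorm B (ev x))"
  unfolding cstar_seminorm_def
  by (auto simp: norm_nonneg ev_add norm_triangle ev_scale norm_scale ev_mult norm_mult ev_adj
      cstar_identity)

end

subsection \<open>The universal property\<close>

locale bounded_relations =
  fixes R :: "'g free set"
  assumes R_free: "R \<subseteq> free_algebra"
    and bounded: "\<exists>K. \<forall>N\<in>admissible_seminorms R. N (free_gen g) \<le> K"
begin

lemma admissible_bdd: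
  assumes "x \<in> free_algebra"
  shows "\<exists>K. \<forall>N\<in>admissible_seminorms R. N x \<le> K"
  using assms
proof (induction x rule: free_algebra_induct)
  case (gen g)
  then show ?case by (rule bounded)
next
  case (adj_gen g)
  then show ?case
    using bounded[of g] cstar_seminormed.N_adj[OF cstar_seminormed.intro]
    by (metis (no_types, lifting) admissible_seminorms_def free_gen_closed mem_Collect_eq)
next
  case (mult x y)
  then obtain K L where "\<forall>N\<in>admissible_seminorms R. N x \<le> K" "\<forall>N\<in>admissible_seminorms R. N y \<le> L"
    by blast
  then have "N (x * y) \<le> \<bar>K\<bar> * \<bar>L\<bar>" if "N \<in> admissible_seminorms R" for N
  proof -
    have N: "cstar_seminorm N" using that by (simp add: admissible_seminorms_def)
    have "N x \<le> \<bar>K\<bar>" "N y \<le> \<bar>L\<bar>"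
      using that \<open>\<forall>N\<in>_. N x \<le> K\<close> \<open>\<forall>N\<in>_. N y \<le> L\<close> by (meson abs_ge_self order_trans)+
    then have "N x * N y \<le> \<bar>K\<bar> * \<bar>L\<bar>"
      using cstar_seminormD(1)[OF N] mult by (intro mult_mono) auto
    then show ?thesis using cstar_seminormD(4)[OF N mult(1,2)] by linarith
  qed
  then show ?case by blast
next
  case zero
  have "N 0 \<le> 0" if "N \<in> admissible_seminorms R" for N
    using cstar_seminormed.N_zero[OF cstar_seminormed.intro, of N] that by (simp add: admissible_seminorms_def)
  then show ?case by blast
next
  case (add x y)
  then obtain K L where "\<forall>N\<in>admissible_seminorms R. N x \<le> K" "\<forall>N\<in>admissible_seminorms R. N y \<le> L"
    by blast
  then have "N (x + y) \<le> K + L" if "N \<in> admissible_seminorms R" for N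
    using that cstar_seminormD(2)[OF _ add(1,2), of N]
    by (fastforce simp: admissible_seminorms_def)
  then show ?case by blast
next
  case (scale a x)
  then obtain K where "\<forall>N\<in>admissible_seminorms R. N x \<le> K" by blast
  then have "N (free_scale a x) \<le> cmod a * K" if "N \<in> admissible_seminorms R" for N
    using that cstar_seminormD(3)[OF _ scale(1), of N a]
    by (simp add: admissible_seminorms_def mult_left_mono)
  then show ?case by blast
qed

lemma admissible_le: "N \<in> admissible_seminorms R \<Longrightarrow> x \<in> free_algebra \<Longrightarrow> N x \<le> universal_seminorm R x"
  unfolding universal_seminorm_def
  using admissible_bdd[of x] by (intro cSUP_upper) (auto simp: bdd_above_def)

lemma admissible_nonempty: "admissible_seminorms R \<noteq> {}"
proof -
  have "(\<lambda>x. 0) \<in> admissible_seminorms R"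
    by (auto simp: admissible_seminorms_def cstar_seminorm_def)
  then show ?thesis by blast
qed

lemma universal_least: "(\<And>N. N \<in> admissible_seminorms R \<Longrightarrow> N x \<le> K) \<Longrightarrow> universal_seminorm R x \<le> K"
  unfolding universal_seminorm_def using admissible_nonempty by (intro cSUP_least)

lemma admissibleD: "N \<in> admissible_seminorms R \<Longrightarrow> cstar_seminorm N"
  by (simp add: admissible_seminorms_def)

lemma universal_nonneg: "x \<in> free_algebra \<Longrightarrow> 0 \<le> universal_seminorm R x"
  using admissible_nonempty admissible_le cstar_seminormD(1) admissibleD by (meson all_not_in_conv order_trans)

lemma universal_zero: "x \<in> R \<Longrightarrow> universal_seminorm R x = 0"
  using universal_nonneg[of x] universal_least[of x 0] R_free
  by (fastforce simp: admissible_seminorms_def)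

lemma universal_cstar_seminorm: "cstar_seminorm (universal_seminorm R)" (is "cstar_seminorm ?U")
  unfolding cstar_seminorm_def
proof (intro conjI ballI allI)
  fix x :: "'g free" assume x: "x \<in> free_algebra"
  show nx: "0 \<le> ?U x" by (rule universal_nonneg[OF x])
  show "?U (free_scale a x) = cmod a * ?U x" for a
  proof (cases "a = 0")
    case True
    have "?U 0 \<le> 0"
    proof (rule universal_least)
      fix N assume "N \<in> admissible_seminorms R"
      then show "N 0 \<le> 0" using cstar_seminormed.N_zero[OF cstar_seminormed.intro[OF admissibleD], of N] by simp
    qed
    then show ?thesis using True universal_nonneg[of 0] by (simp add: free_scale_simps)
  next
    case False
    have le: "?U (free_scale b y) \<le> cmod b * ?U y" if y: "y \<in> free_algebra" for b y
    proof (rule universal_least)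
      fix N assume N: "N \<in> admissible_seminorms R"
      show "N (free_scale b y) \<le> cmod b * ?U y"
        using cstar_seminormD(3)[OF admissibleD[OF N] y, of b] admissible_le[OF N y]
        by (simp add: mult_left_mono)
    qed
    have "?U x = ?U (free_scale (inverse a) (free_scale a x))"
      using False by (simp add: free_scale_simps)
    also have "\<dots> \<le> cmod (inverse a) * ?U (free_scale a x)" using x by (intro le) auto
    finally have "cmod a * ?U x \<le> ?U (free_scale a x)"
      using False by (simp add: norm_divide inverse_eq_divide field_simps)
    then show ?thesis using le[OF x, of a] by linarith
  qed
  show "?U (free_adj x * x) = (?U x)\<^sup>2"
  proof (rule antisym)
    show "?U (free_adj x * x) \<le> (?U x)\<^sup>2"
    proof (rule universal_least)
      fix N assume N: "N \<in> admissible_seminorms R"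
      show "N (free_adj x * x) \<le> (?U x)\<^sup>2"
        using cstar_seminormD(5)[OF admissibleD[OF N] x] admissible_le[OF N x]
          cstar_seminormD(1)[OF admissibleD[OF N] x] by (simp add: power_mono)
    qed
    have "?U x \<le> sqrt (?U (free_adj x * x))"
    proof (rule universal_least)
      fix N assume N: "N \<in> admissible_seminorms R"
      show "N x \<le> sqrt (?U (free_adj x * x))"
        using cstar_seminormD(5)[OF admissibleD[OF N] x] admissible_le[OF N, of "free_adj x * x"] x
        by (intro real_le_rsqrt) auto
    qed
    then have "(?U x)\<^sup>2 \<le> (sqrt (?U (free_adj x * x)))\<^sup>2" using nx by (intro power_mono)
    then show "(?U x)\<^sup>2 \<le> ?U (free_adj x * x)" using x universal_nonneg[of "free_adj x * x"] by simp
  qed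
  fix y :: "'g free" assume y: "y \<in> free_algebra"
  show "?U (x + y) \<le> ?U x + ?U y"
  proof (rule universal_least)
    fix N assume N: "N \<in> admissible_seminorms R"
    show "N (x + y) \<le> ?U x + ?U y"
      using cstar_seminormD(2)[OF admissibleD[OF N] x y] admissible_le[OF N x] admissible_le[OF N y]
      by linarith
  qed
  show "?U (x * y) \<le> ?U x * ?U y"
  proof (rule universal_least)
    fix N assume N: "N \<in> admissible_seminorms R"
    have "N x * N y \<le> ?U x * ?U y"
      using admissible_le[OF N x] admissible_le[OF N y] cstar_seminormD(1)[OF admissibleD[OF N]] x y nx
      by (intro mult_mono) auto
    then show "N (x * y) \<le> ?U x * ?U y"
      using cstar_seminormD(4)[OF admissibleD[OF N] x y] by linarith
  qed
qed

sublocale U: cstar_seminormed "universal_seminorm R"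
  by unfold_locales (rule universal_cstar_seminorm)

lemma cstar_universal: "cstar_algebra (universal_cstar R)"
  unfolding universal_cstar_def by (rule U.cstar_completion)

lemma universal_gen_eq: "universal_gen R g = U.cls (\<lambda>n. free_gen g)"
  by (simp add: universal_gen_def U.cls_def)

lemma cls_relation: "x \<in> R \<Longrightarrow> U.cls (\<lambda>n. x) = \<zero>\<^bsub>universal_cstar R\<^esub>"
  unfolding universal_cstar_def U.zero_completion using R_free
  by (subst U.cls_eq_iff) (auto simp: universal_zero)

sublocale C: cstar_algebra "universal_cstar R"
  by (rule cstar_universal)

lemma gen_closed: "universal_gen R g \<in> carrier (universal_cstar R)"
  unfolding universal_cstar_def universal_gen_eq by (rule U.cls_in) auto

lemma cls_const_tends:
  assumes X: "X \<in> cauchy_seqs (universal_seminorm R)"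
  shows "C.tends (\<lambda>n. U.cls (\<lambda>k. X n)) (U.cls X) sequentially"
  unfolding C.tends_def
proof (intro conjI allI)
  show carr: "U.cls (\<lambda>k. X n) \<in> carrier (universal_cstar R)" for n
    unfolding universal_cstar_def using U.csD(1)[OF X] by auto
  show "U.cls X \<in> carrier (universal_cstar R)"
    unfolding universal_cstar_def using X by auto
  show "(\<lambda>n. cnorm (universal_cstar R) (U.cls (\<lambda>k. X n) \<ominus>\<^bsub>universal_cstar R\<^esub> U.cls X)) \<longlonglongrightarrow> 0"
  proof (rule LIMSEQ_I)
    fix r :: real assume "0 < r"
    then obtain M where M: "\<forall>m\<ge>M. \<forall>n\<ge>M. universal_seminorm R (X m - X n) < r / 2"
      using U.csD(2)[OF X, of "r / 2"] by auto
    have "cnorm (universal_cstar R) (U.cls (\<lambda>k. X n) \<ominus>\<^bsub>universal_cstar R\<^esub> U.cls X) \<le> r / 2"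
      if n: "n \<ge> M" for n
    proof -
      have c: "(\<lambda>k. X n) \<in> cauchy_seqs (universal_seminorm R)" using U.csD(1)[OF X] by auto
      have lim: "(\<lambda>k. universal_seminorm R (X n - X k)) \<longlonglongrightarrow>
          cnorm (universal_cstar R) (U.cls (\<lambda>k. X n) \<ominus>\<^bsub>universal_cstar R\<^esub> U.cls X)"
        unfolding universal_cstar_def U.minus_completion(1)[OF c X]
        by (rule U.norm_completion_tendsto[OF U.minus_completion(2)[OF c X]])
      show ?thesis
        by (rule LIMSEQ_le_const2[OF lim]) (use M n in \<open>auto intro!: exI[of _ M] less_imp_le\<close>)
    qed
    moreover have "0 \<le> cnorm (universal_cstar R) (U.cls (\<lambda>k. X n) \<ominus>\<^bsub>universal_cstar R\<^esub> U.cls X)" for n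
      using carr X by (intro C.norm_nonneg C.minus_closed) (auto simp: universal_cstar_def)
    moreover have "norm (cnorm (universal_cstar R) (U.cls (\<lambda>k. X n) \<ominus>\<^bsub>universal_cstar R\<^esub> U.cls X) - 0) < r"
      if "n \<ge> M" for n
    proof -
      have "cnorm (universal_cstar R) (U.cls (\<lambda>k. X n) \<ominus>\<^bsub>universal_cstar R\<^esub> U.cls X) \<le> r / 2"
        "0 \<le> cnorm (universal_cstar R) (U.cls (\<lambda>k. X n) \<ominus>\<^bsub>universal_cstar R\<^esub> U.cls X)"
        using calculation that by blast+
      then show ?thesis using \<open>0 < r\<close> by simp
    qed
    ultimately show "\<exists>no. \<forall>n\<ge>no. norm (cnorm (universal_cstar R) (U.cls (\<lambda>k. X n) \<ominus>\<^bsub>universal_cstar R\<^esub> U.cls X) - 0) < r"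
      by blast
  qed
qed

lemma ev_gen_eq:
  assumes "x \<in> free_algebra"
  shows "evaluation.ev (universal_cstar R) (universal_gen R) x = U.cls (\<lambda>n. x)"
proof -
  interpret G: evaluation "universal_cstar R" "universal_gen R"
    by unfold_locales (rule gen_closed)
  show ?thesis using assms
  proof (induction x rule: free_algebra_induct)
    case (gen g)
    show ?case unfolding G.ev_gen by (rule universal_gen_eq)
  next
    case (adj_gen g)
    show ?case unfolding G.ev_adj G.ev_gen unfolding universal_gen_eq universal_cstar_def
      by (simp add: U.adj_completion)
  next
    case (mult x y)
    then show ?case by (simp add: G.ev_mult) (simp add: universal_cstar_def U.mult_completion)
  next
    case zero
    show ?case unfolding G.ev_zero by (simp add: universal_cstar_def U.zero_completion)
  next
    case (add x y)
    then show ?case by (simp add: G.ev_add) (simp add: universal_cstar_def U.add_completion)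
  next
    case (scale a x)
    then show ?case by (simp add: G.ev_scale) (simp add: universal_cstar_def U.scale_completion)
  qed
qed

lemma universal_induct [consumes 1, case_names gen zero add mult scale adj limit]:
  assumes x: "x \<in> carrier (universal_cstar R)"
    and gen: "\<And>g. P (universal_gen R g)"
    and zero: "P \<zero>\<^bsub>universal_cstar R\<^esub>"
    and add: "\<And>x y. x \<in> carrier (universal_cstar R) \<Longrightarrow> y \<in> carrier (universal_cstar R) \<Longrightarrow>
        P x \<Longrightarrow> P y \<Longrightarrow> P (x \<oplus>\<^bsub>universal_cstar R\<^esub> y)"
    and mult: "\<And>x y. x \<in> carrier (universal_cstar R) \<Longrightarrow> y \<in> carrier (universal_cstar R) \<Longrightarrow>
        P x \<Longrightarrow> P y \<Longrightarrow> P (x \<otimes>\<^bsub>universal_cstar R\<^esub> y)"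
    and scale: "\<And>a x. x \<in> carrier (universal_cstar R) \<Longrightarrow> P x \<Longrightarrow> P (a \<odot>\<^bsub>universal_cstar R\<^esub> x)"
    and adj: "\<And>x. x \<in> carrier (universal_cstar R) \<Longrightarrow> P x \<Longrightarrow> P (adj (universal_cstar R) x)"
    and limit: "\<And>X x. (\<And>n. X n \<in> carrier (universal_cstar R)) \<Longrightarrow> (\<And>n. P (X n)) \<Longrightarrow>
        x \<in> carrier (universal_cstar R) \<Longrightarrow>
        (\<lambda>n. cnorm (universal_cstar R) (X n \<ominus>\<^bsub>universal_cstar R\<^esub> x)) \<longlonglongrightarrow> 0 \<Longrightarrow> P x"
  shows "P x"
proof -
  interpret G: evaluation "universal_cstar R" "universal_gen R"
    by unfold_locales (rule gen_closed)
  have P: "P (G.ev y)" if "y \<in> free_algebra" for y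
    using that
  proof (induction y rule: free_algebra_induct)
    case (mult x y)
    then show ?case by (simp add: G.ev_mult assms)
  qed (simp_all add: G.ev_adj G.ev_add G.ev_scale assms gen_closed)
  obtain X where X: "X \<in> cauchy_seqs (universal_seminorm R)" "x = U.cls X"
    using x by (auto simp: universal_cstar_def U.carrier_completion)
  note t = cls_const_tends[OF X(1), folded X(2)]
  show ?thesis
    by (rule limit[OF C.tendsD(1)[OF t] _ C.tendsD(2)[OF t] C.tendsD(3)[OF t]])
       (use P ev_gen_eq U.csD(1)[OF X(1)] in metis)
qed

theorem universal_property:
  assumes B: "cstar_algebra (B :: 'b cstar)" and q: "\<And>g. q g \<in> carrier B"
    and rel: "\<And>x. x \<in> R \<Longrightarrow> evaluation.ev B q x = \<zero>\<^bsub>B\<^esub>"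
  obtains \<pi> where "star_hom (universal_cstar R) B \<pi>"
    and "\<And>x. x \<in> carrier (universal_cstar R) \<Longrightarrow> cnorm B (\<pi> x) \<le> cnorm (universal_cstar R) x"
    and "\<And>g. \<pi> (universal_gen R g) = q g"
proof -
  interpret B: evaluation B q
    using B q by (auto intro!: evaluation.intro evaluation_axioms.intro)
  let ?U = "universal_seminorm R"
  let ?C = "universal_cstar R"
  have "(\<lambda>x. cnorm B (B.ev x)) \<in> admissible_seminorms R"
    using rel B.seminorm_ev by (simp add: admissible_seminorms_def)
  note le = admissible_le[OF this]
  have conv: "\<exists>L. B.tends (\<lambda>n. B.ev (X n)) L sequentially" if X: "X \<in> cauchy_seqs ?U" for X
  proof -
    have "\<exists>L\<in>carrier B. (\<lambda>n. cnorm B (B.ev (X n) \<ominus>\<^bsub>B\<^esub> L)) \<longlonglongrightarrow> 0"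
    proof (rule B.complete)
      fix \<epsilon> :: real assume "\<epsilon> > 0"
      then obtain M where "\<forall>m\<ge>M. \<forall>n\<ge>M. ?U (X m - X n) < \<epsilon>" using U.csD(2)[OF X] by blast
      moreover have "cnorm B (B.ev (X m) \<ominus>\<^bsub>B\<^esub> B.ev (X n)) \<le> ?U (X m - X n)" for m n
        using le[of "X m - X n"] U.csD(1)[OF X] by (simp add: B.ev_diff)
      ultimately show "\<exists>M. \<forall>m\<ge>M. \<forall>n\<ge>M. cnorm B (B.ev (X m) \<ominus>\<^bsub>B\<^esub> B.ev (X n)) < \<epsilon>"
        by (meson le_less_trans)
    qed simp
    then show ?thesis by (auto simp: B.tends_def)
  qed
  define \<pi> where "\<pi> x = (SOME L. \<exists>X\<in>cauchy_seqs ?U. x = U.cls X \<and> B.tends (\<lambda>n. B.ev (X n)) L sequentially)" for x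
  have \<pi>: "B.tends (\<lambda>n. B.ev (X n)) (\<pi> (U.cls X)) sequentially" if X: "X \<in> cauchy_seqs ?U" for X
  proof -
    have "\<exists>L. \<exists>Y\<in>cauchy_seqs ?U. U.cls X = U.cls Y \<and> B.tends (\<lambda>n. B.ev (Y n)) L sequentially"
      using X conv by blast
    then have "\<exists>Y\<in>cauchy_seqs ?U. U.cls X = U.cls Y \<and> B.tends (\<lambda>n. B.ev (Y n)) (\<pi> (U.cls X)) sequentially"
      unfolding \<pi>_def by (rule someI_ex)
    then obtain Y where Y: "Y \<in> cauchy_seqs ?U" "U.cls X = U.cls Y"
      "B.tends (\<lambda>n. B.ev (Y n)) (\<pi> (U.cls X)) sequentially" by blast
    let ?L = "\<pi> (U.cls X)"
    have "(\<lambda>n. ?U (X n - Y n)) \<longlonglongrightarrow> 0" using U.cls_eq_iff[OF X Y(1)] Y(2) by simp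
    from tendsto_add[OF this B.tendsD(3)[OF Y(3)]]
    have "(\<lambda>n. ?U (X n - Y n) + cnorm B (B.ev (Y n) \<ominus>\<^bsub>B\<^esub> ?L)) \<longlonglongrightarrow> 0" by simp
    then show ?thesis
    proof (rule B.tendsI[rotated 3])
      show L: "?L \<in> carrier B" by (rule B.tendsD[OF Y(3)])
      fix n
      have "cnorm B (B.ev (X n) \<ominus>\<^bsub>B\<^esub> ?L) \<le> cnorm B (B.ev (X n) \<ominus>\<^bsub>B\<^esub> B.ev (Y n)) + cnorm B (B.ev (Y n) \<ominus>\<^bsub>B\<^esub> ?L)"
        by (rule B.norm_diff_triangle) (use L in auto)
      then show "cnorm B (B.ev (X n) \<ominus>\<^bsub>B\<^esub> ?L) \<le> ?U (X n - Y n) + cnorm B (B.ev (Y n) \<ominus>\<^bsub>B\<^esub> ?L)"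
        using le[of "X n - Y n"] U.csD(1)[OF X] U.csD(1)[OF Y(1)] by (simp add: B.ev_diff)
    qed simp
  qed
  have seq: "sequentially \<noteq> bot" by simp
  show thesis
  proof (rule that[of \<pi>])
    show "\<pi> (universal_gen R g) = q g" for g
    proof -
      have "B.tends (\<lambda>n. q g) (\<pi> (U.cls (\<lambda>n. free_gen g))) sequentially"
        using \<pi>[of "\<lambda>n. free_gen g"] by simp
      then show ?thesis
        using B.tends_unique[OF _ B.tends_const[OF q[of g]] seq] by (simp add: universal_gen_eq)
    qed
    show "cnorm B (\<pi> x) \<le> cnorm ?C x" if x: "x \<in> carrier ?C" for x
    proof -
      obtain X where X: "X \<in> cauchy_seqs ?U" "x = U.cls X"
        using x by (auto simp: universal_cstar_def U.carrier_completion)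
      show ?thesis unfolding X(2) universal_cstar_def
        by (rule LIMSEQ_le[OF B.tends_norm[OF \<pi>[OF X(1)]] U.norm_completion_tendsto[OF X(1)]])
           (use le U.csD(1)[OF X(1)] in blast)
    qed
    show "star_hom ?C B \<pi>"
      unfolding star_hom_def universal_cstar_def U.carrier_completion
    proof (intro conjI ballI allI funcsetI; (elim imageE)?)
      fix x X assume x: "x = U.cls X" "X \<in> cauchy_seqs ?U"
      show "\<pi> x \<in> carrier B" unfolding x by (rule B.tendsD(2)[OF \<pi>[OF x(2)]])
      show "\<pi> (a \<odot>\<^bsub>free_completion ?U\<^esub> x) = a \<odot>\<^bsub>B\<^esub> \<pi> x" for a
        using B.tends_unique[OF \<pi>[OF U.cs_scale[OF x(2), of a]] _ seq] B.tends_scale[OF \<pi>[OF x(2)], of a] x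
        by (simp add: B.ev_scale U.scale_completion)
      show "\<pi> (adj (free_completion ?U) x) = adj B (\<pi> x)"
        using B.tends_unique[OF \<pi>[OF U.cs_adj[OF x(2)]] _ seq] B.tends_adj[OF \<pi>[OF x(2)]] x
        by (simp add: B.ev_adj U.adj_completion)
      fix y Y assume y: "y = U.cls Y" "Y \<in> cauchy_seqs ?U"
      show "\<pi> (x \<oplus>\<^bsub>free_completion ?U\<^esub> y) = \<pi> x \<oplus>\<^bsub>B\<^esub> \<pi> y"
        using B.tends_unique[OF \<pi>[OF U.cs_add[OF x(2) y(2)]] _ seq] B.tends_add[OF \<pi>[OF x(2)] \<pi>[OF y(2)]] x y
        by (simp add: B.ev_add U.add_completion)
      show "\<pi> (x \<otimes>\<^bsub>free_completion ?U\<^esub> y) = \<pi> x \<otimes>\<^bsub>B\<^esub> \<pi> y"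
        using B.tends_unique[OF \<pi>[OF U.cs_mult[OF x(2) y(2)]] _ seq] B.tends_mult[OF \<pi>[OF x(2)] \<pi>[OF y(2)]] x y
          U.csD(1)
        by (simp add: B.ev_mult U.mult_completion)
    qed
  qed
qed

end

context evaluation begin

lemma ev_diff_eq_zero: "ev (x - y) = \<zero> \<longleftrightarrow> ev x = ev y"
  using diff_eq_zero[of "ev x" "ev y"] diff_self[of "ev y"] by (auto simp: ev_diff)

end

subsection \<open>Graph C*-algebras\<close>

lemma graph_relations_free: "graph_relations E \<subseteq> free_algebra"
  unfolding graph_relations_def by (auto intro!: free_algebra_sum)

lemma graph_relations_mem:
  "free_adj (free_p v) - free_p v \<in> graph_relations E"
  "free_p v * free_p v - free_p v \<in> graph_relations E"
  "free_adj (free_s e) * free_s e - free_p (src E e) \<in> graph_relations E"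
  unfolding graph_relations_def Un_iff mem_Collect_eq by metis+

lemma graph_family_iff:
  fixes B :: "'a cstar" and q :: "'v + 'e \<Rightarrow> 'a"
  assumes "evaluation B q"
  shows "graph_family E B (q \<circ> Inl) (q \<circ> Inr) \<longleftrightarrow>
    (\<forall>x\<in>graph_relations E. evaluation.ev B q x = \<zero>\<^bsub>B\<^esub>)"
proof -
  interpret evaluation B q by (rule assms)
  have [simp]: "x \<in> free_algebra \<Longrightarrow> y \<in> free_algebra \<Longrightarrow> ev (x * y) = ev x \<otimes>\<^bsub>B\<^esub> ev y" for x y
    by (rule ev_mult)
  have sum: "ev (\<Sum>e\<in>{e. rng E e = v}. free_s e * free_adj (free_s e)) =
      (\<Oplus>\<^bsub>B\<^esub>e\<in>{e. rng E e = v}. q (Inr e) \<otimes>\<^bsub>B\<^esub> adj B (q (Inr e)))" if "\<not> singular_vertex E v" for v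
    using that by (simp add: singular_vertex_def ev_sum ev_adj)
  have ball1: "(\<forall>x\<in>{f v |v. Q v}. P x) \<longleftrightarrow> (\<forall>v. Q v \<longrightarrow> P (f v))"
    for f :: "'c \<Rightarrow> 'd" and P Q by blast
  have ball2: "(\<forall>x\<in>{f v w |v w. Q v w}. P x) \<longleftrightarrow> (\<forall>v w. Q v w \<longrightarrow> P (f v w))"
    for f :: "'c \<Rightarrow> 'd \<Rightarrow> 'x" and P Q by blast
  have "(\<forall>x\<in>graph_relations E. ev x = \<zero>\<^bsub>B\<^esub>) \<longleftrightarrow>
     (\<forall>v. adj B (q (Inl v)) = q (Inl v)) \<and>
     (\<forall>v. q (Inl v) \<otimes>\<^bsub>B\<^esub> q (Inl v) = q (Inl v)) \<and>
     (\<forall>v w. v \<noteq> w \<longrightarrow> q (Inl v) \<otimes>\<^bsub>B\<^esub> q (Inl w) = \<zero>\<^bsub>B\<^esub>) \<and>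
     (\<forall>e. q (Inr e) \<otimes>\<^bsub>B\<^esub> adj B (q (Inr e)) \<otimes>\<^bsub>B\<^esub> q (Inr e) = q (Inr e)) \<and>
     (\<forall>e f. e \<noteq> f \<longrightarrow> (q (Inr e) \<otimes>\<^bsub>B\<^esub> adj B (q (Inr e))) \<otimes>\<^bsub>B\<^esub> (q (Inr f) \<otimes>\<^bsub>B\<^esub> adj B (q (Inr f))) = \<zero>\<^bsub>B\<^esub>) \<and>
     (\<forall>e. adj B (q (Inr e)) \<otimes>\<^bsub>B\<^esub> q (Inr e) = q (Inl (src E e))) \<and>
     (\<forall>e. q (Inl (rng E e)) \<otimes>\<^bsub>B\<^esub> (q (Inr e) \<otimes>\<^bsub>B\<^esub> adj B (q (Inr e))) = q (Inr e) \<otimes>\<^bsub>B\<^esub> adj B (q (Inr e))) \<and>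
     (\<forall>v. \<not> singular_vertex E v \<longrightarrow>
        q (Inl v) = (\<Oplus>\<^bsub>B\<^esub>e\<in>{e. rng E e = v}. q (Inr e) \<otimes>\<^bsub>B\<^esub> adj B (q (Inr e))))"
    unfolding graph_relations_def ball_Un conj_assoc ball1 ball2
    by (simp add: ev_diff_eq_zero ev_adj sum cong: imp_cong)
  note eq = this
  show ?thesis
    unfolding eq graph_family_def projection_def o_def by (simp add: q all_conj_distrib)
qed

interpretation graph: bounded_relations "graph_relations E" for E :: "('v, 'e) graph"
proof
  show "graph_relations E \<subseteq> free_algebra" by (rule graph_relations_free)
  fix g :: "'v + 'e"
  have p1: "N (free_p v) \<le> 1" if adm: "N \<in> admissible_seminorms (graph_relations E)" for N v
  proof -
    interpret cstar_seminormed N using adm by unfold_locales (simp add: admissible_seminorms_def)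
    have "N (free_adj (free_p v) - free_p v) = 0" "N (free_p v * free_p v - free_p v) = 0"
      using adm graph_relations_mem(1,2)[of v E] by (simp_all add: admissible_seminorms_def)
    moreover have "\<bar>N (free_adj (free_p v) * free_p v) - N (free_p v * free_p v)\<bar> \<le>
        N (free_adj (free_p v) - free_p v) * N (free_p v)"
      using N_abs_diff[of "free_adj (free_p v) * free_p v" "free_p v * free_p v"]
        N_mult[of "free_adj (free_p v) - free_p v" "free_p v"] by (simp add: left_diff_distrib)
    moreover have "\<bar>N (free_p v * free_p v) - N (free_p v)\<bar> \<le> N (free_p v * free_p v - free_p v)"
      by (rule N_abs_diff) auto
    ultimately have "(N (free_p v))\<^sup>2 = N (free_p v)"
      by (simp add: N_square[symmetric])
    then show ?thesis by (cases "N (free_p v) = 0") (auto simp: power2_eq_square)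
  qed
  have s1: "N (free_s e) \<le> 1" if adm: "N \<in> admissible_seminorms (graph_relations E)" for N e
  proof -
    interpret cstar_seminormed N using adm by unfold_locales (simp add: admissible_seminorms_def)
    have "N (free_adj (free_s e) * free_s e - free_p (src E e)) = 0"
      using adm graph_relations_mem(3)[of e E] by (simp add: admissible_seminorms_def)
    moreover have "\<bar>N (free_adj (free_s e) * free_s e) - N (free_p (src E e))\<bar> \<le>
        N (free_adj (free_s e) * free_s e - free_p (src E e))"
      by (rule N_abs_diff) auto
    ultimately have "(N (free_s e))\<^sup>2 \<le> 1\<^sup>2"
      using p1[OF adm, of "src E e"] by (simp add: N_square[symmetric])
    then show ?thesis by (rule power2_le_imp_le) simp
  qed
  show "\<exists>K. \<forall>N\<in>admissible_seminorms (graph_relations E). N (free_gen g) \<le> K"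
    using p1 s1 by (cases g) blast+
qed

lemma cstar_algebra_graph: "cstar_algebra (graph_cstar E)"
  unfolding graph_cstar_def by (rule graph.cstar_universal)

lemma graph_family_graph: "graph_family E (graph_cstar E) (vertex_proj E) (edge_isom E)"
proof -
  have ev: "evaluation (graph_cstar E) (universal_gen (graph_relations E))"
    using cstar_algebra_graph[of E] graph.gen_closed[of E]
    by (auto intro!: evaluation.intro evaluation_axioms.intro simp: graph_cstar_def)
  have "\<forall>x\<in>graph_relations E. evaluation.ev (graph_cstar E) (universal_gen (graph_relations E)) x = \<zero>\<^bsub>graph_cstar E\<^esub>"
    using graph.ev_gen_eq[of _ E] graph.cls_relation[of _ E] graph_relations_free[of E]
    by (auto simp: graph_cstar_def)
  then have "graph_family E (graph_cstar E) (universal_gen (graph_relations E) \<circ> Inl)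
      (universal_gen (graph_relations E) \<circ> Inr)"
    using graph_family_iff[OF ev] by blast
  moreover have "universal_gen (graph_relations E) \<circ> Inl = vertex_proj E"
    "universal_gen (graph_relations E) \<circ> Inr = edge_isom E"
    by (auto simp: vertex_proj_def edge_isom_def)
  ultimately show ?thesis by simp
qed

theorem graph_universal_property:
  assumes B: "cstar_algebra B" and fam: "graph_family E B p s"
  obtains \<pi> where "star_hom (graph_cstar E) B \<pi>"
    and "\<And>x. x \<in> carrier (graph_cstar E) \<Longrightarrow> cnorm B (\<pi> x) \<le> cnorm (graph_cstar E) x"
    and "\<And>v. \<pi> (vertex_proj E v) = p v" and "\<And>e. \<pi> (edge_isom E e) = s e"
proof -
  have q: "case_sum p s g \<in> carrier B" for g
    using fam by (cases g) (auto simp: graph_family_def projection_def)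
  have ev: "evaluation B (case_sum p s)"
    using B q by (auto intro!: evaluation.intro evaluation_axioms.intro)
  have "graph_family E B (case_sum p s \<circ> Inl) (case_sum p s \<circ> Inr)"
    using fam by (simp add: comp_def)
  then have rel: "evaluation.ev B (case_sum p s) x = \<zero>\<^bsub>B\<^esub>" if "x \<in> graph_relations E" for x
    using graph_family_iff[OF ev] that by blast
  obtain \<pi> where \<pi>: "star_hom (universal_cstar (graph_relations E)) B \<pi>"
    "\<And>x. x \<in> carrier (universal_cstar (graph_relations E)) \<Longrightarrow>
        cnorm B (\<pi> x) \<le> cnorm (universal_cstar (graph_relations E)) x"
    "\<And>g. \<pi> (universal_gen (graph_relations E) g) = case_sum p s g"
    using graph.universal_property[OF B q rel] by metis
  show thesis
    by (rule that[of \<pi>]) (use \<pi> in \<open>auto simp: graph_cstar_def vertex_proj_def edge_isom_def\<close>)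
qed

lemma graph_induct [consumes 1, case_names vertex edge zero add mult scale adj limit]:
  assumes x: "x \<in> carrier (graph_cstar E)"
    and "\<And>v. P (vertex_proj E v)" "\<And>e. P (edge_isom E e)"
    and "P \<zero>\<^bsub>graph_cstar E\<^esub>"
    and "\<And>x y. x \<in> carrier (graph_cstar E) \<Longrightarrow> y \<in> carrier (graph_cstar E) \<Longrightarrow>
        P x \<Longrightarrow> P y \<Longrightarrow> P (x \<oplus>\<^bsub>graph_cstar E\<^esub> y)"
    and "\<And>x y. x \<in> carrier (graph_cstar E) \<Longrightarrow> y \<in> carrier (graph_cstar E) \<Longrightarrow>
        P x \<Longrightarrow> P y \<Longrightarrow> P (x \<otimes>\<^bsub>graph_cstar E\<^esub> y)"
    and "\<And>a x. x \<in> carrier (graph_cstar E) \<Longrightarrow> P x \<Longrightarrow> P (a \<odot>\<^bsub>graph_cstar E\<^esub> x)"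
    and "\<And>x. x \<in> carrier (graph_cstar E) \<Longrightarrow> P x \<Longrightarrow> P (adj (graph_cstar E) x)"
    and "\<And>X x. (\<And>n. X n \<in> carrier (graph_cstar E)) \<Longrightarrow> (\<And>n. P (X n)) \<Longrightarrow>
        x \<in> carrier (graph_cstar E) \<Longrightarrow>
        (\<lambda>n. cnorm (graph_cstar E) (X n \<ominus>\<^bsub>graph_cstar E\<^esub> x)) \<longlonglongrightarrow> 0 \<Longrightarrow> P x"
  shows "P x"
proof (rule graph.universal_induct[OF x[unfolded graph_cstar_def], of P])
  show "P (universal_gen (graph_relations E) g)" for g
    using assms(2,3) by (cases g) (simp_all add: vertex_proj_def edge_isom_def)
qed (fact assms(4-)[unfolded graph_cstar_def])+

subsection \<open>Existence of the action\<close>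

definition "contractive_endo E f \<longleftrightarrow> star_hom (graph_cstar E) (graph_cstar E) f \<and>
  (\<forall>x\<in>carrier (graph_cstar E). cnorm (graph_cstar E) (f x) \<le> cnorm (graph_cstar E) x)"

lemma contractive_endoD:
  assumes "contractive_endo E f" "x \<in> carrier (graph_cstar E)"
  shows "f x \<in> carrier (graph_cstar E)"
    "cnorm (graph_cstar E) (f x) \<le> cnorm (graph_cstar E) x"
    "f (a \<odot>\<^bsub>graph_cstar E\<^esub> x) = a \<odot>\<^bsub>graph_cstar E\<^esub> f x"
    "f (adj (graph_cstar E) x) = adj (graph_cstar E) (f x)"
    "y \<in> carrier (graph_cstar E) \<Longrightarrow> f (x \<oplus>\<^bsub>graph_cstar E\<^esub> y) = f x \<oplus>\<^bsub>graph_cstar E\<^esub> f y"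
    "y \<in> carrier (graph_cstar E) \<Longrightarrow> f (x \<otimes>\<^bsub>graph_cstar E\<^esub> y) = f x \<otimes>\<^bsub>graph_cstar E\<^esub> f y"
  using assms unfolding contractive_endo_def star_hom_def by (simp_all add: Pi_iff)

lemma contractive_endo_comp: "contractive_endo E f \<Longrightarrow> contractive_endo E g \<Longrightarrow> contractive_endo E (\<lambda>x. f (g x))"
proof -
  assume f: "contractive_endo E f" and g: "contractive_endo E g"
  have "cnorm (graph_cstar E) (f (g x)) \<le> cnorm (graph_cstar E) x" if "x \<in> carrier (graph_cstar E)" for x
    using contractive_endoD(2)[OF f contractive_endoD(1)[OF g that]] contractive_endoD(2)[OF g that] by linarith
  then show ?thesis
    unfolding contractive_endo_def star_hom_def by (simp add: Pi_iff contractive_endoD[OF f] contractive_endoD[OF g])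
qed

lemma contractive_endo_diff:
  assumes "contractive_endo E f" "x \<in> carrier (graph_cstar E)" "y \<in> carrier (graph_cstar E)"
  shows "f (x \<ominus>\<^bsub>graph_cstar E\<^esub> y) = f x \<ominus>\<^bsub>graph_cstar E\<^esub> f y"
proof -
  interpret cstar_algebra "graph_cstar E" by (rule cstar_algebra_graph)
  have "f (\<ominus>\<^bsub>graph_cstar E\<^esub> y) = \<ominus>\<^bsub>graph_cstar E\<^esub> f y"
    using contractive_endoD(3)[OF assms(1,3), of "-1"] contractive_endoD(1)[OF assms(1,3)] assms by (simp add: scale_minus)
  then show ?thesis using contractive_endoD[OF assms(1)] assms by (simp add: a_minus_def)
qed

lemma contractive_endo_eq:
  assumes f: "contractive_endo E f" and g: "contractive_endo E g"
    and "\<And>v. f (vertex_proj E v) = g (vertex_proj E v)" "\<And>e. f (edge_isom E e) = g (edge_isom E e)"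
    and x: "x \<in> carrier (graph_cstar E)"
  shows "f x = g x"
proof -
  interpret cstar_algebra "graph_cstar E" by (rule cstar_algebra_graph)
  note [simp] = contractive_endoD[OF f] contractive_endoD[OF g]
  show ?thesis using x
  proof (induction x rule: graph_induct)
    case zero
    have "h \<zero>\<^bsub>graph_cstar E\<^esub> = \<zero>\<^bsub>graph_cstar E\<^esub>" if h: "contractive_endo E h" for h
      using contractive_endoD(3)[OF h, of "\<zero>\<^bsub>graph_cstar E\<^esub>" 0] contractive_endoD(1)[OF h, of "\<zero>\<^bsub>graph_cstar E\<^esub>"] by simp
    from this[OF f] this[OF g] show ?case by (rule trans[OF _ sym])
  next
    case (limit X x)
    have "tends (\<lambda>n. f (X n)) (h x) sequentially" if h: "contractive_endo E h" "\<And>n. f (X n) = h (X n)" for h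
    proof (rule tendsI)
      show "(\<lambda>n. cnorm (graph_cstar E) (X n \<ominus>\<^bsub>graph_cstar E\<^esub> x)) \<longlonglongrightarrow> 0" by (rule limit)
      show "cnorm (graph_cstar E) (f (X n) \<ominus>\<^bsub>graph_cstar E\<^esub> h x) \<le> cnorm (graph_cstar E) (X n \<ominus>\<^bsub>graph_cstar E\<^esub> x)" for n
        using contractive_endoD(2)[OF h(1), of "X n \<ominus>\<^bsub>graph_cstar E\<^esub> x"] contractive_endo_diff[OF h(1), of "X n" x] limit
        by (simp add: h(2))
    qed (use limit contractive_endoD[OF h(1)] in auto)
    from tends_unique[OF this[OF f] this[OF g]] show ?case using limit by auto
  qed (use assms in auto)
qed

theorem graph_action_exists:
  assumes c: "\<And>e. c e > 0"
  shows "\<exists>\<sigma>. graph_action E c \<sigma>"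
proof -
  let ?A = "graph_cstar E"
  interpret cstar_algebra "graph_cstar E" by (rule cstar_algebra_graph)
  define u where "u t e = complex_of_real (c e) powr (\<i> * complex_of_real t)" for t e
  have u_eq: "u t e = cis (t * ln (c e))" for t e
    using c[of e] by (auto simp: u_def powr_def cis_conv_exp Ln_of_real mult_ac)
  have u1: "u t e * cnj (u t e) = 1" for t e
    by (simp add: u_eq cis_cnj cis_mult)
  have fam: "graph_family E ?A (vertex_proj E) (\<lambda>e. u t e \<odot>\<^bsub>?A\<^esub> edge_isom E e)" for t
  proof -
    have carr: "edge_isom E e \<in> carrier ?A" for e
      using graph_family_graph[of E] by (simp add: graph_family_def)
    have 1: "(u t e \<odot>\<^bsub>?A\<^esub> edge_isom E e) \<otimes>\<^bsub>?A\<^esub> adj ?A (u t e \<odot>\<^bsub>?A\<^esub> edge_isom E e) =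
        edge_isom E e \<otimes>\<^bsub>?A\<^esub> adj ?A (edge_isom E e)" for e
      using carr u1 by (simp add: adj_scale scale_mult_left scale_mult_right adj_closed scale_closed
          mult_closed scale_scale scale_one mult.commute)
    have 2: "adj ?A (u t e \<odot>\<^bsub>?A\<^esub> edge_isom E e) \<otimes>\<^bsub>?A\<^esub> (u t e \<odot>\<^bsub>?A\<^esub> edge_isom E e) =
        adj ?A (edge_isom E e) \<otimes>\<^bsub>?A\<^esub> edge_isom E e" for e
      using carr u1 by (simp add: adj_scale scale_mult_left scale_mult_right adj_closed scale_closed
          mult_closed scale_scale scale_one mult.commute)
    show ?thesis
      using graph_family_graph[of E] carr unfolding graph_family_def 1 2
      by (simp add: scale_mult_right adj_closed mult_closed scale_closed)
  qed
  have "\<exists>\<pi>. contractive_endo E \<pi> \<and> (\<forall>v. \<pi> (vertex_proj E v) = vertex_proj E v) \<and>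
      (\<forall>e. \<pi> (edge_isom E e) = u t e \<odot>\<^bsub>?A\<^esub> edge_isom E e)" for t
    using graph_universal_property[OF cstar_algebra_graph fam[of t]] unfolding contractive_endo_def by metis
  then obtain \<sigma> where \<sigma>: "\<And>t. contractive_endo E (\<sigma> t)"
    and p: "\<And>t v. \<sigma> t (vertex_proj E v) = vertex_proj E v"
    and s: "\<And>t e. \<sigma> t (edge_isom E e) = u t e \<odot>\<^bsub>?A\<^esub> edge_isom E e"
    by metis
  have carr: "edge_isom E e \<in> carrier ?A" "vertex_proj E v \<in> carrier ?A" for e v
    using graph_family_graph[of E] by (simp_all add: graph_family_def projection_def)
  have u_add: "u (t + t') e = u t e * u t' e" for t t' e
    by (simp add: u_eq cis_mult algebra_simps)
  have add: "\<sigma> (t + t') x = \<sigma> t (\<sigma> t' x)" if "x \<in> carrier ?A" for t t' x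
    by (rule contractive_endo_eq[OF \<sigma> contractive_endo_comp[OF \<sigma> \<sigma>] _ _ that])
       (simp_all add: p s contractive_endoD[OF \<sigma>] carr u_add scale_scale mult.commute)
  have id: "contractive_endo E (\<lambda>x. x)" by (auto simp: contractive_endo_def star_hom_def)
  have zero: "\<sigma> 0 x = x" if "x \<in> carrier ?A" for x
    by (rule contractive_endo_eq[OF \<sigma> id _ _ that]) (simp_all add: p s u_eq scale_one carr)
  have inv: "\<sigma> (- t) (\<sigma> t x) = x" "\<sigma> t (\<sigma> (- t) x) = x" if "x \<in> carrier ?A" for t x
    using add[OF that, of "- t" t] add[OF that, of t "- t"] zero[OF that] by simp_all
  have auto: "star_automorphism ?A (\<sigma> t)" for t
    unfolding star_automorphism_def
  proof (intro conjI ballI)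
    show "star_hom ?A ?A (\<sigma> t)" using \<sigma> by (simp add: contractive_endo_def)
    show "bij_betw (\<sigma> t) (carrier ?A) (carrier ?A)"
      by (rule bij_betwI[where g = "\<sigma> (- t)"]) (use inv contractive_endoD[OF \<sigma>] in auto)
    show "cnorm ?A (\<sigma> t x) = cnorm ?A x" if x: "x \<in> carrier ?A" for x
      using contractive_endoD(2)[OF \<sigma> x, of t] contractive_endoD(2)[OF \<sigma> contractive_endoD(1)[OF \<sigma> x], of "- t" t] inv[OF x, of t] by simp
  qed
  have cont: "tends (\<lambda>r. \<sigma> r x) (\<sigma> t x) (at t)" if "x \<in> carrier ?A" for x t
    using that
  proof (induction x rule: graph_induct)
    case (vertex v)
    show ?case unfolding p by (rule tends_const[OF carr(2)])
  next
    case (edge e)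
    have diff: "cnorm ?A (u r e \<odot>\<^bsub>?A\<^esub> edge_isom E e \<ominus>\<^bsub>?A\<^esub> u t e \<odot>\<^bsub>?A\<^esub> edge_isom E e) =
        cmod (u r e - u t e) * cnorm ?A (edge_isom E e)" for r
    proof -
      have "u r e \<odot>\<^bsub>?A\<^esub> edge_isom E e = (u r e - u t e) \<odot>\<^bsub>?A\<^esub> edge_isom E e \<oplus>\<^bsub>?A\<^esub> u t e \<odot>\<^bsub>?A\<^esub> edge_isom E e"
        using add_scale[OF carr(1), of "u r e - u t e" "u t e" e] by simp
      then have "u r e \<odot>\<^bsub>?A\<^esub> edge_isom E e \<ominus>\<^bsub>?A\<^esub> u t e \<odot>\<^bsub>?A\<^esub> edge_isom E e = (u r e - u t e) \<odot>\<^bsub>?A\<^esub> edge_isom E e"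
        by (simp add: a_minus_def a_assoc r_neg scale_closed carr)
      then show ?thesis using norm_scale[OF carr(1)] by simp
    qed
    have "((\<lambda>r. cmod (u r e - u t e) * cnorm ?A (edge_isom E e)) \<longlongrightarrow>
        cmod (u t e - u t e) * cnorm ?A (edge_isom E e)) (at t)"
      unfolding u_eq cis_conv_exp by (intro tendsto_intros)
    then show ?case unfolding s
      by (intro tendsI[where f = "\<lambda>r. cmod (u r e - u t e) * cnorm ?A (edge_isom E e)"])
         (simp_all add: diff scale_closed carr)
  next
    case zero
    have "\<sigma> r \<zero>\<^bsub>?A\<^esub> = \<zero>\<^bsub>?A\<^esub>" for r
      using contractive_endoD(3)[OF \<sigma>[of r], of "\<zero>\<^bsub>?A\<^esub>" 0] contractive_endoD(1)[OF \<sigma>[of r]] by simp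
    then show ?case by (simp add: tends_const)
  next
    case (add x y)
    then show ?case using tends_add[OF add(3,4)] by (simp add: contractive_endoD[OF \<sigma>])
  next
    case (mult x y)
    then show ?case using tends_mult[OF mult(3,4)] by (simp add: contractive_endoD[OF \<sigma>])
  next
    case (scale a x)
    then show ?case using tends_scale[OF scale(2)] by (simp add: contractive_endoD[OF \<sigma>])
  next
    case (adj x)
    then show ?case using tends_adj[OF adj(2)] by (simp add: contractive_endoD[OF \<sigma>])
  next
    case (limit X x)
    have cl: "\<sigma> r y \<in> carrier ?A" if "y \<in> carrier ?A" for r y using contractive_endoD(1)[OF \<sigma> that] .
    have iso: "cnorm ?A (\<sigma> r (X n) \<ominus>\<^bsub>?A\<^esub> \<sigma> r x) \<le> cnorm ?A (X n \<ominus>\<^bsub>?A\<^esub> x)" for r n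
      using contractive_endoD(2)[OF \<sigma>[of r], of "X n \<ominus>\<^bsub>?A\<^esub> x"] contractive_endo_diff[OF \<sigma>[of r], of "X n" x] limit by simp
    show ?case unfolding tends_def
    proof (intro conjI allI)
      show "((\<lambda>r. cnorm ?A (\<sigma> r x \<ominus>\<^bsub>?A\<^esub> \<sigma> t x)) \<longlongrightarrow> 0) (at t)"
      proof (rule tendstoI)
        fix \<epsilon> :: real assume e: "\<epsilon> > 0"
        then have "eventually (\<lambda>n. cnorm ?A (X n \<ominus>\<^bsub>?A\<^esub> x) < \<epsilon> / 3) sequentially"
          by (intro order_tendstoD(2)[OF limit.hyps(3)]) auto
        then obtain n where n: "cnorm ?A (X n \<ominus>\<^bsub>?A\<^esub> x) < \<epsilon> / 3"
          by (auto simp: eventually_sequentially)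
        have "eventually (\<lambda>r. cnorm ?A (\<sigma> r (X n) \<ominus>\<^bsub>?A\<^esub> \<sigma> t (X n)) < \<epsilon> / 3) (at t)"
          using e by (intro order_tendstoD(2)[OF tendsD(3)[OF limit.IH[of n]]]) auto
        then show "eventually (\<lambda>r. dist (cnorm ?A (\<sigma> r x \<ominus>\<^bsub>?A\<^esub> \<sigma> t x)) 0 < \<epsilon>) (at t)"
        proof (rule eventually_mono)
          fix r assume r: "cnorm ?A (\<sigma> r (X n) \<ominus>\<^bsub>?A\<^esub> \<sigma> t (X n)) < \<epsilon> / 3"
          have "cnorm ?A (\<sigma> r x \<ominus>\<^bsub>?A\<^esub> \<sigma> t x) \<le>
              cnorm ?A (\<sigma> r x \<ominus>\<^bsub>?A\<^esub> \<sigma> r (X n)) + cnorm ?A (\<sigma> r (X n) \<ominus>\<^bsub>?A\<^esub> \<sigma> t x)"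
            using limit by (intro norm_diff_triangle cl) auto
          moreover have "cnorm ?A (\<sigma> r (X n) \<ominus>\<^bsub>?A\<^esub> \<sigma> t x) \<le>
              cnorm ?A (\<sigma> r (X n) \<ominus>\<^bsub>?A\<^esub> \<sigma> t (X n)) + cnorm ?A (\<sigma> t (X n) \<ominus>\<^bsub>?A\<^esub> \<sigma> t x)"
            using limit by (intro norm_diff_triangle cl) auto
          moreover have "cnorm ?A (\<sigma> r x \<ominus>\<^bsub>?A\<^esub> \<sigma> r (X n)) = cnorm ?A (\<sigma> r (X n) \<ominus>\<^bsub>?A\<^esub> \<sigma> r x)"
            using limit by (intro norm_minus_commute cl) auto
          moreover have "0 \<le> cnorm ?A (\<sigma> r x \<ominus>\<^bsub>?A\<^esub> \<sigma> t x)"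
            using limit by (intro norm_nonneg minus_closed cl) auto
          ultimately show "dist (cnorm ?A (\<sigma> r x \<ominus>\<^bsub>?A\<^esub> \<sigma> t x)) 0 < \<epsilon>"
            using r n iso[of r n] iso[of t n] by (simp add: dist_real_def)
        qed
      qed
    qed (use limit cl in auto)
  qed
  have "graph_action E c \<sigma>"
    unfolding graph_action_def one_parameter_group_def
    using auto zero add cont p s by (auto simp: tends_def u_def)
  then show ?thesis by blast
qed

end

theory Submission
  imports Defs "HOL-Complex_Analysis.Conformal_Mappings"
begin

text \<open>
  Let \<open>\<phi>\<close> be a ground state.  Since \<open>\<sigma>\<close> multiplies \<open>s\<^sub>e\<^sup>*\<close> by \<open>c(e)\<^sup>y\<close> at the point \<open>iy\<close>,
  boundedness forces \<open>\<phi>(s\<^sub>e s\<^sub>e\<^sup>*) = 0\<close>, and by the Cauchy-Schwarz inequality \<open>\<phi>\<close> vanishes on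
  \<open>s\<^sub>e x\<close> and \<open>x s\<^sub>e\<^sup>*\<close>.  As the words \<open>p\<^sub>v\<close>, \<open>s\<^sub>e x\<close>, \<open>x s\<^sub>e\<^sup>*\<close> span a dense subspace, \<open>\<phi>\<close> is determined
  by its values on the \<open>p\<^sub>v\<close>, and relation (3) gives \<open>\<phi>(p\<^sub>v) = 0\<close> for regular \<open>v\<close>.

  Conversely, represent the graph algebra on the finite paths that start at a singular vertex.  For such
  \<open>v\<close> the path of length zero at \<open>v\<close> has a vector state \<open>\<phi>\<^sub>v\<close> with \<open>\<phi>\<^sub>v(p\<^sub>w) = \<delta>\<^bsub>vw\<^esub>\<close>, and \<open>\<tau>\<close> extends to
  \<open>\<Sum>\<^sub>v \<tau>(p\<^sub>v) \<phi>\<^sub>v\<close>.  The coefficient of \<open>\<sigma>\<^sub>\<zeta>(b)\<close> from \<open>v\<close> to a path \<open>\<mu>\<close> is that of \<open>b\<close> times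
  \<open>c(\<mu>)\<close> to the power \<open>i\<zeta>\<close>, a factor of modulus at most 1 on the upper half plane, which bounds
  \<open>\<phi>\<^sub>v(a \<sigma>\<^sub>\<zeta>(b))\<close> by the product of the norms of \<open>a\<close> and \<open>b\<close>.
\<close>

section \<open>Closed spans and bounded functionals\<close>

context cstar_algebra
begin

lemma lin_span_closed:
  assumes "S \<subseteq> carrier A" "x \<in> lin_span A S"
  shows "x \<in> carrier A"
  using assms(2,1)
proof (induction x rule: lin_span.induct)
  case (add_scaled x y a)
  then show ?case by (simp add: scale_closed subset_iff)
qed simp

lemma lin_span_base: "S \<subseteq> carrier A \<Longrightarrow> x \<in> S \<Longrightarrow> x \<in> lin_span A S"
  using lin_span.add_scaled[OF _ lin_span.zero, of x S A 1] by (auto simp: scale_one subset_iff)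

lemma lin_span_add:
  assumes S: "S \<subseteq> carrier A" and "x \<in> lin_span A S" "y \<in> lin_span A S"
  shows "x \<oplus> y \<in> lin_span A S"
  using assms(2)
proof induction
  case zero
  then show ?case using assms(3) lin_span_closed[OF S] by simp
next
  case (add_scaled x z a)
  have "(a \<odot> x \<oplus> z) \<oplus> y = a \<odot> x \<oplus> (z \<oplus> y)"
    using add_scaled S assms(3) lin_span_closed[OF S] by (simp add: a_assoc scale_closed subset_iff)
  then show ?case using lin_span.add_scaled[OF add_scaled(1,3)] by simp
qed

lemma lin_span_scale:
  assumes S: "S \<subseteq> carrier A" and "x \<in> lin_span A S"
  shows "a \<odot> x \<in> lin_span A S"
  using assms(2)
proof induction
  case zero
  have "a \<odot> \<zero> = \<zero>" using scale_scale[of \<zero> a 0] by simp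
  then show ?case by (simp add: lin_span.zero)
next
  case (add_scaled x z b)
  have "a \<odot> (b \<odot> x \<oplus> z) = (a * b) \<odot> x \<oplus> a \<odot> z"
    using add_scaled S lin_span_closed[OF S] by (simp add: scale_add scale_scale scale_closed subset_iff)
  then show ?case using lin_span.add_scaled[OF add_scaled(1,3)] by simp
qed

lemma lin_span_mult:
  assumes S: "S \<subseteq> carrier A" and mult: "\<And>x y. x \<in> S \<Longrightarrow> y \<in> S \<Longrightarrow> x \<otimes> y \<in> lin_span A S"
    and "x \<in> lin_span A S" "y \<in> lin_span A S"
  shows "x \<otimes> y \<in> lin_span A S"
proof -
  have *: "x \<otimes> y \<in> lin_span A S" if "x \<in> S" for x
    using assms(4)
  proof induction
    case zero
    then show ?case using that S by (auto simp: lin_span.zero)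
  next
    case (add_scaled y z a)
    have "x \<otimes> (a \<odot> y \<oplus> z) = a \<odot> (x \<otimes> y) \<oplus> x \<otimes> z"
      using that add_scaled S lin_span_closed[OF S]
      by (simp add: mult_add_right scale_mult_right scale_closed subset_iff)
    then show ?case
      using lin_span_add[OF S lin_span_scale[OF S mult[OF that add_scaled(1)]] add_scaled(3)] by simp
  qed
  show ?thesis using assms(3)
  proof induction
    case zero
    then show ?case using lin_span_closed[OF S assms(4)] by (simp add: lin_span.zero)
  next
    case (add_scaled x z a)
    have "(a \<odot> x \<oplus> z) \<otimes> y = a \<odot> (x \<otimes> y) \<oplus> z \<otimes> y"
      using assms(4) add_scaled S lin_span_closed[OF S]
      by (simp add: mult_add_left scale_mult_left scale_closed subset_iff)
    then show ?case
      using lin_span_add[OF S lin_span_scale[OF S *[OF add_scaled(1)]] add_scaled(3)] by simp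
  qed
qed

lemma lin_span_adj:
  assumes S: "S \<subseteq> carrier A" and adj: "\<And>x. x \<in> S \<Longrightarrow> adj A x \<in> lin_span A S"
    and "x \<in> lin_span A S"
  shows "adj A x \<in> lin_span A S"
  using assms(3)
proof induction
  case zero
  then show ?case by (simp add: lin_span.zero)
next
  case (add_scaled x z a)
  have "adj A (a \<odot> x \<oplus> z) = cnj a \<odot> adj A x \<oplus> adj A z"
    using add_scaled S lin_span_closed[OF S] by (simp add: adj_add adj_scale scale_closed subset_iff)
  then show ?case
    using lin_span_add[OF S lin_span_scale[OF S adj[OF add_scaled(1)]] add_scaled(3)] by simp
qed

lemma lin_span_commute:
  assumes S: "S \<subseteq> carrier A" and comm: "\<And>x y. x \<in> S \<Longrightarrow> y \<in> S \<Longrightarrow> x \<otimes> y = y \<otimes> x"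
    and "x \<in> lin_span A S" "y \<in> lin_span A S"
  shows "x \<otimes> y = y \<otimes> x"
proof -
  have *: "x \<otimes> y = y \<otimes> x" if "x \<in> S" for x
    using assms(4)
  proof induction
    case zero
    then show ?case using that S by auto
  next
    case (add_scaled y z a)
    then show ?case using that S lin_span_closed[OF S] comm[OF that]
      by (simp add: mult_add_right mult_add_left scale_mult_right scale_mult_left scale_closed subset_iff)
  qed
  show ?thesis using assms(3)
  proof induction
    case zero
    then show ?case using lin_span_closed[OF S assms(4)] by simp
  next
    case (add_scaled x z a)
    then show ?case using assms(4) S lin_span_closed[OF S] *
      by (simp add: mult_add_right mult_add_left scale_mult_right scale_mult_left scale_closed subset_iff)
  qed
qed

text \<open>Choosing approximants with error below \<open>1 / (n + 1)\<close> trades the epsilon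
  condition for a single sequence, so that the limit laws of \<open>tends\<close> become
  available.\<close>

lemma closed_span_iff:
  assumes S: "S \<subseteq> carrier A"
  shows "x \<in> closed_span A S \<longleftrightarrow> (\<exists>X. (\<forall>n. X n \<in> lin_span A S) \<and> tends X x sequentially)"
proof
  assume x: "x \<in> closed_span A S"
  then have "\<exists>y\<in>lin_span A S. cnorm A (x \<ominus> y) < inverse (real (Suc n))" for n
    unfolding closed_span_def by auto
  then obtain X where X: "\<And>n. X n \<in> lin_span A S" "\<And>n. cnorm A (x \<ominus> X n) < inverse (real (Suc n))"
    by metis
  have "tends X x sequentially"
  proof (rule tendsI[OF _ _ _ LIMSEQ_inverse_real_of_nat])
    show "x \<in> carrier A" using x by (simp add: closed_span_def)
    show "X n \<in> carrier A" for n using lin_span_closed[OF S X(1)] .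
    then show "cnorm A (X n \<ominus> x) \<le> inverse (real (Suc n))" for n
      using X(2)[of n] norm_minus_commute[OF \<open>x \<in> carrier A\<close>, of "X n"] by simp
  qed
  then show "\<exists>X. (\<forall>n. X n \<in> lin_span A S) \<and> tends X x sequentially" using X by blast
next
  assume "\<exists>X. (\<forall>n. X n \<in> lin_span A S) \<and> tends X x sequentially"
  then obtain X where X: "\<And>n. X n \<in> lin_span A S" "tends X x sequentially" by blast
  note d = tendsD[OF X(2)]
  show "x \<in> closed_span A S" unfolding closed_span_def
  proof (intro CollectI conjI allI impI)
    fix \<epsilon> :: real assume "\<epsilon> > 0"
    then have "eventually (\<lambda>n. cnorm A (X n \<ominus> x) < \<epsilon>) sequentially"
      using order_tendstoD(2)[OF d(3)] by simp
    then obtain n where "cnorm A (X n \<ominus> x) < \<epsilon>" by (auto simp: eventually_sequentially)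
    then show "\<exists>y\<in>lin_span A S. cnorm A (x \<ominus> y) < \<epsilon>"
      using X(1)[of n] norm_minus_commute[OF d(2) d(1)[of n]] by (intro bexI[of _ "X n"]) simp_all
  qed (rule d)
qed

lemma closed_span_closed: "x \<in> closed_span A S \<Longrightarrow> x \<in> carrier A"
  by (simp add: closed_span_def)

lemma lin_span_subset: "S \<subseteq> carrier A \<Longrightarrow> x \<in> lin_span A S \<Longrightarrow> x \<in> closed_span A S"
  unfolding closed_span_iff by (intro exI[of _ "\<lambda>n. x"] conjI allI tends_const lin_span_closed)

lemma closed_span_limit:
  assumes S: "S \<subseteq> carrier A" and x: "x \<in> closed_span A S"
  obtains X where "\<And>n. X n \<in> lin_span A S" "tends X x sequentially"
proof -
  obtain X where "(\<forall>n. X n \<in> lin_span A S) \<and> tends X x sequentially"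
    using x unfolding closed_span_iff[OF S] by (rule exE)
  then show thesis by (intro that[of X]) simp_all
qed

lemma closed_spanI:
  "S \<subseteq> carrier A \<Longrightarrow> (\<And>n. X n \<in> lin_span A S) \<Longrightarrow> tends X x sequentially \<Longrightarrow> x \<in> closed_span A S"
  unfolding closed_span_iff by (intro exI[of _ X]) simp

text \<open>All operations are norm continuous, so whatever extends from \<open>S\<close> to its
  linear span passes on to limits of sequences in the span.\<close>

lemma closed_span_op:
  assumes S: "S \<subseteq> carrier A"
  shows "x \<in> closed_span A S \<Longrightarrow> y \<in> closed_span A S \<Longrightarrow> x \<oplus> y \<in> closed_span A S"
    and "x \<in> closed_span A S \<Longrightarrow> a \<odot> x \<in> closed_span A S"
    and "(\<And>x y. x \<in> S \<Longrightarrow> y \<in> S \<Longrightarrow> x \<otimes> y \<in> lin_span A S) \<Longrightarrow>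
      x \<in> closed_span A S \<Longrightarrow> y \<in> closed_span A S \<Longrightarrow> x \<otimes> y \<in> closed_span A S"
    and "(\<And>x. x \<in> S \<Longrightarrow> adj A x \<in> lin_span A S) \<Longrightarrow>
      x \<in> closed_span A S \<Longrightarrow> adj A x \<in> closed_span A S"
    and "(\<And>x y. x \<in> S \<Longrightarrow> y \<in> S \<Longrightarrow> x \<otimes> y = y \<otimes> x) \<Longrightarrow>
      x \<in> closed_span A S \<Longrightarrow> y \<in> closed_span A S \<Longrightarrow> x \<otimes> y = y \<otimes> x"
proof -
  assume "x \<in> closed_span A S"
  then obtain X where X: "\<And>n. X n \<in> lin_span A S" "tends X x sequentially"
    by (rule closed_span_limit[OF S]) (rule that)
  show "a \<odot> x \<in> closed_span A S"
    by (rule closed_spanI[OF S lin_span_scale[OF S X(1)] tends_scale[OF X(2)]])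
  show "adj A x \<in> closed_span A S" if "\<And>x. x \<in> S \<Longrightarrow> adj A x \<in> lin_span A S"
    by (rule closed_spanI[OF S lin_span_adj[OF S that X(1)] tends_adj[OF X(2)]])
  assume "y \<in> closed_span A S"
  then obtain Y where Y: "\<And>n. Y n \<in> lin_span A S" "tends Y y sequentially"
    by (rule closed_span_limit[OF S]) (rule that)
  show "x \<oplus> y \<in> closed_span A S"
    by (rule closed_spanI[OF S lin_span_add[OF S X(1) Y(1)] tends_add[OF X(2) Y(2)]])
  show "x \<otimes> y \<in> closed_span A S" if "\<And>x y. x \<in> S \<Longrightarrow> y \<in> S \<Longrightarrow> x \<otimes> y \<in> lin_span A S"
    by (rule closed_spanI[OF S lin_span_mult[OF S that X(1) Y(1)] tends_mult[OF X(2) Y(2)]])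
  show "x \<otimes> y = y \<otimes> x" if "\<And>x y. x \<in> S \<Longrightarrow> y \<in> S \<Longrightarrow> x \<otimes> y = y \<otimes> x"
    using tends_unique[OF tends_mult[OF X(2) Y(2)]] tends_mult[OF Y(2) X(2)]
      lin_span_commute[OF S that X(1) Y(1)] by simp
qed

text \<open>Homogeneity reduces the bound to vectors of norm at most 1. A subset \<open>B\<close> is
  allowed so that the estimate serves both states on \<open>A\<close> and functionals on the vertex
  algebra, where the supremum runs over a smaller unit ball.\<close>

lemma functional_bound:
  assumes B: "B \<subseteq> carrier A" "\<And>x a. x \<in> B \<Longrightarrow> a \<odot> x \<in> B"
    and \<phi>: "\<And>x a. x \<in> B \<Longrightarrow> \<phi> (a \<odot> x) = a * \<phi> x"
    and bdd: "bdd_above {cmod (\<phi> x) |x. x \<in> B \<and> cnorm A x \<le> 1}" and x: "x \<in> B"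
  shows "cmod (\<phi> x) \<le> Sup {cmod (\<phi> x) |x. x \<in> B \<and> cnorm A x \<le> 1} * cnorm A x"
proof (cases "cnorm A x = 0")
  case True
  then have "x = \<zero>" using x B norm_eq_zero by auto
  then have "\<phi> x = 0" using \<phi>[OF x, of 0] by simp
  then show ?thesis using True by simp
next
  case False
  then have pos: "cnorm A x > 0" using norm_nonneg x B by (metis less_eq_real_def subsetD)
  define y where "y = complex_of_real (inverse (cnorm A x)) \<odot> x"
  have y: "y \<in> B" "cnorm A y \<le> 1" "cmod (\<phi> y) = cmod (\<phi> x) / cnorm A x"
    using x pos B norm_scale[of x] \<phi>[OF x]
    by (auto simp: y_def norm_mult norm_inverse divide_inverse Real_Vector_Spaces.norm_mult)
  have "cmod (\<phi> y) \<le> Sup {cmod (\<phi> x) |x. x \<in> B \<and> cnorm A x \<le> 1}"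
    using y by (intro cSup_upper[OF _ bdd]) blast
  then show ?thesis using pos y(3) by (simp add: field_simps)
qed

lemma state_norm_le:
  assumes "state A \<phi>" "x \<in> carrier A"
  shows "cmod (\<phi> x) \<le> cnorm A x"
  using functional_bound[of "carrier A" \<phi> x] assms unfolding state_def linear_functional_def
  by (simp add: scale_closed)

lemma state_linear:
  assumes "state A \<phi>"
  shows "x \<in> carrier A \<Longrightarrow> y \<in> carrier A \<Longrightarrow> \<phi> (x \<oplus> y) = \<phi> x + \<phi> y"
    "x \<in> carrier A \<Longrightarrow> \<phi> (a \<odot> x) = a * \<phi> x"
    "\<phi> \<zero> = 0"
    "x \<in> carrier A \<Longrightarrow> y \<in> carrier A \<Longrightarrow> \<phi> (x \<ominus> y) = \<phi> x - \<phi> y"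
    "x \<in> carrier A \<Longrightarrow> \<phi> (adj A x \<otimes> x) \<in> \<real>\<^sub>\<ge>\<^sub>0"
proof -
  show 1: "x \<in> carrier A \<Longrightarrow> y \<in> carrier A \<Longrightarrow> \<phi> (x \<oplus> y) = \<phi> x + \<phi> y" for x y
    using assms by (simp add: state_def linear_functional_def)
  show 2: "x \<in> carrier A \<Longrightarrow> \<phi> (a \<odot> x) = a * \<phi> x" for x a
    using assms by (simp add: state_def linear_functional_def)
  show "\<phi> \<zero> = 0" using 2[of \<zero> 0] by simp
  show "x \<in> carrier A \<Longrightarrow> y \<in> carrier A \<Longrightarrow> \<phi> (x \<ominus> y) = \<phi> x - \<phi> y"
    using 1[of x "\<ominus> y"] 2[of y "-1"] by (simp add: a_minus_def scale_minus)
  show "x \<in> carrier A \<Longrightarrow> \<phi> (adj A x \<otimes> x) \<in> \<real>\<^sub>\<ge>\<^sub>0"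
    using assms by (simp add: state_def)
qed

lemma tendsto_functional:
  assumes lin: "\<And>x y. x \<in> carrier A \<Longrightarrow> y \<in> carrier A \<Longrightarrow> \<phi> (x \<ominus> y) = \<phi> x - \<phi> y"
    and bound: "\<And>x. x \<in> carrier A \<Longrightarrow> cmod (\<phi> x) \<le> K * cnorm A x"
    and X: "tends X x F"
  shows "((\<lambda>n. \<phi> (X n)) \<longlongrightarrow> \<phi> x) F"
proof -
  have "((\<lambda>n. K * cnorm A (X n \<ominus> x)) \<longlongrightarrow> 0) F"
    using tendsto_mult_left[OF tendsD(3)[OF X], of K] by simp
  then have "((\<lambda>n. \<phi> (X n) - \<phi> x) \<longlongrightarrow> 0) F"
  proof (rule Lim_null_comparison[rotated], intro always_eventually allI)
    show "cmod (\<phi> (X n) - \<phi> x) \<le> K * cnorm A (X n \<ominus> x)" for n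
      using bound[of "X n \<ominus> x"] lin[of "X n" x] tendsD(1,2)[OF X] by simp
  qed
  then show ?thesis by (subst Lim_null)
qed

lemma state_tendsto: "state A \<phi> \<Longrightarrow> tends X x F \<Longrightarrow> ((\<lambda>n. \<phi> (X n)) \<longlongrightarrow> \<phi> x) F"
  using tendsto_functional[of \<phi> 1 X x F] state_linear(4)[of \<phi>] state_norm_le[of \<phi>] by simp

text \<open>Positivity on \<open>x \<oplus> t \<odot> y\<close> for every complex \<open>t\<close>
  yields a nonnegative quadratic in a real parameter. Hermitian symmetry of the form is itself
  extracted from this positivity.\<close>

lemma state_cauchy_schwarz:
  assumes \<phi>: "state A \<phi>" and x: "x \<in> carrier A" and y: "y \<in> carrier A"
  shows "(cmod (\<phi> (adj A y \<otimes> x)))\<^sup>2 \<le> Re (\<phi> (adj A y \<otimes> y)) * Re (\<phi> (adj A x \<otimes> x))"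
proof -
  define a b where "a = Re (\<phi> (adj A x \<otimes> x))" and "b = Re (\<phi> (adj A y \<otimes> y))"
  define z w where "z = \<phi> (adj A y \<otimes> x)" and "w = \<phi> (adj A x \<otimes> y)"
  have ab: "\<phi> (adj A x \<otimes> x) = complex_of_real a" "a \<ge> 0" "\<phi> (adj A y \<otimes> y) = complex_of_real b" "b \<ge> 0"
    using state_linear(5)[OF \<phi> x] state_linear(5)[OF \<phi> y]
    by (auto simp: a_def b_def complex_nonneg_Reals_iff complex_eq_iff)
  have pos: "complex_of_real a + t * w + cnj t * z + t * cnj t * complex_of_real b \<in> \<real>\<^sub>\<ge>\<^sub>0" for t
  proof -
    have "adj A (x \<oplus> t \<odot> y) \<otimes> (x \<oplus> t \<odot> y) =
      (adj A x \<otimes> x \<oplus> t \<odot> (adj A x \<otimes> y)) \<oplus> (cnj t \<odot> (adj A y \<otimes> x) \<oplus> (cnj t * t) \<odot> (adj A y \<otimes> y))"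
      using x y by (simp add: adj_add adj_scale mult_add_left mult_add_right scale_mult_left
          scale_mult_right scale_closed adj_closed mult_closed scale_add scale_scale a_ac mult.commute)
    then have "\<phi> (adj A (x \<oplus> t \<odot> y) \<otimes> (x \<oplus> t \<odot> y)) =
      complex_of_real a + t * w + cnj t * z + t * cnj t * complex_of_real b"
      using x y by (simp add: state_linear[OF \<phi>] scale_closed adj_closed mult_closed ab z_def w_def)
    then show ?thesis using state_linear(5)[OF \<phi>, of "x \<oplus> t \<odot> y"] x y by (simp add: scale_closed)
  qed
  \<comment> \<open>The expression must be real: \<open>t = 1\<close> relates the imaginary parts of
    \<open>w\<close> and \<open>z\<close>, \<open>t = \<i>\<close> their real parts.\<close>
  have w: "w = cnj z"
    using pos[of 1] pos[of \<i>] by (auto simp: complex_nonneg_Reals_iff complex_eq_iff)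
  have cz: "(cmod z)\<^sup>2 = Re z * Re z + Im z * Im z" by (simp add: cmod_power2 flip: power2_eq_square)
  \<comment> \<open>For \<open>t = - r * z\<close> both cross terms become
    \<open>- r * (cmod z)\<^sup>2\<close>.\<close>
  have quad: "a - 2 * r * (cmod z)\<^sup>2 + r\<^sup>2 * (cmod z)\<^sup>2 * b \<ge> 0" for r :: real
    using pos[of "- complex_of_real r * z"] unfolding w cz
    by (simp add: complex_nonneg_Reals_iff power2_eq_square[of r] algebra_simps)
  have "(cmod z)\<^sup>2 \<le> b * a"
  proof (cases "b = 0")
    case True
    \<comment> \<open>Without a quadratic term the inequality fails for large \<open>r\<close>; this
      \<open>r\<close> would give the value -1 if \<open>z\<close> were nonzero.\<close>
    then have "2 * ((a + 1) / (2 * (cmod z)\<^sup>2)) * (cmod z)\<^sup>2 \<le> a"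
      using quad[of "(a + 1) / (2 * (cmod z)\<^sup>2)"] by simp
    then have "z = 0" by (cases "z = 0") (simp_all add: field_simps)
    then show ?thesis using ab True by simp
  next
    case False
    then have "b > 0" using ab by simp
    \<comment> \<open>\<open>r = inverse b\<close> minimises the quadratic.\<close>
    have "a - 2 * inverse b * (cmod z)\<^sup>2 + (inverse b)\<^sup>2 * (cmod z)\<^sup>2 * b = a - (cmod z)\<^sup>2 / b"
      using False by (simp add: power2_eq_square field_simps)
    then have "a - (cmod z)\<^sup>2 / b \<ge> 0" using quad[of "inverse b"] by (simp only:)
    then show ?thesis using \<open>b > 0\<close> by (simp add: field_simps)
  qed
  then show ?thesis by (simp add: z_def a_def b_def)
qed

lemma projection_norm_le:
  assumes "projection A p"
  shows "cnorm A p \<le> 1"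
proof -
  have p: "p \<in> carrier A" "adj A p = p" "p \<otimes> p = p" using assms by (auto simp: projection_def)
  have "(cnorm A p)\<^sup>2 = cnorm A p" using cstar_identity[OF p(1)] p by simp
  then show ?thesis by (cases "cnorm A p = 0") (auto simp: power2_eq_square)
qed

end

section \<open>Words in a graph C*-algebra\<close>

text \<open>\<open>A\<close> is a parameter tied to \<open>graph_cstar E\<close> by an equation, so
  that the structure declaration gives short infix notation for its operations.\<close>

locale graph_algebra = cstar_algebra A for A :: "(nat \<Rightarrow> ('v + 'e) free) set cstar" (structure) +
  fixes E :: "('v, 'e) graph"
  assumes A_eq: "A = graph_cstar E"
begin

abbreviation p :: "'v \<Rightarrow> (nat \<Rightarrow> ('v + 'e) free) set" where "p \<equiv> vertex_proj E"

abbreviation s :: "'e \<Rightarrow> (nat \<Rightarrow> ('v + 'e) free) set" where "s \<equiv> edge_isom E"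

abbreviation s' :: "'e \<Rightarrow> (nat \<Rightarrow> ('v + 'e) free) set" where "s' e \<equiv> adj A (s e)"

abbreviation U :: "('v + 'e) free \<Rightarrow> real" where "U \<equiv> universal_seminorm (graph_relations E)"

text \<open>With the generators of \<open>A\<close> as values, \<open>ev\<close> is the canonical
  map from the free algebra to \<open>A\<close>.\<close>

sublocale evaluation A "universal_gen (graph_relations E)"
  by unfold_locales (simp add: A_eq graph_cstar_def graph.gen_closed)

lemma val_simps: "val (Inl v, False) = p v" "val (Inl v, True) = adj A (p v)"
  "val (Inr e, False) = s e" "val (Inr e, True) = s' e"
  by (simp_all add: val_def vertex_proj_def edge_isom_def)

lemma family: "graph_family E A p s"
  unfolding A_eq by (rule graph_family_graph)

lemmas family_relations = family[unfolded graph_family_def projection_def]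

lemma p_simps [simp]: "p v \<in> carrier A" "adj A (p v) = p v" "p v \<otimes> p v = p v"
  using family_relations[THEN conjunct1] by blast+

lemma p_orthogonal [simp]: "v \<noteq> w \<Longrightarrow> p v \<otimes> p w = \<zero>"
  using family_relations[THEN conjunct2, THEN conjunct1] by blast

lemma s_isometry: "s e \<in> carrier A" "s e \<otimes> s' e \<otimes> s e = s e"
  using family_relations[THEN conjunct2, THEN conjunct2, THEN conjunct1] by blast+

lemma s_closed [simp]: "s e \<in> carrier A" "s' e \<in> carrier A"
  by (simp_all add: s_isometry adj_closed)

lemma s_relations:
  "e \<noteq> f \<Longrightarrow> (s e \<otimes> s' e) \<otimes> (s f \<otimes> s' f) = \<zero>"
  "s' e \<otimes> s e = p (src E e)"
  "p (rng E e) \<otimes> (s e \<otimes> s' e) = s e \<otimes> s' e"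
  "\<not> singular_vertex E v \<Longrightarrow> p v = (\<Oplus>e\<in>{e. rng E e = v}. s e \<otimes> s' e)"
  using family_relations[THEN conjunct2, THEN conjunct2, THEN conjunct2] by blast+

lemma p_s: "p v \<otimes> s e = (if v = rng E e then s e else \<zero>)"
proof -
  have *: "p (rng E e) \<otimes> s e = s e"
    using s_isometry(2)[of e] s_relations(3)[of e] by (metis mult_assoc mult_closed p_simps(1) s_closed)
  have "p v \<otimes> s e = (p v \<otimes> p (rng E e)) \<otimes> s e" by (simp add: mult_assoc *)
  then show ?thesis using * by simp
qed

lemma s_p: "s e \<otimes> p v = (if v = src E e then s e else \<zero>)"
proof -
  have *: "s e \<otimes> p (src E e) = s e"
    using s_isometry(2)[of e] s_relations(2)[of e] by (simp add: mult_assoc)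
  have "s e \<otimes> p v = s e \<otimes> (p (src E e) \<otimes> p v)" by (simp add: mult_assoc[symmetric] *)
  then show ?thesis using * by simp
qed

lemma p_s': "p v \<otimes> s' e = (if v = src E e then s' e else \<zero>)"
  using arg_cong[OF s_p[of e v], of "adj A"] by (auto simp: adj_mult split: if_splits)

lemma s'_p: "s' e \<otimes> p v = (if v = rng E e then s' e else \<zero>)"
  using arg_cong[OF p_s[of v e], of "adj A"] by (auto simp: adj_mult split: if_splits)

text \<open>For distinct edges, inserting the partial isometry identity and its adjoint brings out
  the product of the two range projections, which vanishes.\<close>

lemma s'_s: "s' e \<otimes> s f = (if e = f then p (src E e) else \<zero>)"
proof (cases "e = f")
  case False
  have "s' e = s' e \<otimes> (s e \<otimes> s' e)"
    using arg_cong[OF s_isometry(2)[of e], of "adj A"] by (simp add: adj_mult mult_closed adj_adj mult_assoc)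
  moreover have "s f = (s f \<otimes> s' f) \<otimes> s f" by (simp add: s_isometry)
  ultimately have "s' e \<otimes> s f = (s' e \<otimes> (s e \<otimes> s' e)) \<otimes> ((s f \<otimes> s' f) \<otimes> s f)" by (rule arg_cong2)
  also have "\<dots> = s' e \<otimes> (((s e \<otimes> s' e) \<otimes> (s f \<otimes> s' f)) \<otimes> s f)" by (simp add: mult_assoc mult_closed)
  finally show ?thesis using False by (simp add: s_relations(1))
qed (simp add: s_relations(2))

text \<open>The possible values of words in the generators, up to the relations (\<open>wval_reduced\<close>).\<close>

inductive_set reduced :: "(nat \<Rightarrow> ('v + 'e) free) set set" where
  zero: "\<zero> \<in> reduced"
| vertex: "p v \<in> reduced"
| left: "w \<in> reduced \<Longrightarrow> s e \<otimes> w \<in> reduced"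
| right: "w \<in> reduced \<Longrightarrow> w \<otimes> s' e \<in> reduced"

lemma reduced_closed [simp]: "w \<in> reduced \<Longrightarrow> w \<in> carrier A"
  by (induction rule: reduced.induct) (auto simp: mult_closed)

lemma reduced_p: "w \<in> reduced \<Longrightarrow> p v \<otimes> w \<in> reduced"
proof (induction rule: reduced.induct)
  case (vertex w)
  then show ?case by (cases "v = w") (auto intro: reduced.intros)
next
  case (left w e)
  have "p v \<otimes> (s e \<otimes> w) = (p v \<otimes> s e) \<otimes> w" using left by (simp add: mult_assoc)
  then show ?case using left by (auto simp: p_s intro: reduced.intros)
next
  case (right w e)
  have "p v \<otimes> (w \<otimes> s' e) = (p v \<otimes> w) \<otimes> s' e" using right by (simp add: mult_assoc)
  then show ?case using right by (auto intro: reduced.intros)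
qed (auto intro: reduced.intros)

text \<open>Induction along the formation of \<open>w\<close>: \<open>s' e\<close> leaves a right
  factor untouched, and against a leading \<open>s f\<close> it produces zero or a vertex
  projection, which \<open>reduced_p\<close> absorbs.\<close>

lemma reduced_s': "w \<in> reduced \<Longrightarrow> s' e \<otimes> w \<in> reduced"
proof (induction rule: reduced.induct)
  case (vertex v)
  have "s' e = p (src E e) \<otimes> s' e" by (simp add: p_s')
  then have "s' e \<in> reduced" using reduced.right[OF reduced.vertex] by metis
  then show ?case by (auto simp: s'_p intro: reduced.intros)
next
  case (left w f)
  have "s' e \<otimes> (s f \<otimes> w) = (s' e \<otimes> s f) \<otimes> w" using left by (simp add: mult_assoc)
  then show ?case using left by (auto simp: s'_s intro: reduced.intros reduced_p)
next
  case (right w f)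
  have "s' e \<otimes> (w \<otimes> s' f) = (s' e \<otimes> w) \<otimes> s' f" using right by (simp add: mult_assoc)
  then show ?case using right by (auto intro: reduced.intros)
qed (auto intro: reduced.intros)

lemma reduced_val: "w \<in> reduced \<Longrightarrow> val l \<otimes> w \<in> reduced"
proof -
  assume w: "w \<in> reduced"
  obtain g b where l: "l = (g, b)" by (cases l)
  show ?thesis unfolding l
    using w by (cases g; cases b) (auto simp: val_simps reduced_p reduced_s' reduced.left)
qed

lemma wval_reduced: "wval ls \<in> reduced"
proof (induction ls)
  case Nil
  then show ?case by (simp add: reduced.zero)
next
  case (Cons l ls)
  show ?case
  proof (cases "ls = []")
    \<comment> \<open>A one-letter word needs its own case because \<open>wval []\<close> is
      \<open>\<zero>\<close> and not a unit; an edge letter is brought to reduced form by its source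
      projection.\<close>
    case True
    obtain g b where l: "l = (g, b)" by (cases l)
    have "s e = s e \<otimes> p (src E e)" "s' e = p (src E e) \<otimes> s' e" for e by (simp_all add: s_p p_s')
    then have "s e \<in> reduced" "s' e \<in> reduced" for e
      using reduced.left[OF reduced.vertex] reduced.right[OF reduced.vertex] by metis+
    then show ?thesis using True unfolding l
      by (cases g; cases b) (auto simp: val_simps reduced.vertex)
  next
    case False
    then show ?thesis using Cons by (simp add: wval_Cons reduced_val)
  qed
qed

section \<open>The dense image of the free algebra\<close>

lemma ev_eq: "x \<in> free_algebra \<Longrightarrow> ev x = graph.U.cls E (\<lambda>n. x)"
  using graph.ev_gen_eq[of x E] by (simp add: A_eq graph_cstar_def)

text \<open>\<open>ev x\<close> is the class of a constant sequence, along which the limit defining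
  the norm is the seminorm itself.\<close>

lemma norm_ev: "x \<in> free_algebra \<Longrightarrow> cnorm A (ev x) = U x"
  using graph.U.norm_completion[of "\<lambda>n. x" E] graph.U.cs_const[of x E]
  by (simp add: ev_eq) (simp add: A_eq graph_cstar_def universal_cstar_def)

text \<open>An element is the class of a Cauchy sequence, and the terms of that sequence, embedded
  as constant sequences, converge to it.\<close>

lemma ev_dense:
  assumes "b \<in> carrier A"
  obtains X where "\<And>n. X n \<in> free_algebra" "tends (\<lambda>n. ev (X n)) b sequentially"
proof -
  obtain X where X: "X \<in> cauchy_seqs U" "b = graph.U.cls E X"
    using assms graph.U.carrier_completion[of E] by (auto simp: A_eq graph_cstar_def universal_cstar_def)
  have free: "X n \<in> free_algebra" for n using graph.U.csD(1)[OF X(1)] .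
  have "tends (\<lambda>n. graph.U.cls E (\<lambda>k. X n)) b sequentially"
    using graph.cls_const_tends[OF X(1)] unfolding X(2) A_eq graph_cstar_def .
  then have "tends (\<lambda>n. ev (X n)) b sequentially" using free by (simp add: ev_eq)
  then show thesis using that[of X] free by simp
qed

text \<open>By density, a property stable under norm limits need only be checked on values of free
  elements. This carries identities, inequalities and positivity over to all of
  \<open>A\<close>.\<close>

lemma closed_induct:
  assumes b: "b \<in> carrier A"
    and free: "\<And>x. x \<in> free_algebra \<Longrightarrow> P (ev x)"
    and limit: "\<And>X x. (\<And>n. P (X n)) \<Longrightarrow> tends X x sequentially \<Longrightarrow> P x"
  shows "P b"
proof -
  obtain X where X: "\<And>n. X n \<in> free_algebra" "tends (\<lambda>n. ev (X n)) b sequentially"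
    using b by (rule ev_dense) (rule that)
  show ?thesis by (rule limit[OF _ X(2)]) (rule free[OF X(1)])
qed

text \<open>Reduced elements include the values of all words, whose linear combinations are dense,
  and states are continuous.\<close>

lemma state_eqI:
  assumes \<phi>: "state A \<phi>" and \<psi>: "state A \<psi>"
    and eq: "\<And>w. w \<in> reduced \<Longrightarrow> \<phi> w = \<psi> w"
  shows "\<phi> = \<psi>"
proof (rule extensionalityI)
  show "\<phi> \<in> extensional (carrier A)" "\<psi> \<in> extensional (carrier A)"
    using \<phi> \<psi> by (simp_all add: state_def linear_functional_def)
  have free: "\<phi> (ev x) = \<psi> (ev x)" if "x \<in> free_algebra" for x
    using that
  proof (induction x rule: free_algebra_induct_single)
    case zero
    then show ?case by (simp add: state_linear[OF \<phi>] state_linear[OF \<psi>])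
  next
    case (single_add w a x)
    then show ?case
      by (simp add: ev_add ev_single state_linear[OF \<phi>] state_linear[OF \<psi>] eq[OF wval_reduced])
  qed
  fix b assume b: "b \<in> carrier A"
  show "\<phi> b = \<psi> b" using b
  proof (rule closed_induct)
    fix X x assume X: "\<And>n. \<phi> (X n) = \<psi> (X n)" "tends X x sequentially"
    show "\<phi> x = \<psi> x"
      using LIMSEQ_unique[OF state_tendsto[OF \<phi> X(2)]] state_tendsto[OF \<psi> X(2)] X(1) by simp
  qed (rule free)
qed

section \<open>Finite sums of vertex projections\<close>

definition psum :: "'v set \<Rightarrow> (nat \<Rightarrow> ('v + 'e) free) set" where
  "psum F = (\<Oplus>v\<in>F. p v)"

lemma psum_insert: "finite F \<Longrightarrow> v \<notin> F \<Longrightarrow> psum (insert v F) = p v \<oplus> psum F"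
  unfolding psum_def by (rule finsum_insert) auto

lemma psum_empty [simp]: "psum {} = \<zero>"
  by (simp add: psum_def)

lemma psum_closed [simp]: "psum F \<in> carrier A"
  unfolding psum_def by (rule finsum_closed) auto

lemma p_range: "range p \<subseteq> carrier A"
  by auto

lemma psum_span: "finite F \<Longrightarrow> psum F \<in> lin_span A (range p)"
proof (induction rule: finite_induct)
  case (insert v F)
  then show ?case
    using lin_span_add[OF p_range lin_span_base[OF p_range, of "p v"]] by (auto simp: psum_insert)
qed (simp add: lin_span.zero)

lemma psum_p: "finite F \<Longrightarrow> psum F \<otimes> p v = (if v \<in> F then p v else \<zero>)"
proof (induction rule: finite_induct)
  case (insert w F)
  have "psum (insert w F) \<otimes> p v = p w \<otimes> p v \<oplus> psum F \<otimes> p v"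
    using insert by (simp add: psum_insert mult_add_left)
  then show ?case using insert by (cases "w = v") (auto simp: mult_closed)
qed auto

lemma psum_projection: "finite F \<Longrightarrow> projection A (psum F)"
proof (induction rule: finite_induct)
  case (insert v F)
  have a: "adj A (psum F) = psum F" "psum F \<otimes> psum F = psum F" using insert by (auto simp: projection_def)
  have "psum F \<otimes> p v = \<zero>" using insert by (simp add: psum_p)
  moreover have "p v \<otimes> psum F = adj A (psum F \<otimes> p v)" using a by (simp add: adj_mult)
  ultimately show ?case using a insert
    by (simp add: projection_def psum_insert adj_add mult_add_left mult_add_right mult_closed)
qed (auto simp: projection_def)

text \<open>Only finitely many vertices occur as left supports of the words of \<open>x\<close>.
  Quantifying over all finite supersets \<open>G\<close> lets the sets for two summands be merged by
  union.\<close>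

lemma psum_unit:
  assumes "x \<in> free_algebra"
  shows "\<exists>F. finite F \<and> (\<forall>G. finite G \<longrightarrow> F \<subseteq> G \<longrightarrow> psum G \<otimes> ev x = ev x)"
  using assms
proof (induction x rule: free_algebra_induct)
  case (gen g)
  have *: "psum G \<otimes> s e = s e" if "finite G" "rng E e \<in> G" for G e
  proof -
    have "psum G \<otimes> s e = (psum G \<otimes> p (rng E e)) \<otimes> s e" by (simp add: mult_assoc p_s)
    then show ?thesis using that by (simp add: psum_p p_s)
  qed
  show ?case
  proof (cases g)
    case (Inl v)
    then show ?thesis
      by (intro exI[of _ "{v}"]) (auto simp: psum_p simp flip: vertex_proj_def)
  next
    case (Inr e)
    then show ?thesis using *
      by (intro exI[of _ "{rng E e}"]) (auto simp flip: edge_isom_def)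
  qed
next
  case (adj_gen g)
  have *: "psum G \<otimes> s' e = s' e" if "finite G" "src E e \<in> G" for G e
  proof -
    have "psum G \<otimes> s' e = (psum G \<otimes> p (src E e)) \<otimes> s' e" by (simp add: mult_assoc p_s')
    then show ?thesis using that by (simp add: psum_p p_s')
  qed
  show ?case
  proof (cases g)
    case (Inl v)
    then show ?thesis
      by (intro exI[of _ "{v}"]) (auto simp: psum_p ev_adj simp flip: vertex_proj_def)
  next
    case (Inr e)
    then show ?thesis using *
      by (intro exI[of _ "{src E e}"]) (auto simp: ev_adj simp flip: edge_isom_def)
  qed
next
  \<comment> \<open>Left multiplication only meets the first factor, so its set \<open>F\<close>
    serves for the product.\<close>
  case (mult x y)
  then obtain F where F: "finite F" "\<And>G. finite G \<Longrightarrow> F \<subseteq> G \<Longrightarrow> psum G \<otimes> ev x = ev x" by metis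
  have "psum G \<otimes> ev (x * y) = (psum G \<otimes> ev x) \<otimes> ev y" for G
    using mult by (simp add: ev_mult mult_assoc)
  then show ?case using F mult by (intro exI[of _ F]) (simp add: ev_mult)
next
  case (add x y)
  then obtain F G where F: "finite F" "\<And>H. finite H \<Longrightarrow> F \<subseteq> H \<Longrightarrow> psum H \<otimes> ev x = ev x"
    and G: "finite G" "\<And>H. finite H \<Longrightarrow> G \<subseteq> H \<Longrightarrow> psum H \<otimes> ev y = ev y" by metis
  then show ?case by (intro exI[of _ "F \<union> G"]) (auto simp: ev_add mult_add_right)
qed (auto simp: ev_scale scale_mult_right)

end

section \<open>Restricting ground states to the vertex algebra\<close>

context cstar_algebra
begin

lemma scale_diff: "x \<in> carrier A \<Longrightarrow> a \<odot> x \<ominus> b \<odot> x = (a - b) \<odot> x"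
proof -
  assume x: "x \<in> carrier A"
  have "a \<odot> x = (a - b) \<odot> x \<oplus> b \<odot> x" using add_scale[OF x, of "a - b" b] by simp
  then show ?thesis using x by (simp add: a_minus_def a_assoc r_neg scale_closed)
qed

text \<open>The orbit of an eigenvector of the flow stays on one line, so differentiability of the
  extension is that of a scalar exponential.\<close>

lemma entire_extension_scale:
  assumes x: "x \<in> carrier A" and \<sigma>: "\<And>t. \<sigma> t x = exp (k * complex_of_real t) \<odot> x"
  shows "entire_extension A \<sigma> x (\<lambda>z. exp (k * z) \<odot> x)"
  unfolding entire_extension_def entire_into_def
proof (intro conjI allI bexI)
  fix z :: complex
  let ?d = "k * exp (k * z)"
  show "?d \<odot> x \<in> carrier A" "exp (k * z) \<odot> x \<in> carrier A" using x by (auto simp: scale_closed)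
  have "((\<lambda>w. exp (k * w)) has_field_derivative ?d) (at z)"
    by (auto intro!: derivative_eq_intros)
  then have "((\<lambda>w. (exp (k * w) - exp (k * z)) / (w - z)) \<longlongrightarrow> ?d) (at z)"
    by (simp add: has_field_derivative_iff)
  then have "((\<lambda>w. (exp (k * w) - exp (k * z)) / (w - z) - ?d) \<longlongrightarrow> 0) (at z)"
    by (subst (asm) Lim_null)
  then have "((\<lambda>w. cmod ((exp (k * w) - exp (k * z)) / (w - z) - ?d) * cnorm A x) \<longlongrightarrow> 0) (at z)"
    by (intro tendsto_mult_left_zero tendsto_norm_zero)
  moreover have "cnorm A (inverse (w - z) \<odot> (exp (k * w) \<odot> x \<ominus> exp (k * z) \<odot> x) \<ominus> ?d \<odot> x) =
      cmod ((exp (k * w) - exp (k * z)) / (w - z) - ?d) * cnorm A x" for w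
    using x by (simp add: scale_diff scale_scale norm_scale divide_inverse mult.commute)
  ultimately show "((\<lambda>w. cnorm A (inverse (w - z) \<odot> (exp (k * w) \<odot> x \<ominus> exp (k * z) \<odot> x) \<ominus> ?d \<odot> x)) \<longlongrightarrow> 0) (at z)"
    by simp
qed (simp add: \<sigma>)

text \<open>At \<open>\<i> * y\<close> the eigenvector is multiplied by \<open>exp (l * y)\<close>;
  this growth is incompatible with the ground state bound unless the value is zero.\<close>

lemma ground_state_eigen:
  assumes \<phi>: "ground_state A \<sigma> \<phi>" and a: "a \<in> analytic_elements A \<sigma>" and x: "x \<in> carrier A"
    and \<sigma>: "\<And>t. \<sigma> t x = exp (- \<i> * complex_of_real (l * t)) \<odot> x" and l: "l > 0"
  shows "\<phi> (a \<otimes> x) = 0"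
proof (rule ccontr)
  let ?F = "\<lambda>z. exp (- \<i> * complex_of_real l * z) \<odot> x"
  assume nz: "\<phi> (a \<otimes> x) \<noteq> 0"
  have st: "state A \<phi>" using \<phi> by (simp add: ground_state_def)
  have a_carrier: "a \<in> carrier A" using a by (simp add: analytic_elements_def)
  have F: "entire_extension A \<sigma> x ?F"
    by (rule entire_extension_scale[OF x]) (simp add: \<sigma> mult.assoc)
  then have "x \<in> analytic_elements A \<sigma>" using x by (auto simp: analytic_elements_def)
  then obtain K where K: "\<And>z. Im z \<ge> 0 \<Longrightarrow> cmod (\<phi> (a \<otimes> ?F z)) \<le> K"
    using \<phi> a F unfolding ground_state_def by meson
  have eq: "cmod (\<phi> (a \<otimes> ?F (\<i> * complex_of_real y))) = exp (l * y) * cmod (\<phi> (a \<otimes> x))" for y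
    using a_carrier x by (simp add: scale_mult_right state_linear[OF st] mult_closed Real_Vector_Spaces.norm_mult)
  \<comment> \<open>For this \<open>y\<close> the product
    \<open>l * y * cmod (\<phi> (a \<otimes> x))\<close> is \<open>\<bar>K\<bar>\<close>, so the
    lower bound \<open>1 + l * y\<close> of the exponential already passes \<open>K\<close>.\<close>
  define y where "y = \<bar>K\<bar> / (l * cmod (\<phi> (a \<otimes> x)))"
  have y: "y \<ge> 0" using l by (simp add: y_def)
  have "K < (1 + l * y) * cmod (\<phi> (a \<otimes> x))"
  proof -
    have "\<bar>K\<bar> = l * y * cmod (\<phi> (a \<otimes> x))" using l nz by (simp add: y_def)
    moreover have "cmod (\<phi> (a \<otimes> x)) > 0" using nz by simp
    ultimately show ?thesis unfolding distrib_right by linarith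
  qed
  also have "\<dots> \<le> exp (l * y) * cmod (\<phi> (a \<otimes> x))"
    by (intro mult_right_mono exp_ge_add_one_self) auto
  also have "\<dots> \<le> K" using K[of "\<i> * complex_of_real y"] y unfolding eq by simp
  finally show False by simp
qed

end

context graph_algebra
begin

lemma action_s: "graph_action E c \<sigma> \<Longrightarrow> c e > 0 \<Longrightarrow>
    \<sigma> t (s e) = exp (\<i> * complex_of_real (ln (c e) * t)) \<odot> s e"
  by (simp add: graph_action_def A_eq powr_def Ln_of_real mult_ac)

lemma action_hom:
  assumes "graph_action E c \<sigma>"
  shows "star_hom A A (\<sigma> t)" "x \<in> carrier A \<Longrightarrow> cnorm A (\<sigma> t x) = cnorm A x"
  using assms by (auto simp: graph_action_def one_parameter_group_def star_automorphism_def A_eq)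

lemma action_s':
  assumes "graph_action E c \<sigma>" "c e > 0"
  shows "\<sigma> t (s' e) = exp (- \<i> * complex_of_real (ln (c e) * t)) \<odot> s' e"
proof -
  have "\<sigma> t (s' e) = adj A (\<sigma> t (s e))"
    using action_hom(1)[OF assms(1), of t] by (simp add: star_hom_def)
  then show ?thesis by (simp add: action_s[OF assms] adj_scale exp_cnj)
qed

lemma ground_state_edge:
  assumes c: "\<And>e. c e > 1" and act: "graph_action E c \<sigma>" and \<phi>: "ground_state A \<sigma> \<phi>"
  shows "x \<in> carrier A \<Longrightarrow> \<phi> (x \<otimes> s' e) = 0" "x \<in> carrier A \<Longrightarrow> \<phi> (s e \<otimes> x) = 0"
    "\<phi> (s e \<otimes> s' e) = 0"
proof -
  have st: "state A \<phi>" using \<phi> by (simp add: ground_state_def)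
  have c0: "c e > 0" using c[of e] by simp
  have "entire_extension A \<sigma> (s e) (\<lambda>z. exp (\<i> * complex_of_real (ln (c e)) * z) \<odot> s e)"
    by (rule entire_extension_scale) (simp_all add: action_s[OF act c0] mult.assoc)
  then have "s e \<in> analytic_elements A \<sigma>" by (auto simp: analytic_elements_def)
  \<comment> \<open>The other two claims rest on this one: \<open>s e\<close> is the analytic left
    factor, and \<open>s' e\<close> is the eigenvector with rate
    \<open>ln (c e) > 0\<close>.\<close>
  then show 0: "\<phi> (s e \<otimes> s' e) = 0"
    by (rule ground_state_eigen[OF \<phi> _ _ action_s'[OF act c0]]) (simp_all add: ln_gt_zero[OF c])
  \<comment> \<open>In both Cauchy-Schwarz estimates one factor of the bound is
    \<open>\<phi> (s e \<otimes> s' e)\<close>, which is zero.\<close>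
  show "\<phi> (x \<otimes> s' e) = 0" if "x \<in> carrier A"
    using state_cauchy_schwarz[OF st, of "s' e" "adj A x"] 0 that by (simp add: adj_closed adj_adj)
  show "\<phi> (s e \<otimes> x) = 0" if "x \<in> carrier A"
    using state_cauchy_schwarz[OF st, of x "s' e"] 0 that by (simp add: adj_closed adj_adj)
qed

lemma ground_state_unique:
  assumes c: "\<And>e. c e > 1" and act: "graph_action E c \<sigma>"
    and \<phi>: "ground_state A \<sigma> \<phi>" and \<psi>: "ground_state A \<sigma> \<psi>" and eq: "\<And>v. \<phi> (p v) = \<psi> (p v)"
  shows "\<phi> = \<psi>"
proof (rule state_eqI)
  show \<phi>s: "state A \<phi>" and \<psi>s: "state A \<psi>" using \<phi> \<psi> by (simp_all add: ground_state_def)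
  \<comment> \<open>The last rule in the formation of \<open>w\<close> decides, without induction: a
    leading \<open>s e\<close> or a trailing \<open>s' e\<close> makes both states vanish.\<close>
  show "\<phi> w = \<psi> w" if "w \<in> reduced" for w
    using that
    by cases (simp_all add: eq state_linear(3)[OF \<phi>s] state_linear(3)[OF \<psi>s]
        ground_state_edge[OF c act \<phi>] ground_state_edge[OF c act \<psi>])
qed

section \<open>The vertex algebra and restrictions of states\<close>

abbreviation V :: "(nat \<Rightarrow> ('v + 'e) free) set set" where "V \<equiv> closed_span A (range p)"

lemma vertex_algebra_ops:
  "carrier (vertex_algebra E) = V"
  "x \<oplus>\<^bsub>vertex_algebra E\<^esub> y = x \<oplus> y"
  "x \<otimes>\<^bsub>vertex_algebra E\<^esub> y = x \<otimes> y"
  "a \<odot>\<^bsub>vertex_algebra E\<^esub> x = a \<odot> x"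
  "adj (vertex_algebra E) x = adj A x"
  "cnorm (vertex_algebra E) x = cnorm A x"
  by (simp_all add: vertex_algebra_def A_eq)

lemma V_closed: "x \<in> V \<Longrightarrow> x \<in> carrier A"
  by (rule closed_span_closed)

lemma V_subset: "V \<subseteq> carrier A"
  using V_closed by blast

text \<open>By orthogonality a product of two vertex projections is such a projection or zero, in
  either order. Commutativity is what makes restricted states tracial.\<close>

lemma V_op: "x \<in> V \<Longrightarrow> y \<in> V \<Longrightarrow> x \<oplus> y \<in> V" "x \<in> V \<Longrightarrow> a \<odot> x \<in> V"
    "x \<in> V \<Longrightarrow> y \<in> V \<Longrightarrow> x \<otimes> y \<in> V" "x \<in> V \<Longrightarrow> adj A x \<in> V"
    "x \<in> V \<Longrightarrow> y \<in> V \<Longrightarrow> x \<otimes> y = y \<otimes> x"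
proof -
  show "x \<in> V \<Longrightarrow> y \<in> V \<Longrightarrow> x \<oplus> y \<in> V" by (rule closed_span_op(1)[OF p_range])
  show "x \<in> V \<Longrightarrow> a \<odot> x \<in> V" by (rule closed_span_op(2)[OF p_range])
  have base: "p v \<in> lin_span A (range p)" for v
    by (rule lin_span_base[OF p_range]) simp
  have "p v \<otimes> p w \<in> lin_span A (range p)" for v w
    using base by (cases "v = w") (simp_all add: lin_span.zero)
  then have "x \<otimes> y \<in> lin_span A (range p)" if "x \<in> range p" "y \<in> range p" for x y
    using that by (elim rangeE) simp
  then show "x \<in> V \<Longrightarrow> y \<in> V \<Longrightarrow> x \<otimes> y \<in> V"
    by (rule closed_span_op(3)[OF p_range])
  show "x \<in> V \<Longrightarrow> adj A x \<in> V"
    by (rule closed_span_op(4)[OF p_range]) (use base in \<open>elim rangeE, simp\<close>)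
  have "p v \<otimes> p w = p w \<otimes> p v" for v w by (cases "v = w") simp_all
  then have "x \<otimes> y = y \<otimes> x" if "x \<in> range p" "y \<in> range p" for x y
    using that by (elim rangeE) simp
  then show "x \<in> V \<Longrightarrow> y \<in> V \<Longrightarrow> x \<otimes> y = y \<otimes> x"
    by (rule closed_span_op(5)[OF p_range])
qed

lemma p_in_V: "p v \<in> V"
  by (rule lin_span_subset[OF p_range lin_span_base[OF p_range]]) simp

lemma psum_in_V: "finite F \<Longrightarrow> psum F \<in> V"
  by (rule lin_span_subset[OF p_range psum_span])

lemma psum_norm_le: "finite F \<Longrightarrow> cnorm A (psum F) \<le> 1"
  by (rule projection_norm_le[OF psum_projection])

text \<open>The sums of vertex projections form an approximate unit, so they detect the norm of a state.\<close>

lemma norm_le_restriction: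
  assumes \<phi>: "state A \<phi>" and S: "\<And>F. finite F \<Longrightarrow> cmod (\<phi> (psum F)) \<le> S" and x: "x \<in> carrier A"
  shows "(cmod (\<phi> x))\<^sup>2 \<le> S * (cnorm A x)\<^sup>2"
proof (rule closed_induct[OF x, of "\<lambda>x. (cmod (\<phi> x))\<^sup>2 \<le> S * (cnorm A x)\<^sup>2"])
  fix y :: "('v + 'e) free" assume y: "y \<in> free_algebra"
  obtain F where F0: "finite F \<and> (\<forall>G. finite G \<longrightarrow> F \<subseteq> G \<longrightarrow> psum G \<otimes> ev y = ev y)"
    using psum_unit[OF y] by (rule exE)
  then have F: "finite F" "psum F \<otimes> ev y = ev y" by simp_all
  have pr: "adj A (psum F) = psum F" "psum F \<otimes> psum F = psum F"
    using psum_projection[OF F(1)] by (simp_all add: projection_def)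
  \<comment> \<open>Cauchy-Schwarz with \<open>psum F\<close> in the role of a unit: it is a
    projection and fixes \<open>ev y\<close> from the left.\<close>
  have "(cmod (\<phi> (ev y)))\<^sup>2 \<le> Re (\<phi> (psum F)) * Re (\<phi> (adj A (ev y) \<otimes> ev y))"
    using state_cauchy_schwarz[OF \<phi>, of "ev y" "psum F"] by (simp add: pr F)
  also have "\<dots> \<le> S * (cnorm A (ev y))\<^sup>2"
  proof (rule mult_mono)
    show "Re (\<phi> (psum F)) \<le> S" using S[OF F(1)] complex_Re_le_cmod order_trans by blast
    show "0 \<le> S" using S[OF F(1)] norm_ge_zero order_trans by blast
    have "cmod (\<phi> (adj A (ev y) \<otimes> ev y)) \<le> (cnorm A (ev y))\<^sup>2"
      using state_norm_le[OF \<phi>, of "adj A (ev y) \<otimes> ev y"] by (simp add: cstar_identity mult_closed adj_closed)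
    then show "Re (\<phi> (adj A (ev y) \<otimes> ev y)) \<le> (cnorm A (ev y))\<^sup>2"
      using complex_Re_le_cmod order_trans by blast
    show "0 \<le> Re (\<phi> (adj A (ev y) \<otimes> ev y))"
      using state_linear(5)[OF \<phi>, of "ev y"] by (simp add: complex_nonneg_Reals_iff)
  qed
  finally show "(cmod (\<phi> (ev y)))\<^sup>2 \<le> S * (cnorm A (ev y))\<^sup>2" .
next
  fix X x assume X: "\<And>n. (cmod (\<phi> (X n)))\<^sup>2 \<le> S * (cnorm A (X n))\<^sup>2" "tends X x sequentially"
  show "(cmod (\<phi> x))\<^sup>2 \<le> S * (cnorm A x)\<^sup>2"
    by (rule LIMSEQ_le[OF tendsto_power[OF tendsto_norm[OF state_tendsto[OF \<phi> X(2)]]]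
          tendsto_mult_left[OF tendsto_power[OF tends_norm[OF X(2)]]]]) (use X(1) in auto)
qed

text \<open>Let \<open>S\<close> be the supremum over \<open>V\<close>. It bounds the values on all
  \<open>psum F\<close>, so \<open>norm_le_restriction\<close> applies with it and gives
  \<open>1 \<le> sqrt S\<close>, while contractivity of the state gives
  \<open>S \<le> 1\<close>.\<close>

lemma Sup_restriction:
  assumes \<phi>: "state A \<phi>"
  shows "bdd_above {cmod (\<phi> x) |x. x \<in> V \<and> cnorm A x \<le> 1}"
    "Sup {cmod (\<phi> x) |x. x \<in> V \<and> cnorm A x \<le> 1} = 1"
proof -
  let ?B = "{cmod (\<phi> x) |x. x \<in> V \<and> cnorm A x \<le> 1}"
  let ?S = "Sup ?B"
  have le1: "r \<le> 1" if "r \<in> ?B" for r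
    using that by (elim CollectE exE conjE) (simp add: order_trans[OF state_norm_le[OF \<phi> V_closed]])
  then show bdd: "bdd_above ?B" by (rule bdd_aboveI)
  have mem: "cmod (\<phi> (psum F)) \<in> ?B" if "finite F" for F
    by (intro CollectI exI[of _ "psum F"] conjI refl psum_in_V psum_norm_le that)
  have S: "cmod (\<phi> (psum F)) \<le> ?S" if "finite F" for F
    by (rule cSup_upper[OF mem[OF that] bdd])
  have S0: "?S \<ge> 0" using S[of "{}"] by (simp add: state_linear[OF \<phi>])
  have "?B \<noteq> {}" using mem[of "{}"] by (metis empty_iff finite.emptyI)
  then have S1: "?S \<le> 1" by (rule cSup_least) (rule le1)
  have "1 = Sup {cmod (\<phi> x) |x. x \<in> carrier A \<and> cnorm A x \<le> 1}"
    using \<phi> by (simp add: state_def)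
  also have "\<dots> \<le> sqrt ?S"
  proof (rule cSup_least)
    show "{cmod (\<phi> x) |x. x \<in> carrier A \<and> cnorm A x \<le> 1} \<noteq> {}"
    proof -
      have "cmod (\<phi> \<zero>) \<in> {cmod (\<phi> x) |x. x \<in> carrier A \<and> cnorm A x \<le> 1}"
        by (intro CollectI exI[of _ \<zero>]) simp
      then show ?thesis by (metis empty_iff)
    qed
    fix r assume "r \<in> {cmod (\<phi> x) |x. x \<in> carrier A \<and> cnorm A x \<le> 1}"
    then obtain x where x: "r = cmod (\<phi> x)" "x \<in> carrier A" "cnorm A x \<le> 1" by blast
    have "(cnorm A x)\<^sup>2 \<le> 1" using x norm_nonneg[of x] by (simp add: power_le_one)
    then have "?S * (cnorm A x)\<^sup>2 \<le> ?S * 1" using S0 by (intro mult_left_mono)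
    then have "r\<^sup>2 \<le> ?S" using norm_le_restriction[OF \<phi> S x(2)] x(1) by simp
    then show "r \<le> sqrt ?S" by (rule real_le_rsqrt)
  qed
  finally have "1 \<le> ?S" by simp
  with S1 show "?S = 1" by (rule antisym)
qed

text \<open>Norm one is kept by \<open>Sup_restriction\<close>, and the trace identity holds because
  \<open>V\<close> is commutative. At a regular vertex relation (3) writes \<open>p v\<close> as a
  finite sum of range projections, on each of which \<open>\<phi>\<close> vanishes.\<close>

lemma ground_state_restrict:
  assumes c: "\<And>e. c e > 1" and act: "graph_action E c \<sigma>" and \<phi>: "ground_state A \<sigma> \<phi>"
  shows "tracial_state (vertex_algebra E) (restrict \<phi> V)"
    "vertex_support E (restrict \<phi> V) \<subseteq> {v. singular_vertex E v}"
proof -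
  have st: "state A \<phi>" using \<phi> by (simp add: ground_state_def)
  have eq: "{cmod (restrict \<phi> V x) |x. x \<in> V \<and> cnorm A x \<le> 1} = {cmod (\<phi> x) |x. x \<in> V \<and> cnorm A x \<le> 1}"
    by (rule Collect_cong) (auto intro!: ex_cong)
  show "tracial_state (vertex_algebra E) (restrict \<phi> V)"
    unfolding tracial_state_def state_def linear_functional_def vertex_algebra_ops
  proof (intro conjI ballI allI)
    fix x y assume x: "x \<in> V" and y: "y \<in> V"
    show "restrict \<phi> V (x \<oplus> y) = restrict \<phi> V x + restrict \<phi> V y"
      using x y by (simp add: V_op state_linear(1)[OF st] V_closed)
    show "restrict \<phi> V (x \<otimes> y) = restrict \<phi> V (y \<otimes> x)"
      using V_op(5)[OF x y] by simp
  next
    fix x and a :: complex assume x: "x \<in> V"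
    show "restrict \<phi> V (a \<odot> x) = a * restrict \<phi> V x"
      using x by (simp add: V_op state_linear(2)[OF st] V_closed)
  next
    fix x assume x: "x \<in> V"
    show "restrict \<phi> V (adj A x \<otimes> x) \<in> \<real>\<^sub>\<ge>\<^sub>0"
      using x by (simp add: V_op(3,4) state_linear(5)[OF st] V_closed)
  qed ((unfold eq)?, (rule restrict_extensional Sup_restriction[OF st])+)
  have "\<phi> (p v) = 0" if "\<not> singular_vertex E v" for v
  proof -
    have fin: "\<phi> (\<Oplus>e\<in>F. s e \<otimes> s' e) = 0" if "finite F" for F
      using that
    proof (induction rule: finite_induct)
      case (insert e F)
      have "(\<Oplus>e\<in>insert e F. s e \<otimes> s' e) = (s e \<otimes> s' e) \<oplus> (\<Oplus>e\<in>F. s e \<otimes> s' e)"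
        using insert by (intro finsum_insert) (auto simp: mult_closed)
      then show ?case using insert
        by (simp add: state_linear[OF st] mult_closed finsum_closed ground_state_edge(3)[OF c act \<phi>])
    qed (simp add: state_linear[OF st])
    have "finite {e. rng E e = v}" using that by (simp add: singular_vertex_def)
    then show ?thesis by (subst s_relations(4)[OF that]) (rule fin)
  qed
  then show "vertex_support E (restrict \<phi> V) \<subseteq> {v. singular_vertex E v}"
    by (auto simp: vertex_support_def p_in_V)
qed

end

section \<open>Finitely supported functions as an inner product space\<close>

text \<open>For complex values the inner product is the real part of the Hermitian one, and the norm
  is the square-summable norm. Operators on this space, without completion, already define
  C*-seminorms on the free algebra.\<close>

instantiation poly_mapping :: (type, real_inner) real_inner
begin

definition scaleR_poly_mapping :: "real \<Rightarrow> ('a \<Rightarrow>\<^sub>0 'b) \<Rightarrow> ('a \<Rightarrow>\<^sub>0 'b)" where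
  "scaleR_poly_mapping r = Poly_Mapping.map (scaleR r)"

definition inner_poly_mapping :: "('a \<Rightarrow>\<^sub>0 'b) \<Rightarrow> ('a \<Rightarrow>\<^sub>0 'b) \<Rightarrow> real" where
  "inner_poly_mapping f g = (\<Sum>i\<in>Poly_Mapping.keys f. inner (Poly_Mapping.lookup f i) (Poly_Mapping.lookup g i))"

definition norm_poly_mapping :: "('a \<Rightarrow>\<^sub>0 'b) \<Rightarrow> real" where
  "norm_poly_mapping f = sqrt (inner f f)"

definition sgn_poly_mapping :: "('a \<Rightarrow>\<^sub>0 'b) \<Rightarrow> ('a \<Rightarrow>\<^sub>0 'b)" where
  "sgn_poly_mapping f = inverse (norm f) *\<^sub>R f"

definition dist_poly_mapping :: "('a \<Rightarrow>\<^sub>0 'b) \<Rightarrow> ('a \<Rightarrow>\<^sub>0 'b) \<Rightarrow> real" where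
  "dist_poly_mapping f g = norm (f - g)"

definition uniformity_poly_mapping :: "(('a \<Rightarrow>\<^sub>0 'b) \<times> ('a \<Rightarrow>\<^sub>0 'b)) filter" where
  "uniformity_poly_mapping = (INF e\<in>{0<..}. principal {(x, y). dist x y < e})"

definition open_poly_mapping :: "('a \<Rightarrow>\<^sub>0 'b) set \<Rightarrow> bool" where
  "open_poly_mapping U \<longleftrightarrow> (\<forall>x\<in>U. \<forall>\<^sub>F (x', y) in uniformity. x' = x \<longrightarrow> y \<in> U)"

lemma lookup_scaleR_aux: "Poly_Mapping.lookup (r *\<^sub>R f) i = r *\<^sub>R Poly_Mapping.lookup f i"
  for f :: "'a \<Rightarrow>\<^sub>0 'b"
  by (simp add: scaleR_poly_mapping_def Poly_Mapping.map.rep_eq when_def)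

lemma inner_superset_aux:
  fixes f g :: "'a \<Rightarrow>\<^sub>0 'b"
  assumes "finite K" "Poly_Mapping.keys f \<subseteq> K"
  shows "inner f g = (\<Sum>i\<in>K. inner (Poly_Mapping.lookup f i) (Poly_Mapping.lookup g i))"
  unfolding inner_poly_mapping_def using assms
  by (intro sum.mono_neutral_left) (auto simp: in_keys_iff)

instance
proof
  fix f g h :: "'a \<Rightarrow>\<^sub>0 'b" and r q :: real
  show "r *\<^sub>R (f + g) = r *\<^sub>R f + r *\<^sub>R g" "(r + q) *\<^sub>R f = r *\<^sub>R f + q *\<^sub>R f"
    "r *\<^sub>R q *\<^sub>R f = (r * q) *\<^sub>R f" "1 *\<^sub>R f = f"
    by (intro poly_mapping_eqI; simp add: lookup_scaleR_aux lookup_add scaleR_add_right scaleR_add_left)+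
  let ?K = "Poly_Mapping.keys f \<union> Poly_Mapping.keys g"
  have K: "finite ?K" "Poly_Mapping.keys f \<subseteq> ?K" "Poly_Mapping.keys g \<subseteq> ?K"
    "Poly_Mapping.keys (f + g) \<subseteq> ?K"
    using Poly_Mapping.keys_add[of f g] by auto
  show "inner f g = inner g f"
    using inner_superset_aux[OF K(1,2), of g] inner_superset_aux[OF K(1,3), of f] by (simp add: inner_commute)
  show "inner (f + g) h = inner f h + inner g h"
    using inner_superset_aux[OF K(1,2), of h] inner_superset_aux[OF K(1,3), of h]
      inner_superset_aux[OF K(1,4), of h] by (simp add: lookup_add inner_add_left sum.distrib)
  have "Poly_Mapping.keys (r *\<^sub>R f) \<subseteq> Poly_Mapping.keys f"
    by (auto simp: in_keys_iff lookup_scaleR_aux)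
  then show "inner (r *\<^sub>R f) g = r * inner f g"
    using inner_superset_aux[of "Poly_Mapping.keys f" "r *\<^sub>R f" g]
    by (simp add: lookup_scaleR_aux inner_poly_mapping_def sum_distrib_left)
  show "0 \<le> inner f f" by (simp add: inner_poly_mapping_def sum_nonneg)
  have "inner f f = 0 \<longleftrightarrow> (\<forall>i\<in>Poly_Mapping.keys f. inner (Poly_Mapping.lookup f i) (Poly_Mapping.lookup f i) = 0)"
    unfolding inner_poly_mapping_def by (rule sum_nonneg_eq_0_iff) simp_all
  also have "\<dots> \<longleftrightarrow> Poly_Mapping.keys f = {}"
    by (auto simp: in_keys_iff intro: poly_mapping_eqI)
  finally show "inner f f = 0 \<longleftrightarrow> f = 0" by simp
qed (simp_all add: norm_poly_mapping_def sgn_poly_mapping_def dist_poly_mapping_def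
    uniformity_poly_mapping_def open_poly_mapping_def)

end

lemma lookup_scaleR [simp]: "Poly_Mapping.lookup (r *\<^sub>R f) i = r *\<^sub>R Poly_Mapping.lookup f i"
  for f :: "'a \<Rightarrow>\<^sub>0 'b :: real_inner"
  by (rule lookup_scaleR_aux)

lemma inner_poly_mapping_superset:
  fixes f g :: "'a \<Rightarrow>\<^sub>0 'b :: real_inner"
  assumes "finite K" "Poly_Mapping.keys f \<subseteq> K"
  shows "inner f g = (\<Sum>i\<in>K. inner (Poly_Mapping.lookup f i) (Poly_Mapping.lookup g i))"
  by (rule inner_superset_aux[OF assms])

lemma inner_single_single:
  fixes a b :: "'b :: real_inner"
  shows "inner (Poly_Mapping.single i a) (Poly_Mapping.single j b) = (if i = j then inner a b else 0)"
  using inner_poly_mapping_superset[of "{i}" "Poly_Mapping.single i a"]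
  by (simp add: lookup_single when_def)

lemma norm_single [simp]: "norm (Poly_Mapping.single i a) = norm a"
  for a :: "'b :: real_inner"
  by (simp add: norm_eq_sqrt_inner inner_single_single)

lemma norm_poly_mapping_superset:
  fixes f :: "'a \<Rightarrow>\<^sub>0 'b :: real_inner"
  assumes "finite K" "Poly_Mapping.keys f \<subseteq> K"
  shows "(norm f)\<^sup>2 = (\<Sum>i\<in>K. (norm (Poly_Mapping.lookup f i))\<^sup>2)"
  using inner_poly_mapping_superset[OF assms, of f] by (simp add: power2_norm_eq_inner)

lemma bessel_poly_mapping:
  fixes f :: "'a \<Rightarrow>\<^sub>0 'b :: real_inner"
  assumes "finite M"
  shows "(\<Sum>i\<in>M. (norm (Poly_Mapping.lookup f i))\<^sup>2) \<le> (norm f)\<^sup>2"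
  using norm_poly_mapping_superset[of "M \<union> Poly_Mapping.keys f" f] assms
  by (simp add: sum_mono2)

text \<open>Single terms generate additively. The rule serves twice: for operator identities checked
  on basis vectors, and for identities in a free element checked on words.\<close>

lemma additive_poly_mapping_eqI:
  fixes T T' :: "('a \<Rightarrow>\<^sub>0 'b :: comm_monoid_add) \<Rightarrow> 'c :: comm_monoid_add"
  assumes "T 0 = T' 0" "\<And>f g. T (f + g) = T f + T g" "\<And>f g. T' (f + g) = T' f + T' g"
    and "\<And>i a. T (Poly_Mapping.single i a) = T' (Poly_Mapping.single i a)"
  shows "T f = T' f"
  by (induction f rule: poly_mapping_induct) (simp_all add: assms)

text \<open>The additive extension of prescribed values on single terms. Whenever
  \<open>h i 0 = 0\<close>, enlarging the index set changes nothing.\<close>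

definition extend :: "('a \<Rightarrow> 'b \<Rightarrow> 'c) \<Rightarrow> ('a \<Rightarrow>\<^sub>0 'b :: comm_monoid_add) \<Rightarrow> 'c :: comm_monoid_add" where
  "extend h f = (\<Sum>i\<in>Poly_Mapping.keys f. h i (Poly_Mapping.lookup f i))"

lemma extend_zero [simp]: "extend h 0 = 0"
  by (simp add: extend_def)

lemma extend_single: "(\<And>i. h i 0 = 0) \<Longrightarrow> extend h (Poly_Mapping.single i a) = h i a"
  by (cases "a = 0") (simp_all add: extend_def)

lemma extend_superset:
  assumes "\<And>i. h i 0 = 0" "finite K" "Poly_Mapping.keys f \<subseteq> K"
  shows "extend h f = (\<Sum>i\<in>K. h i (Poly_Mapping.lookup f i))"
  unfolding extend_def using assms by (intro sum.mono_neutral_left) (auto simp: in_keys_iff)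

lemma extend_add:
  assumes "\<And>i. h i 0 = 0" "\<And>i a b. h i (a + b) = h i a + h i b"
  shows "extend h (f + g) = extend h f + extend h g"
proof -
  let ?K = "Poly_Mapping.keys f \<union> Poly_Mapping.keys g"
  have "Poly_Mapping.keys (f + g) \<subseteq> ?K" by (rule Poly_Mapping.keys_add)
  then show ?thesis
    by (simp add: extend_superset[where K = ?K] assms lookup_add sum.distrib)
qed

text \<open>The inner product space structure is over the reals, so complex scalars act through this
  separate operation.\<close>

definition cscale :: "complex \<Rightarrow> ('a \<Rightarrow>\<^sub>0 complex) \<Rightarrow> ('a \<Rightarrow>\<^sub>0 complex)" where
  "cscale a f = Poly_Mapping.map ((*) a) f"

lemma lookup_cscale [simp]: "Poly_Mapping.lookup (cscale a f) i = a * Poly_Mapping.lookup f i"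
  by (simp add: cscale_def Poly_Mapping.map.rep_eq when_def)

lemma cscale_simps:
  "cscale a (f + g) = cscale a f + cscale a g" "cscale (a + b) f = cscale a f + cscale b f"
  "cscale a (cscale b f) = cscale (a * b) f" "cscale 0 f = 0" "cscale a 0 = 0" "cscale 1 f = f"
  "cscale a (Poly_Mapping.single i b) = Poly_Mapping.single i (a * b)"
  "cscale (complex_of_real r) f = r *\<^sub>R f"
  by (intro poly_mapping_eqI; simp add: lookup_add lookup_single when_def algebra_simps scaleR_conv_of_real)+

lemma inner_cscale: "inner (cscale a f) g = inner f (cscale (cnj a) g)"
proof -
  have "Poly_Mapping.keys (cscale a f) \<subseteq> Poly_Mapping.keys f" by (auto simp: in_keys_iff)
  then show ?thesis
    by (simp add: inner_poly_mapping_superset[of "Poly_Mapping.keys f" "cscale a f" g]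
        inner_poly_mapping_superset[of "Poly_Mapping.keys f" f] inner_complex_def algebra_simps)
qed

lemma norm_cscale [simp]: "norm (cscale a f) = cmod a * norm f"
proof -
  have "inner (cscale a f) (cscale a f) = (cmod a)\<^sup>2 * inner f f"
  proof -
    have "cscale (cnj a) (cscale a f) = (cmod a)\<^sup>2 *\<^sub>R f"
      by (intro poly_mapping_eqI)
         (simp add: scaleR_conv_of_real complex_norm_square mult_ac del: of_real_power)
    then show ?thesis by (simp add: inner_cscale)
  qed
  then show ?thesis by (simp add: norm_eq_sqrt_inner real_sqrt_mult)
qed

section \<open>Operators induced by partial injections\<close>

text \<open>Basis vectors are moved along a partial map, with \<open>None\<close> standing for 0. If
  the map has an inverse in the sense of \<open>inverse_maps\<close>, this is a partial
  isometry.\<close>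

definition push :: "('a \<Rightarrow> 'a option) \<Rightarrow> ('a \<Rightarrow>\<^sub>0 complex) \<Rightarrow> ('a \<Rightarrow>\<^sub>0 complex)" where
  "push k = extend (\<lambda>i a. case k i of None \<Rightarrow> 0 | Some j \<Rightarrow> Poly_Mapping.single j a)"

lemma push_single: "push k (Poly_Mapping.single i a) = (case k i of None \<Rightarrow> 0 | Some j \<Rightarrow> Poly_Mapping.single j a)"
  unfolding push_def by (rule extend_single) (auto split: option.split)

lemma push_add: "push k (f + g) = push k f + push k g"
  unfolding push_def by (rule extend_add) (auto split: option.split simp: single_add)

lemma push_zero [simp]: "push k 0 = 0"
  by (simp add: push_def)

lemma push_cscale: "push k (cscale a f) = cscale a (push k f)"
  by (rule additive_poly_mapping_eqI[where f = f])
     (auto simp: push_add cscale_simps push_single split: option.split)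

lemma push_comp: "push (k \<circ>\<^sub>m l) f = push k (push l f)"
  by (rule additive_poly_mapping_eqI[where f = f])
     (auto simp: push_add push_single map_comp_def split: option.split)

lemma push_Some [simp]: "push Some f = f"
  by (rule additive_poly_mapping_eqI[where f = f]) (auto simp: push_add push_single)

definition inverse_maps :: "('a \<Rightarrow> 'a option) \<Rightarrow> ('a \<Rightarrow> 'a option) \<Rightarrow> bool" where
  "inverse_maps k l \<longleftrightarrow> (\<forall>i j. k i = Some j \<longleftrightarrow> l j = Some i)"

text \<open>On basis vectors both sides are \<open>inner a b\<close> if \<open>k\<close> takes
  \<open>i\<close> to \<open>j\<close>, which is the same as \<open>l\<close> taking
  \<open>j\<close> to \<open>i\<close>, and zero otherwise.\<close>

lemma inner_push:
  assumes "inverse_maps k l"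
  shows "inner (push k f) g = inner f (push l g)"
proof (induction f rule: poly_mapping_induct)
  case (single_add i a f)
  have "inner (push k (Poly_Mapping.single i a)) g = inner (Poly_Mapping.single i a) (push l g)"
  proof (induction g rule: poly_mapping_induct)
    case (single_add j b g)
    have "inner (push k (Poly_Mapping.single i a)) (Poly_Mapping.single j b) =
        inner (Poly_Mapping.single i a) (push l (Poly_Mapping.single j b))"
      using assms[unfolded inverse_maps_def, rule_format, of i j]
      by (cases "k i"; cases "l j") (auto simp: push_single inner_single_single)
    then show ?case using single_add by (simp add: inner_add_right push_add)
  qed simp
  then show ?case using single_add by (simp add: inner_add_left push_add)
qed simp

lemma lookup_push:
  assumes "inverse_maps k l"
  shows "Poly_Mapping.lookup (push k f) j = (case l j of None \<Rightarrow> 0 | Some i \<Rightarrow> Poly_Mapping.lookup f i)"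
proof (induction f rule: poly_mapping_induct)
  case (single_add i a f)
  then show ?case using assms[unfolded inverse_maps_def, rule_format, of i j]
    by (cases "k i"; cases "l j") (auto simp: push_add push_single lookup_add lookup_single when_def)
qed (auto split: option.split)

text \<open>The nonzero coefficients of \<open>push k f\<close> are coefficients of
  \<open>f\<close>, and none is used twice because \<open>l\<close> is injective where it is
  defined.\<close>

lemma norm_push_le:
  assumes inv: "inverse_maps k l"
  shows "norm (push k f) \<le> norm f"
proof -
  let ?J = "Poly_Mapping.keys (push k f)"
  let ?g = "\<lambda>j. the (l j)"
  have J: "\<exists>i. l j = Some i \<and> Poly_Mapping.lookup (push k f) j = Poly_Mapping.lookup f i \<and> Poly_Mapping.lookup f i \<noteq> 0"
    if "j \<in> ?J" for j
    using that by (auto simp: in_keys_iff lookup_push[OF inv] split: option.splits)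
  have inj: "inj_on ?g ?J"
  proof (rule inj_onI)
    fix j j' assume "j \<in> ?J" "j' \<in> ?J" "?g j = ?g j'"
    then obtain i where "l j = Some i" "l j' = Some i" using J by fastforce
    then have "k i = Some j" "k i = Some j'" using inv by (simp_all add: inverse_maps_def)
    then show "j = j'" by simp
  qed
  have "(norm (push k f))\<^sup>2 = (\<Sum>j\<in>?J. (norm (Poly_Mapping.lookup f (?g j)))\<^sup>2)"
  proof -
    have "Poly_Mapping.lookup (push k f) j = Poly_Mapping.lookup f (?g j)" if "j \<in> ?J" for j
      using J[OF that] by auto
    then show ?thesis by (simp add: norm_poly_mapping_superset[of ?J])
  qed
  also have "\<dots> = (\<Sum>i\<in>?g ` ?J. (norm (Poly_Mapping.lookup f i))\<^sup>2)"
    by (simp add: sum.reindex[OF inj])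
  also have "\<dots> \<le> (norm f)\<^sup>2" by (rule bessel_poly_mapping) simp
  finally show ?thesis by simp
qed

lemma bounded_linear_push: "inverse_maps k l \<Longrightarrow> bounded_linear (push k)"
  by (rule bounded_linear_intro[where K = 1])
     (simp_all add: push_add norm_push_le push_cscale flip: cscale_simps(8))

lemma bounded_linear_cscale: "bounded_linear (cscale a)"
  by (rule bounded_linear_intro[where K = "cmod a"])
     (simp_all add: cscale_simps(1,3) mult.commute flip: cscale_simps(8))

section \<open>Representations of the free algebra by partial injections\<close>

text \<open>The linearisation \<open>rep\<close> of such an action is a star-representation of the
  free algebra: concatenation becomes composition, and the adjoint word acts by the inverse partial
  injection.\<close>

locale word_action =
  fixes k :: "'g word \<Rightarrow> 'i \<Rightarrow> 'i option"
  assumes k_zero: "k 0 = Some" and k_add: "k (u + w) = k u \<circ>\<^sub>m k w"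
    and k_adj: "inverse_maps (k w) (k (word_adj w))"
begin

definition rep :: "'g free \<Rightarrow> ('i \<Rightarrow>\<^sub>0 complex) \<Rightarrow> ('i \<Rightarrow>\<^sub>0 complex)" where
  "rep x f = extend (\<lambda>w a. cscale a (push (k w) f)) x"

lemma rep_simps:
  "rep 0 f = 0" "rep (x + y) f = rep x f + rep y f"
  "rep (Poly_Mapping.single w a) f = cscale a (push (k w) f)"
  unfolding rep_def by (auto simp: extend_add extend_single cscale_simps)

lemma rep_linear: "rep x (f + g) = rep x f + rep x g" "rep x (cscale a f) = cscale a (rep x f)" "rep x 0 = 0"
  by (induction x rule: poly_mapping_induct)
     (simp_all add: rep_simps push_add push_cscale cscale_simps mult.commute)

lemma rep_scale: "rep (free_scale a x) f = cscale a (rep x f)"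
proof (rule additive_poly_mapping_eqI[where f = x])
  show "rep (free_scale a (Poly_Mapping.single i b)) f = cscale a (rep (Poly_Mapping.single i b) f)" for i b
    by (simp add: free_scale_eq mult_single rep_simps cscale_simps)
qed (simp_all add: rep_simps free_scale_simps cscale_simps, simp add: free_scale_eq rep_simps)

lemma rep_diff: "rep (x - y) f = rep x f - rep y f"
  using rep_simps(2)[of "x - y" y f] by simp

lemma rep_mult: "rep (x * y) f = rep x (rep y f)"
proof (rule additive_poly_mapping_eqI[where f = x])
  fix w a
  show "rep (Poly_Mapping.single w a * y) f = rep (Poly_Mapping.single w a) (rep y f)"
    by (rule additive_poly_mapping_eqI[where f = y])
       (simp_all add: rep_simps distrib_left push_add cscale_simps mult_single k_add push_comp push_cscale)
qed (simp_all add: rep_simps distrib_right)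

lemma rep_adjoint: "inner (rep x f) g = inner f (rep (free_adj x) g)"
proof (rule additive_poly_mapping_eqI[where f = x])
  show "inner (rep (Poly_Mapping.single w a) f) g = inner f (rep (free_adj (Poly_Mapping.single w a)) g)" for w a
    by (simp add: rep_simps inner_cscale inner_push[OF k_adj] push_cscale)
qed (simp_all add: rep_simps inner_add_left inner_add_right)

lemma bounded_linear_rep: "bounded_linear (rep x)"
proof (induction x rule: poly_mapping_induct)
  case zero
  have "rep 0 = (\<lambda>f. 0)" by (simp add: fun_eq_iff rep_simps)
  then show ?case by (simp add: bounded_linear_zero)
next
  case (single_add w a x)
  have "bounded_linear (\<lambda>f. cscale a (push (k w) f) + rep x f)"
    using single_add bounded_linear_compose[OF bounded_linear_cscale bounded_linear_push[OF k_adj]]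
    by (intro bounded_linear_add)
  moreover have "rep (Poly_Mapping.single w a + x) = (\<lambda>f. cscale a (push (k w) f) + rep x f)"
    by (simp add: fun_eq_iff rep_simps)
  ultimately show ?case by simp
qed

definition rep_norm :: "'g free \<Rightarrow> real" where
  "rep_norm x = onorm (rep x)"

lemma norm_rep_le: "norm (rep x f) \<le> rep_norm x * norm f"
  unfolding rep_norm_def by (rule onorm[OF bounded_linear_rep])

lemma rep_norm_least: "0 \<le> K \<Longrightarrow> (\<And>f. norm (rep x f) \<le> K * norm f) \<Longrightarrow> rep_norm x \<le> K"
  unfolding rep_norm_def by (rule onorm_bound)

lemma rep_norm_nonneg: "0 \<le> rep_norm x"
  unfolding rep_norm_def by (rule onorm_pos_le[OF bounded_linear_rep])

lemma rep_norm_mult: "rep_norm (x * y) \<le> rep_norm x * rep_norm y"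
proof (rule rep_norm_least)
  show "norm (rep (x * y) f) \<le> rep_norm x * rep_norm y * norm f" for f
    using order_trans[OF norm_rep_le[of x "rep y f"] mult_left_mono[OF norm_rep_le[of y f] rep_norm_nonneg[of x]]]
    by (simp add: rep_mult mult.assoc)
qed (simp add: rep_norm_nonneg)

lemma rep_norm_scale_le: "rep_norm (free_scale a x) \<le> cmod a * rep_norm x"
proof (rule rep_norm_least)
  show "norm (rep (free_scale a x) f) \<le> cmod a * rep_norm x * norm f" for f
    using mult_left_mono[OF norm_rep_le[of x f], of "cmod a"] by (simp add: rep_scale mult.assoc)
qed (simp add: rep_norm_nonneg)

text \<open>Moving \<open>rep x\<close> across the inner product turns the square of
  \<open>norm (rep x f)\<close> into a pairing of \<open>f\<close> with
  \<open>rep (free_adj x * x) f\<close>, to which Cauchy-Schwarz applies.\<close>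

lemma rep_norm_square_le: "(rep_norm x)\<^sup>2 \<le> rep_norm (free_adj x * x)"
proof -
  let ?K = "rep_norm (free_adj x * x)"
  have "rep_norm x \<le> sqrt ?K"
  proof (rule rep_norm_least)
    fix f
    have "(norm (rep x f))\<^sup>2 = inner f (rep (free_adj x * x) f)"
      by (simp add: power2_norm_eq_inner rep_adjoint rep_mult)
    also have "\<dots> \<le> norm f * norm (rep (free_adj x * x) f)" by (rule norm_cauchy_schwarz)
    also have "\<dots> \<le> norm f * (?K * norm f)" by (intro mult_left_mono norm_rep_le) simp
    finally have "(norm (rep x f))\<^sup>2 \<le> (sqrt ?K * norm f)\<^sup>2"
      by (simp add: power_mult_distrib rep_norm_nonneg power2_eq_square mult_ac)
    then show "norm (rep x f) \<le> sqrt ?K * norm f"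
      by (rule power2_le_imp_le) (simp add: rep_norm_nonneg)
  qed (simp add: rep_norm_nonneg)
  then have "(rep_norm x)\<^sup>2 \<le> (sqrt ?K)\<^sup>2" by (intro power_mono rep_norm_nonneg)
  then show ?thesis by (simp add: rep_norm_nonneg)
qed

lemma cstar_seminorm_rep: "cstar_seminorm rep_norm"
  unfolding cstar_seminorm_def
proof (intro conjI ballI allI)
  fix x y :: "'g free" and a
  show "0 \<le> rep_norm x" by (rule rep_norm_nonneg)
  show "rep_norm (x * y) \<le> rep_norm x * rep_norm y" by (rule rep_norm_mult)
  show "rep_norm (x + y) \<le> rep_norm x + rep_norm y"
  proof (rule rep_norm_least)
    show "norm (rep (x + y) f) \<le> (rep_norm x + rep_norm y) * norm f" for f
      using norm_triangle_ineq[of "rep x f" "rep y f"] norm_rep_le[of x f] norm_rep_le[of y f]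
      unfolding rep_simps distrib_right by linarith
  qed (simp add: rep_norm_nonneg)
  show "rep_norm (free_scale a x) = cmod a * rep_norm x"
  proof (cases "a = 0")
    case True
    then show ?thesis using rep_norm_scale_le[of a x] rep_norm_nonneg[of "free_scale a x"] by simp
  next
    case False
    \<comment> \<open>The reverse inequality is the one-sided estimate for the scalar
      \<open>inverse a\<close>.\<close>
    then have "rep_norm x \<le> cmod (inverse a) * rep_norm (free_scale a x)"
      using rep_norm_scale_le[of "inverse a" "free_scale a x"] by (simp add: free_scale_simps)
    then have "cmod a * rep_norm x \<le> rep_norm (free_scale a x)"
      using False by (simp add: norm_divide field_simps)
    then show ?thesis using rep_norm_scale_le[of a x] by simp
  qed
  \<comment> \<open>This follows from \<open>rep_norm_square_le\<close> and submultiplicativity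
    after division by \<open>rep_norm z\<close>; applied to \<open>x\<close> and to its adjoint it
    makes the involution isometric.\<close>
  have le: "rep_norm z \<le> rep_norm (free_adj z)" for z
  proof (cases "rep_norm z = 0")
    case False
    then have "rep_norm z > 0" using rep_norm_nonneg[of z] by simp
    then show ?thesis using order_trans[OF rep_norm_square_le[of z] rep_norm_mult[of "free_adj z" z]]
      by (simp add: power2_eq_square)
  qed (simp add: rep_norm_nonneg)
  have "rep_norm (free_adj x) = rep_norm x" using le[of x] le[of "free_adj x"] by simp
  then show "rep_norm (free_adj x * x) = (rep_norm x)\<^sup>2"
    using rep_norm_mult[of "free_adj x" x] rep_norm_square_le[of x] by (simp add: power2_eq_square)
qed

end

section \<open>The path representation\<close>

text \<open>
  The pair \<open>(\<mu>, v)\<close> stands for a path \<open>\<mu>\<close> with source \<open>v\<close>.  Restricting to singular \<open>v\<close> is what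
  makes relation (3) hold: at a regular vertex \<open>w\<close> there is then no path of length zero.
\<close>

fun path_range :: "('v, 'e) graph \<Rightarrow> 'e list \<times> 'v \<Rightarrow> 'v" where
  "path_range E ([], v) = v"
| "path_range E (e # \<mu>, v) = rng E e"

fun valid :: "('v, 'e) graph \<Rightarrow> 'e list \<times> 'v \<Rightarrow> bool" where
  "valid E ([], v) = singular_vertex E v"
| "valid E (e # \<mu>, v) = (src E e = path_range E (\<mu>, v) \<and> valid E (\<mu>, v))"

text \<open>The head of the list is the edge at the range end, so \<open>s e\<close> prepends and
  its adjoint removes the head. Testing validity in the clauses keeps the maps of a letter and of
  its adjoint mutually inverse, and sends invalid pairs to \<open>None\<close>.\<close>

fun letter_map :: "('v, 'e) graph \<Rightarrow> ('v + 'e) \<times> bool \<Rightarrow> 'e list \<times> 'v \<Rightarrow> ('e list \<times> 'v) option" where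
  "letter_map E (Inl w, b) i = (if valid E i \<and> path_range E i = w then Some i else None)"
| "letter_map E (Inr e, False) (\<mu>, v) = (if valid E (e # \<mu>, v) then Some (e # \<mu>, v) else None)"
| "letter_map E (Inr e, True) ([], v) = None"
| "letter_map E (Inr e, True) (f # \<mu>, v) = (if f = e \<and> valid E (f # \<mu>, v) then Some (\<mu>, v) else None)"

fun path_map :: "('v, 'e) graph \<Rightarrow> (('v + 'e) \<times> bool) list \<Rightarrow> 'e list \<times> 'v \<Rightarrow> ('e list \<times> 'v) option" where
  "path_map E [] = Some"
| "path_map E (l # ls) = letter_map E l \<circ>\<^sub>m path_map E ls"

lemma map_comp_Some [simp]: "k \<circ>\<^sub>m Some = k" "Some \<circ>\<^sub>m k = k"
  by (auto simp: map_comp_def fun_eq_iff split: option.split)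

lemma map_comp_assoc: "(k \<circ>\<^sub>m l) \<circ>\<^sub>m m = k \<circ>\<^sub>m (l \<circ>\<^sub>m m)"
  by (auto simp: map_comp_def fun_eq_iff split: option.split)

lemma path_map_append: "path_map E (xs @ ys) = path_map E xs \<circ>\<^sub>m path_map E ys"
  by (induction xs) (simp_all add: map_comp_assoc)

lemma inverse_letter_map: "inverse_maps (letter_map E (g, b)) (letter_map E (g, \<not> b))"
proof -
  have "letter_map E (Inr e, False) (\<mu>, v) = Some (\<nu>, u) \<longleftrightarrow> letter_map E (Inr e, True) (\<nu>, u) = Some (\<mu>, v)"
    for e \<mu> v \<nu> u
    by (cases \<nu>) auto
  then show ?thesis unfolding inverse_maps_def by (cases g; cases b) auto
qed

lemma inverse_maps_comp:
  assumes "inverse_maps k l" "inverse_maps k' l'"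
  shows "inverse_maps (k \<circ>\<^sub>m k') (l' \<circ>\<^sub>m l)"
  using assms unfolding inverse_maps_def map_comp_Some_iff by blast

lemma inverse_path_map: "inverse_maps (path_map E ls) (path_map E (rev (map (\<lambda>(g, b). (g, \<not> b)) ls)))"
proof (induction ls)
  case Nil
  then show ?case by (auto simp: inverse_maps_def)
next
  case (Cons l ls)
  then show ?case
    using inverse_maps_comp[OF inverse_letter_map[of E "fst l" "snd l"] Cons]
    by (simp add: path_map_append case_prod_unfold)
qed

interpretation path: word_action "\<lambda>w. path_map E (letters w)" for E :: "('v, 'e) graph"
  by standard (simp_all add: path_map_append word_adj_def inverse_path_map)

abbreviation path_rep :: "('v, 'e) graph \<Rightarrow> ('v + 'e) free \<Rightarrow> ('e list \<times> 'v \<Rightarrow>\<^sub>0 complex) \<Rightarrow> ('e list \<times> 'v \<Rightarrow>\<^sub>0 complex)" where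
  "path_rep E \<equiv> path.rep E"

lemma path_rep_gen:
  "path_rep E (free_gen g) f = push (letter_map E (g, False)) f"
  "path_rep E (free_adj (free_gen g)) f = push (letter_map E (g, True)) f"
  by (simp_all add: free_gen_def path.rep_simps cscale_simps word_adj_def)

lemma path_rep_sum: "path_rep E (sum h I) f = (\<Sum>i\<in>I. path_rep E (h i) f)"
  by (induction I rule: infinite_finite_induct) (simp_all add: path.rep_simps)

text \<open>The operators are compared on basis vectors. Only relation (3) involves more than the
  clauses of \<open>letter_map\<close>: the two sides agree because a regular vertex carries no
  valid path of length zero.\<close>

lemma path_rep_relation:
  assumes "x \<in> graph_relations E"
  shows "path_rep E x f = 0"
proof (rule additive_poly_mapping_eqI[where T = "path_rep E x" and T' = "\<lambda>f. 0"])
  fix i :: "'b list \<times> 'a" and a :: complex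
  obtain \<mu> v where i: "i = (\<mu>, v)" by (cases i)
  have sum: "path_rep E (free_p w - (\<Sum>e\<in>{e. rng E e = w}. free_s e * free_adj (free_s e)))
      (Poly_Mapping.single i a) = 0" if w: "\<not> singular_vertex E w" for w
  proof (cases \<mu>)
    \<comment> \<open>A valid path of length zero sits at a singular vertex, so every term vanishes
      at the regular vertex \<open>w\<close>.\<close>
    case Nil
    then show ?thesis using w unfolding i
      by (auto simp: path.rep_diff path.rep_mult path_rep_sum path_rep_gen push_single path.rep_linear)
  next
    case (Cons f \<nu>)
    have fin: "finite {e. rng E e = w}" using w by (simp add: singular_vertex_def)
    \<comment> \<open>Only the edge at the head of the path contributes, so the finite sum over
      \<open>e\<close> has at most one nonzero term.\<close>
    have "path_rep E (free_s e * free_adj (free_s e)) (Poly_Mapping.single i a) =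
        (if f = e then (if valid E i then Poly_Mapping.single i a else 0) else 0)" for e
      unfolding i Cons by (auto simp: path.rep_mult path_rep_gen push_single)
    then show ?thesis using fin unfolding path.rep_diff path_rep_sum
      by (auto simp: path_rep_gen push_single i Cons)
  qed
  show "path_rep E x (Poly_Mapping.single i a) = 0"
    using assms sum unfolding graph_relations_def i
    by (cases \<mu>)
       (auto simp: path.rep_diff path.rep_mult path_rep_gen push_single path.rep_linear)
qed (simp_all add: path.rep_linear)

text \<open>By \<open>path_rep_relation\<close> the operator seminorm is one of those whose supremum
  is the universal one. This is how path coefficients become continuous on the graph
  algebra.\<close>

lemma path_norm_le: "x \<in> free_algebra \<Longrightarrow> path.rep_norm E x \<le> universal_seminorm (graph_relations E) x"
proof (rule graph.admissible_le)
  have "path.rep_norm E x = 0" if "x \<in> graph_relations E" for x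
    using path.rep_norm_least[of 0 E x] path.rep_norm_nonneg[of E x] path_rep_relation[OF that] by simp
  then show "path.rep_norm E \<in> admissible_seminorms (graph_relations E)"
    by (simp add: admissible_seminorms_def path.cstar_seminorm_rep)
qed

section \<open>Matrix entries of the path representation\<close>

definition entry :: "('v, 'e) graph \<Rightarrow> 'e list \<times> 'v \<Rightarrow> 'e list \<times> 'v \<Rightarrow> ('v + 'e) free \<Rightarrow> complex" where
  "entry E j i x = Poly_Mapping.lookup (path_rep E x (Poly_Mapping.single i 1)) j"

lemma entry_linear: "entry E j i (x + y) = entry E j i x + entry E j i y"
  "entry E j i (free_scale a x) = a * entry E j i x"
  by (simp_all add: entry_def path.rep_simps path.rep_scale lookup_add)

lemma entry_single: "entry E j i (Poly_Mapping.single w a) = (if path_map E (letters w) i = Some j then a else 0)"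
  by (auto simp: entry_def path.rep_simps push_single lookup_single when_def split: option.split)

lemma entry_bessel:
  assumes "x \<in> free_algebra" "finite M"
  shows "(\<Sum>j\<in>M. (cmod (entry E j i x))\<^sup>2) \<le> (universal_seminorm (graph_relations E) x)\<^sup>2"
proof -
  have "norm (path_rep E x (Poly_Mapping.single i 1)) \<le> universal_seminorm (graph_relations E) x"
    using path.norm_rep_le[of E x "Poly_Mapping.single i 1"] path_norm_le[OF assms(1), of E] by simp
  then have "(norm (path_rep E x (Poly_Mapping.single i 1)))\<^sup>2 \<le> (universal_seminorm (graph_relations E) x)\<^sup>2"
    by (intro power_mono) auto
  then show ?thesis
    using bessel_poly_mapping[OF assms(2), of "path_rep E x (Poly_Mapping.single i 1)"] by (simp add: entry_def)
qed

text \<open>The inner product sees only real parts; testing adjointness against \<open>b = 1\<close>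
  and \<open>b = \<i>\<close> recovers the complex identity.\<close>

lemma entry_adj: "entry E j i (free_adj x) = cnj (entry E i j x)"
proof -
  have "inner (path_rep E x (Poly_Mapping.single j 1)) (Poly_Mapping.single i b) =
      inner (Poly_Mapping.single j 1) (cscale b (path_rep E (free_adj x) (Poly_Mapping.single i 1)))" for b
    using path.rep_linear(2)[of E "free_adj x" b "Poly_Mapping.single i 1"]
    by (simp add: path.rep_adjoint cscale_simps)
  moreover have "inner f (Poly_Mapping.single i b) = inner (Poly_Mapping.lookup f i) b"
    "inner (Poly_Mapping.single i b) f = inner b (Poly_Mapping.lookup f i)"
    for f :: "'b list \<times> 'a \<Rightarrow>\<^sub>0 complex" and i b
    using inner_poly_mapping_superset[of "{i}" "Poly_Mapping.single i b" f]
    by (simp_all add: inner_commute)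
  ultimately have "inner (entry E i j x) b = inner 1 (b * entry E j i (free_adj x))" for b
    by (simp add: entry_def)
  from this[of 1] this[of \<i>] show ?thesis by (simp add: complex_eq_iff inner_complex_def)
qed

text \<open>Row \<open>j\<close> of \<open>x\<close> is the conjugate of column \<open>j\<close> of
  \<open>free_adj x\<close>, which has finite support. Hence the matrix product is a finite sum over
  a set that depends neither on \<open>i\<close> nor on \<open>y\<close>.\<close>

lemma entry_mult:
  obtains K where "finite K" "\<And>i y. entry E j i (x * y) = (\<Sum>m\<in>K. entry E j m x * entry E m i y)"
proof
  let ?K = "Poly_Mapping.keys (path_rep E (free_adj x) (Poly_Mapping.single j 1))"
  show "finite ?K" by simp
  have zero: "entry E j m x = 0" if "m \<notin> ?K" for m
    using that entry_adj[of E m j x] by (simp add: in_keys_iff flip: entry_def)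
  have *: "Poly_Mapping.lookup (path_rep E x f) j = (\<Sum>m\<in>?K. entry E j m x * Poly_Mapping.lookup f m)" for f
  proof (rule additive_poly_mapping_eqI[where f = f])
    fix i b
    have "path_rep E x (Poly_Mapping.single i b) = cscale b (path_rep E x (Poly_Mapping.single i 1))"
      using path.rep_linear(2)[of E x b "Poly_Mapping.single i 1"] by (simp add: cscale_simps)
    then have "Poly_Mapping.lookup (path_rep E x (Poly_Mapping.single i b)) j = entry E j i x * b"
      by (simp add: entry_def)
    moreover have "(\<Sum>m\<in>?K. entry E j m x * Poly_Mapping.lookup (Poly_Mapping.single i b) m) =
        (\<Sum>m\<in>?K. if m = i then entry E j i x * b else 0)"
      by (rule sum.cong) (auto simp: lookup_single when_def)
    ultimately show "Poly_Mapping.lookup (path_rep E x (Poly_Mapping.single i b)) j =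
        (\<Sum>m\<in>?K. entry E j m x * Poly_Mapping.lookup (Poly_Mapping.single i b) m)"
      using zero[of i] by auto
  qed (simp_all add: path.rep_linear lookup_add distrib_left sum.distrib)
  show "entry E j i (x * y) = (\<Sum>m\<in>?K. entry E j m x * entry E m i y)" for i y
    using *[of "path_rep E y (Poly_Mapping.single i 1)"] by (simp add: entry_def path.rep_mult)
qed

lemma entry_row_bessel:
  assumes "x \<in> free_algebra" "finite M"
  shows "(\<Sum>m\<in>M. (cmod (entry E j m x))\<^sup>2) \<le> (universal_seminorm (graph_relations E) x)\<^sup>2"
  using entry_bessel[of "free_adj x" M E j] assms graph.U.N_adj[of x E] by (simp add: entry_adj)

lemma entry_le:
  assumes "x \<in> free_algebra"
  shows "cmod (entry E j i x) \<le> universal_seminorm (graph_relations E) x"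
  using entry_bessel[OF assms, of "{j}" E i] graph.universal_nonneg[OF assms, of E]
  by (simp add: power2_le_iff_abs_le)

text \<open>The entry is the squared length of column \<open>i\<close> of \<open>x\<close>.\<close>

lemma entry_positive: "entry E i i (free_adj x * x) \<in> \<real>\<^sub>\<ge>\<^sub>0"
proof -
  obtain K where "finite K" "\<And>k y. entry E i k (free_adj x * y) = (\<Sum>m\<in>K. entry E i m (free_adj x) * entry E m k y)"
    using entry_mult[of E i "free_adj x"] by blast
  then have "entry E i i (free_adj x * x) = (\<Sum>m\<in>K. complex_of_real ((cmod (entry E m i x))\<^sup>2))"
    by (simp add: entry_adj complex_norm_square mult.commute del: of_real_power)
  also have "\<dots> \<in> \<real>\<^sub>\<ge>\<^sub>0"
    by (simp add: complex_nonneg_Reals_iff sum_nonneg flip: of_real_sum)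
  finally show ?thesis .
qed

section \<open>Matrix entries on the graph C*-algebra\<close>

context cstar_algebra
begin

definition contractive :: "('a \<Rightarrow> complex) \<Rightarrow> bool" where
  "contractive G \<longleftrightarrow>
    (\<forall>x\<in>carrier A. \<forall>y\<in>carrier A. G (x \<oplus> y) = G x + G y) \<and>
    (\<forall>a. \<forall>x\<in>carrier A. G (a \<odot> x) = a * G x) \<and>
    (\<forall>x\<in>carrier A. cmod (G x) \<le> cnorm A x)"

lemma contractiveD:
  assumes "contractive G"
  shows "x \<in> carrier A \<Longrightarrow> y \<in> carrier A \<Longrightarrow> G (x \<oplus> y) = G x + G y"
    "x \<in> carrier A \<Longrightarrow> G (a \<odot> x) = a * G x"
    "x \<in> carrier A \<Longrightarrow> cmod (G x) \<le> cnorm A x"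
    "x \<in> carrier A \<Longrightarrow> y \<in> carrier A \<Longrightarrow> G (x \<ominus> y) = G x - G y"
proof -
  show 1: "x \<in> carrier A \<Longrightarrow> y \<in> carrier A \<Longrightarrow> G (x \<oplus> y) = G x + G y" for x y
    using assms by (simp add: contractive_def)
  show 2: "x \<in> carrier A \<Longrightarrow> G (a \<odot> x) = a * G x" for a x
    using assms by (simp add: contractive_def)
  show "x \<in> carrier A \<Longrightarrow> cmod (G x) \<le> cnorm A x"
    using assms by (simp add: contractive_def)
  show "x \<in> carrier A \<Longrightarrow> y \<in> carrier A \<Longrightarrow> G (x \<ominus> y) = G x - G y"
    using 1[of x "\<ominus> y"] 2[of y "-1"] by (simp add: a_minus_def scale_minus)
qed

lemma contractive_tendsto:
  assumes G: "contractive G" and X: "tends X x F"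
  shows "((\<lambda>n. G (X n)) \<longlongrightarrow> G x) F"
  by (rule tendsto_functional[where K = 1, OF contractiveD(4)[OF G] _ X])
     (simp_all add: contractiveD(3)[OF G])

text \<open>A bounded functional carries norm convergence of difference quotients to scalar
  convergence, so that scalar complex analysis applies to the coefficients of an orbit.\<close>

lemma contractive_entire:
  assumes G: "contractive G" and F: "entire_into A F"
  shows "(\<lambda>z. G (F z)) holomorphic_on UNIV"
  unfolding holomorphic_on_def
proof
  fix z :: complex
  have Fc: "F w \<in> carrier A" for w using F by (simp add: entire_into_def)
  obtain d where d: "d \<in> carrier A" and
    lim: "((\<lambda>w. cnorm A (inverse (w - z) \<odot> (F w \<ominus> F z) \<ominus> d)) \<longlongrightarrow> 0) (at z)"
    using F unfolding entire_into_def by blast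
  have "tends (\<lambda>w. inverse (w - z) \<odot> (F w \<ominus> F z)) d (at z)"
    unfolding tends_def using d lim Fc by (simp add: scale_closed)
  from contractive_tendsto[OF G this]
  have "((\<lambda>w. (G (F w) - G (F z)) / (w - z)) \<longlongrightarrow> G d) (at z)"
    by (simp add: contractiveD[OF G] Fc scale_closed divide_inverse mult.commute)
  then have "((\<lambda>z. G (F z)) has_field_derivative G d) (at z)"
    by (simp add: has_field_derivative_iff)
  then show "(\<lambda>z. G (F z)) field_differentiable at z within UNIV"
    by (auto simp: field_differentiable_def)
qed

end

section \<open>Continuation from the real line and logarithmic weights\<close>

lemma entire_eq_on_reals:
  fixes f g :: "complex \<Rightarrow> complex"
  assumes "f holomorphic_on UNIV" "g holomorphic_on UNIV"
    and "\<And>t. f (complex_of_real t) = g (complex_of_real t)"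
  shows "f z = g z"
proof -
  \<comment> \<open>The identity theorem for \<open>f z - g z\<close> calls for an accumulation
    point of the reals.\<close>
  have "(0 :: complex) islimpt \<real>"
    unfolding islimpt_approachable
  proof (intro allI impI)
    fix \<epsilon> :: real assume "\<epsilon> > 0"
    then show "\<exists>x'\<in>\<real>. x' \<noteq> 0 \<and> dist x' (0 :: complex) < \<epsilon>"
      by (intro bexI[of _ "complex_of_real (\<epsilon> / 2)"]) (auto simp: dist_norm)
  qed
  then have "f z - g z = 0"
    by (rule analytic_continuation[of "\<lambda>z. f z - g z" UNIV \<real>, rotated 5])
       (use assms in \<open>auto intro!: holomorphic_intros elim!: Reals_cases\<close>)
  then show ?thesis by simp
qed

text \<open>The logarithm of \<open>c(\<mu>)\<close>, the product of the weights along the path;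
  appending or removing an edge becomes addition.\<close>

definition path_log :: "('e \<Rightarrow> real) \<Rightarrow> 'e list \<times> 'v \<Rightarrow> real" where
  "path_log c i = (\<Sum>e\<leftarrow>fst i. ln (c e))"

fun letter_log :: "('e \<Rightarrow> real) \<Rightarrow> ('v + 'e) \<times> bool \<Rightarrow> real" where
  "letter_log c (Inl v, b) = 0"
| "letter_log c (Inr e, b) = (if b then - ln (c e) else ln (c e))"

lemma letter_map_log: "letter_map E l i = Some j \<Longrightarrow> path_log c j = letter_log c l + path_log c i"
  by (induction E l i rule: letter_map.induct) (auto simp: path_log_def split: if_splits)

text \<open>All words that take \<open>i\<close> to \<open>j\<close> have the same total weight, the
  difference of the logarithms of the two paths.\<close>

lemma path_map_log: "path_map E ls i = Some j \<Longrightarrow> path_log c j = sum_list (map (letter_log c) ls) + path_log c i"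
proof (induction ls arbitrary: j)
  case (Cons l ls)
  then obtain m where m: "path_map E ls i = Some m" "letter_map E l m = Some j"
    by (auto simp: map_comp_Some_iff)
  then show ?case using Cons.IH[OF m(1)] letter_map_log[OF m(2), of c] by simp
qed simp

section \<open>Extension of functionals and matrix coefficients on the graph algebra\<close>

context graph_algebra
begin

text \<open>The bound by \<open>U\<close> makes \<open>g\<close> Lipschitz for the norm of
  \<open>A\<close> on the dense image of the free algebra, so it extends by limits.\<close>

lemma functional_extension:
  assumes add: "\<And>x y. g (x + y) = g x + g y" and scale: "\<And>a x. g (free_scale a x) = a * g x"
    and bound: "\<And>x. x \<in> free_algebra \<Longrightarrow> cmod (g x) \<le> U x"
  shows "\<exists>G. contractive G \<and> (\<forall>x\<in>free_algebra. G (ev x) = g x)"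
proof -
  define approx where "approx Y b \<longleftrightarrow> (\<forall>n. Y n \<in> free_algebra) \<and> tends (\<lambda>n. ev (Y n)) b sequentially" for Y b
  have le: "cmod (g x - g y) \<le> cnorm A (ev x \<ominus> b) + cnorm A (ev y \<ominus> b)"
    if "x \<in> free_algebra" "y \<in> free_algebra" "b \<in> carrier A" for x y b
  proof -
    have "cmod (g x - g y) \<le> cnorm A (ev x \<ominus> ev y)"
      using bound[of "x - y"] norm_ev[of "x - y"] add[of "x - y" y] that by (simp add: ev_diff)
    also have "\<dots> \<le> cnorm A (ev x \<ominus> b) + cnorm A (b \<ominus> ev y)"
      by (rule norm_diff_triangle) (simp_all add: that)
    also have "cnorm A (b \<ominus> ev y) = cnorm A (ev y \<ominus> b)" by (rule norm_minus_commute) (simp_all add: that)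
    finally show ?thesis .
  qed
  have conv: "\<exists>l. (\<lambda>n. g (Y n)) \<longlonglongrightarrow> l" if Y: "approx Y b" for Y b
  proof -
    have d: "Y n \<in> free_algebra" "b \<in> carrier A" "(\<lambda>n. cnorm A (ev (Y n) \<ominus> b)) \<longlonglongrightarrow> 0" for n
      using Y tendsD[of "\<lambda>n. ev (Y n)" b sequentially] by (simp_all add: approx_def)
    have "Cauchy (\<lambda>n. g (Y n))"
    proof (rule metric_CauchyI)
      fix \<epsilon> :: real assume "\<epsilon> > 0"
      then have "eventually (\<lambda>n. cnorm A (ev (Y n) \<ominus> b) < \<epsilon> / 2) sequentially"
        by (intro order_tendstoD(2)[OF d(3)]) simp
      then obtain M where M: "\<forall>n\<ge>M. cnorm A (ev (Y n) \<ominus> b) < \<epsilon> / 2"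
        unfolding eventually_sequentially by (rule exE)
      have "dist (g (Y m)) (g (Y n)) < \<epsilon>" if "m \<ge> M" "n \<ge> M" for m n
        using le[OF d(1) d(1) d(2), of m n] M[rule_format, OF that(1)] M[rule_format, OF that(2)] by (simp add: dist_norm)
      then show "\<exists>M. \<forall>m\<ge>M. \<forall>n\<ge>M. dist (g (Y m)) (g (Y n)) < \<epsilon>" by (intro exI[of _ M]) simp
    qed
    then show ?thesis by (simp add: Cauchy_convergent_iff convergent_def)
  qed
  \<comment> \<open>A chosen approximating sequence defines the limit; the claim \<open>G\<close>
    below frees it from this choice, so that each operation can use a sequence suited to it.\<close>
  define X where "X b = (SOME Y. approx Y b)" for b
  have X: "approx (X b) b" if "b \<in> carrier A" for b
  proof -
    obtain Y where "\<And>n. Y n \<in> free_algebra" "tends (\<lambda>n. ev (Y n)) b sequentially"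
      by (rule ev_dense[OF \<open>b \<in> carrier A\<close>]) (rule that)
    then have "approx Y b" by (simp add: approx_def)
    then show ?thesis unfolding X_def by (rule someI[of "\<lambda>Y. approx Y b"])
  qed
  define G where "G b = lim (\<lambda>n. g (X b n))" for b
  have G: "(\<lambda>n. g (Y n)) \<longlonglongrightarrow> G b" if Y: "approx Y b" for Y b
  proof -
    have b: "b \<in> carrier A" using Y tendsD(2)[of "\<lambda>n. ev (Y n)" b sequentially] by (simp add: approx_def)
    note X = X[OF b]
    have lim: "(\<lambda>n. g (X b n)) \<longlonglongrightarrow> G b"
      unfolding G_def using conv[OF X] by (simp add: convergent_def flip: convergent_LIMSEQ_iff)
    have "(\<lambda>n. cnorm A (ev (Y n) \<ominus> b) + cnorm A (ev (X b n) \<ominus> b)) \<longlonglongrightarrow> 0"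
      using X Y unfolding approx_def by (intro tendsto_add_zero tendsD(3)[where L = b]) simp_all
    then have "(\<lambda>n. g (Y n) - g (X b n)) \<longlonglongrightarrow> 0"
    proof (rule Lim_null_comparison[rotated], intro always_eventually allI)
      show "cmod (g (Y n) - g (X b n)) \<le> cnorm A (ev (Y n) \<ominus> b) + cnorm A (ev (X b n) \<ominus> b)" for n
        using X Y b by (intro le) (simp_all add: approx_def)
    qed
    from tendsto_add[OF this lim] show ?thesis by simp
  qed
  have "contractive G"
    unfolding contractive_def
  proof (intro conjI ballI allI)
    fix x y a assume x: "x \<in> carrier A"
    note x = X[OF x]
    show "cmod (G x) \<le> cnorm A x"
    proof (rule LIMSEQ_le[OF tendsto_norm[OF G[OF x]]])
      show "(\<lambda>n. cnorm A (ev (X x n))) \<longlonglongrightarrow> cnorm A x"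
        using x by (intro tends_norm) (simp add: approx_def)
      show "\<exists>N. \<forall>n\<ge>N. cmod (g (X x n)) \<le> cnorm A (ev (X x n))"
        using x bound by (simp add: approx_def norm_ev)
    qed
    have "approx (\<lambda>n. free_scale a (X x n)) (a \<odot> x)"
      using x tends_scale[of "\<lambda>n. ev (X x n)" x sequentially a] by (simp add: approx_def ev_scale)
    from LIMSEQ_unique[OF G[OF this]] show "G (a \<odot> x) = a * G x"
      using tendsto_mult_left[OF G[OF x], of a] by (simp add: scale)
    assume y: "y \<in> carrier A"
    note y = X[OF y]
    have "approx (\<lambda>n. X x n + X y n) (x \<oplus> y)"
      using x y tends_add[of "\<lambda>n. ev (X x n)" x sequentially "\<lambda>n. ev (X y n)" y]
      by (simp add: approx_def ev_add)
    from LIMSEQ_unique[OF G[OF this]] show "G (x \<oplus> y) = G x + G y"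
      using tendsto_add[OF G[OF x] G[OF y]] by (simp add: add)
  qed
  moreover have "G (ev x) = g x" if "x \<in> free_algebra" for x
  proof -
    have "approx (\<lambda>n. x) (ev x)" using that by (simp add: approx_def tends_const)
    from LIMSEQ_unique[OF G[OF this]] show ?thesis by simp
  qed
  ultimately show ?thesis by (intro exI[of _ G]) simp
qed

text \<open>The continuous extension of \<open>entry\<close>. Density of the image of
  \<open>ev\<close> determines it on the carrier, so the choice does not matter there.\<close>

definition coef :: "'e list \<times> 'v \<Rightarrow> 'e list \<times> 'v \<Rightarrow> (nat \<Rightarrow> ('v + 'e) free) set \<Rightarrow> complex" where
  "coef j i = (SOME G. contractive G \<and> (\<forall>x\<in>free_algebra. G (ev x) = entry E j i x))"

lemma coef_spec: "contractive (coef j i) \<and> (\<forall>x\<in>free_algebra. coef j i (ev x) = entry E j i x)"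
  unfolding coef_def
  by (rule someI_ex[of "\<lambda>G. contractive G \<and> (\<forall>x\<in>free_algebra. G (ev x) = entry E j i x)"],
      rule functional_extension) (simp_all add: entry_linear entry_le)

lemma coef_contractive: "contractive (coef j i)"
  using coef_spec by simp

lemma coef_ev: "x \<in> free_algebra \<Longrightarrow> coef j i (ev x) = entry E j i x"
  using coef_spec by simp

lemmas coef_tendsto = contractive_tendsto[OF coef_contractive]

lemma coef_bessel:
  assumes M: "finite M" and b: "b \<in> carrier A"
  shows "(\<Sum>j\<in>M. (cmod (coef j i b))\<^sup>2) \<le> (cnorm A b)\<^sup>2"
proof (rule closed_induct[OF b, of "\<lambda>b. (\<Sum>j\<in>M. (cmod (coef j i b))\<^sup>2) \<le> (cnorm A b)\<^sup>2"])
  fix x :: "('v + 'e) free" assume "x \<in> free_algebra"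
  then show "(\<Sum>j\<in>M. (cmod (coef j i (ev x)))\<^sup>2) \<le> (cnorm A (ev x))\<^sup>2"
    using entry_bessel[of x M E i] M by (simp add: coef_ev norm_ev)
next
  fix X x assume X: "\<And>n. (\<Sum>j\<in>M. (cmod (coef j i (X n)))\<^sup>2) \<le> (cnorm A (X n))\<^sup>2" "tends X x sequentially"
  show "(\<Sum>j\<in>M. (cmod (coef j i x))\<^sup>2) \<le> (cnorm A x)\<^sup>2"
  proof (rule LIMSEQ_le)
    show "(\<lambda>n. \<Sum>j\<in>M. (cmod (coef j i (X n)))\<^sup>2) \<longlonglongrightarrow> (\<Sum>j\<in>M. (cmod (coef j i x))\<^sup>2)"
      by (rule tendsto_sum, rule tendsto_power, rule tendsto_norm, rule coef_tendsto, rule X)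
    show "(\<lambda>n. (cnorm A (X n))\<^sup>2) \<longlonglongrightarrow> (cnorm A x)\<^sup>2"
      by (rule tendsto_power, rule tends_norm, rule X)
  qed (use X(1) in simp)
qed

text \<open>With the left factor in the free algebra, the finite set \<open>K\<close> of
  \<open>entry_mult\<close> stays fixed while \<open>b\<close> is approximated, so both sides are
  continuous in \<open>b\<close>.\<close>

lemma coef_mult:
  assumes y: "y \<in> free_algebra"
  obtains K where "finite K"
    "\<And>i b. b \<in> carrier A \<Longrightarrow> coef j i (ev y \<otimes> b) = (\<Sum>m\<in>K. entry E j m y * coef m i b)"
proof -
  obtain K where K: "finite K" "\<And>i z. entry E j i (y * z) = (\<Sum>m\<in>K. entry E j m y * entry E m i z)"
    by (rule entry_mult[of E j y]) (rule that)
  have eq: "coef j i (ev y \<otimes> b) = (\<Sum>m\<in>K. entry E j m y * coef m i b)" if b: "b \<in> carrier A" for i b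
  proof (rule closed_induct[OF b, of "\<lambda>b. coef j i (ev y \<otimes> b) = (\<Sum>m\<in>K. entry E j m y * coef m i b)"])
    fix z :: "('v + 'e) free" assume z: "z \<in> free_algebra"
    have "coef j i (ev y \<otimes> ev z) = coef j i (ev (y * z))" using y z by (simp add: ev_mult)
    then show "coef j i (ev y \<otimes> ev z) = (\<Sum>m\<in>K. entry E j m y * coef m i (ev z))"
      using y z by (simp add: coef_ev K)
  next
    fix X x assume X: "\<And>n. coef j i (ev y \<otimes> X n) = (\<Sum>m\<in>K. entry E j m y * coef m i (X n))"
      "tends X x sequentially"
    have "(\<lambda>n. coef j i (ev y \<otimes> X n)) \<longlonglongrightarrow> coef j i (ev y \<otimes> x)"
      by (rule coef_tendsto, rule tends_mult[OF tends_const X(2)]) simp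
    moreover have "(\<lambda>n. coef j i (ev y \<otimes> X n)) \<longlonglongrightarrow> (\<Sum>m\<in>K. entry E j m y * coef m i x)"
      unfolding X(1) by (rule tendsto_sum, rule tendsto_mult_left, rule coef_tendsto, rule X)
    ultimately show "coef j i (ev y \<otimes> x) = (\<Sum>m\<in>K. entry E j m y * coef m i x)" by (rule LIMSEQ_unique)
  qed
  show thesis by (rule that[OF K(1) eq])
qed

lemma coef_positive:
  assumes b: "b \<in> carrier A"
  shows "coef i i (adj A b \<otimes> b) \<in> \<real>\<^sub>\<ge>\<^sub>0"
proof (rule closed_induct[OF b, of "\<lambda>b. coef i i (adj A b \<otimes> b) \<in> \<real>\<^sub>\<ge>\<^sub>0"])
  fix x :: "('v + 'e) free" assume x: "x \<in> free_algebra"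
  have "coef i i (adj A (ev x) \<otimes> ev x) = coef i i (ev (free_adj x * x))"
    using x by (simp add: ev_mult ev_adj)
  then show "coef i i (adj A (ev x) \<otimes> ev x) \<in> \<real>\<^sub>\<ge>\<^sub>0"
    using x by (simp add: coef_ev entry_positive)
next
  fix X x assume X: "\<And>n. coef i i (adj A (X n) \<otimes> X n) \<in> \<real>\<^sub>\<ge>\<^sub>0" "tends X x sequentially"
  have "(\<lambda>n. coef i i (adj A (X n) \<otimes> X n)) \<longlonglongrightarrow> coef i i (adj A x \<otimes> x)"
    by (rule coef_tendsto, rule tends_mult[OF tends_adj[OF X(2)] X(2)])
  then show "coef i i (adj A x \<otimes> x) \<in> \<real>\<^sub>\<ge>\<^sub>0"
    using X(1) by (intro Lim_in_closed_set[OF closed_nonneg_Reals_complex]) auto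
qed

section \<open>The flow on matrix coefficients\<close>

lemma action_val:
  assumes "graph_action E c \<sigma>" "\<And>e. c e > 0"
  shows "\<sigma> t (val l) = exp (\<i> * complex_of_real (letter_log c l * t)) \<odot> val l"
proof -
  have p: "\<sigma> t (p v) = p v" for v using assms(1) by (simp add: graph_action_def)
  obtain g b where l: "l = (g, b)" by (cases l)
  show ?thesis unfolding l
    by (cases g; cases b) (simp_all add: val_simps p scale_one action_s[OF assms] action_s'[OF assms])
qed

lemma action_linear:
  assumes "graph_action E c \<sigma>"
  shows "x \<in> carrier A \<Longrightarrow> \<sigma> t x \<in> carrier A"
    "x \<in> carrier A \<Longrightarrow> y \<in> carrier A \<Longrightarrow> \<sigma> t (x \<oplus> y) = \<sigma> t x \<oplus> \<sigma> t y"
    "x \<in> carrier A \<Longrightarrow> y \<in> carrier A \<Longrightarrow> \<sigma> t (x \<otimes> y) = \<sigma> t x \<otimes> \<sigma> t y"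
    "x \<in> carrier A \<Longrightarrow> \<sigma> t (a \<odot> x) = a \<odot> \<sigma> t x"
    "\<sigma> t \<zero> = \<zero>"
    "x \<in> carrier A \<Longrightarrow> y \<in> carrier A \<Longrightarrow> \<sigma> t (x \<ominus> y) = \<sigma> t x \<ominus> \<sigma> t y"
proof -
  note h = action_hom(1)[OF assms, of t, unfolded star_hom_def]
  show 1: "x \<in> carrier A \<Longrightarrow> \<sigma> t x \<in> carrier A" for x using h by (simp add: Pi_iff)
  show 2: "x \<in> carrier A \<Longrightarrow> y \<in> carrier A \<Longrightarrow> \<sigma> t (x \<oplus> y) = \<sigma> t x \<oplus> \<sigma> t y" for x y using h by simp
  show "x \<in> carrier A \<Longrightarrow> y \<in> carrier A \<Longrightarrow> \<sigma> t (x \<otimes> y) = \<sigma> t x \<otimes> \<sigma> t y" using h by simp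
  show 4: "x \<in> carrier A \<Longrightarrow> \<sigma> t (a \<odot> x) = a \<odot> \<sigma> t x" for x a using h by simp
  show "\<sigma> t \<zero> = \<zero>" using 4[of \<zero> 0] 1[of \<zero>] by simp
  show "x \<in> carrier A \<Longrightarrow> y \<in> carrier A \<Longrightarrow> \<sigma> t (x \<ominus> y) = \<sigma> t x \<ominus> \<sigma> t y"
    using 2[of x "\<ominus> y"] 4[of y "-1"] 1[of y] by (simp add: a_minus_def scale_minus)
qed

lemma action_wval:
  assumes act: "graph_action E c \<sigma>" "\<And>e. c e > 0"
  shows "\<sigma> t (wval ls) = exp (\<i> * complex_of_real (sum_list (map (letter_log c) ls) * t)) \<odot> wval ls"
proof (induction ls rule: wval.induct)
  case 1
  then show ?case by (simp add: action_linear(5)[OF act(1)] scale_one)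
next
  case (2 l)
  then show ?case by (simp add: action_val[OF act])
next
  case (3 l l' ls)
  then show ?case
    by (simp add: action_val[OF act] action_linear(3)[OF act(1)] mult_closed scale_mult_left scale_mult_right
        scale_scale scale_closed algebra_simps del: mult_exp_exp flip: exp_add)
qed

text \<open>On a word the flow is the scalar given by its weight, and by \<open>path_map_log\<close>
  this scalar is the same for all words with a nonzero entry. Isometry of \<open>\<sigma> t\<close>
  permits the passage to limits.\<close>

lemma coef_action:
  assumes act: "graph_action E c \<sigma>" "\<And>e. c e > 0" and b: "b \<in> carrier A"
  shows "coef j i (\<sigma> t b) = exp (\<i> * complex_of_real ((path_log c j - path_log c i) * t)) * coef j i b"
proof (rule closed_induct[OF b, of "\<lambda>b. coef j i (\<sigma> t b) = exp (\<i> * complex_of_real ((path_log c j - path_log c i) * t)) * coef j i b"])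
  let ?e = "exp (\<i> * complex_of_real ((path_log c j - path_log c i) * t))"
  note lin = action_linear[OF act(1)] contractiveD[OF coef_contractive]
  fix x :: "('v + 'e) free" assume "x \<in> free_algebra"
  then show "coef j i (\<sigma> t (ev x)) = ?e * coef j i (ev x)"
  proof (induction x rule: free_algebra_induct_single)
    case zero
    have "coef j i \<zero> = 0" using contractiveD(2)[OF coef_contractive, of \<zero> j i 0] by simp
    then show ?case by (simp add: lin)
  next
    case (single_add w a x)
    have free: "Poly_Mapping.single w a \<in> free_algebra"
      using single_add by (simp add: free_algebra_iff lookup_single)
    have "\<sigma> t (ev (Poly_Mapping.single w a)) =
        exp (\<i> * complex_of_real (sum_list (map (letter_log c) (letters w)) * t)) \<odot> ev (Poly_Mapping.single w a)"
      by (simp add: ev_single lin action_wval[OF act] scale_scale mult.commute)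
    then have "coef j i (\<sigma> t (ev (Poly_Mapping.single w a))) =
        exp (\<i> * complex_of_real (sum_list (map (letter_log c) (letters w)) * t)) * entry E j i (Poly_Mapping.single w a)"
      using free by (simp add: lin coef_ev)
    \<comment> \<open>Where the entry is zero the exponents may differ, but both sides
      vanish.\<close>
    also have "\<dots> = ?e * entry E j i (Poly_Mapping.single w a)"
      using path_map_log[of E "letters w" i j c] by (auto simp: entry_single)
    finally show ?case
      using single_add free by (simp add: ev_add lin coef_ev distrib_left)
  qed
next
  fix X x assume X: "\<And>n. coef j i (\<sigma> t (X n)) = exp (\<i> * complex_of_real ((path_log c j - path_log c i) * t)) * coef j i (X n)"
    "tends X x sequentially"
  have "tends (\<lambda>n. \<sigma> t (X n)) (\<sigma> t x) sequentially"
  proof (rule tendsI[OF _ _ _ tendsD(3)[OF X(2)]])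
    show "cnorm A (\<sigma> t (X n) \<ominus> \<sigma> t x) \<le> cnorm A (X n \<ominus> x)" for n
      using action_hom(2)[OF act(1), of "X n \<ominus> x" t] tendsD(1,2)[OF X(2)]
      by (simp add: action_linear(6)[OF act(1)])
  qed (use tendsD(1,2)[OF X(2)] in \<open>simp_all add: action_linear(1)[OF act(1)]\<close>)
  from LIMSEQ_unique[OF coef_tendsto[OF this]] tendsto_mult_left[OF coef_tendsto[OF X(2)]]
  show "coef j i (\<sigma> t x) = exp (\<i> * complex_of_real ((path_log c j - path_log c i) * t)) * coef j i x"
    by (simp only: X(1))
qed

text \<open>Both sides are entire in \<open>z\<close> and agree for real \<open>z\<close> by
  \<open>coef_action\<close>, so the coefficients of any entire extension are known on the whole
  plane.\<close>

lemma coef_entire: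
  assumes act: "graph_action E c \<sigma>" "\<And>e. c e > 0" and b: "b \<in> carrier A"
    and F: "entire_extension A \<sigma> b F"
  shows "coef j i (F z) = exp (\<i> * complex_of_real (path_log c j - path_log c i) * z) * coef j i b"
proof (rule entire_eq_on_reals[of "\<lambda>z. coef j i (F z)"
      "\<lambda>z. exp (\<i> * complex_of_real (path_log c j - path_log c i) * z) * coef j i b"])
  show "(\<lambda>z. coef j i (F z)) holomorphic_on UNIV"
    using F by (intro contractive_entire[OF coef_contractive]) (simp add: entire_extension_def)
  show "(\<lambda>z. exp (\<i> * complex_of_real (path_log c j - path_log c i) * z) * coef j i b) holomorphic_on UNIV"
    by (intro holomorphic_intros)
  show "coef j i (F (complex_of_real t)) =
      exp (\<i> * complex_of_real (path_log c j - path_log c i) * complex_of_real t) * coef j i b" for t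
    using F coef_action[OF act b, of j i t] by (simp add: entire_extension_def mult.assoc)
qed

text \<open>For \<open>a\<close> in the free algebra only finitely many paths contribute to the matrix product.\<close>

lemma coef_ground_bound:
  assumes act: "graph_action E c \<sigma>" and c: "\<And>e. c e > 1" and a: "a \<in> carrier A" and b: "b \<in> carrier A"
    and F: "entire_extension A \<sigma> b F" and z: "Im z \<ge> 0"
  shows "cmod (coef j ([], v) (a \<otimes> F z)) \<le> cnorm A a * cnorm A b"
proof (rule closed_induct[OF a, of "\<lambda>a. cmod (coef j ([], v) (a \<otimes> F z)) \<le> cnorm A a * cnorm A b"])
  let ?i = "([], v) :: 'e list \<times> 'v"
  have Fc: "F z \<in> carrier A" using F by (simp add: entire_extension_def entire_into_def)
  have c0: "c e > 0" for e using c[of e] by simp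
  have le: "cmod (coef m ?i (F z)) \<le> cmod (coef m ?i b)" for m
  proof -
    \<comment> \<open>The path \<open>([], v)\<close> has weight zero and \<open>c e > 1\<close>
      makes all logarithms nonnegative, so for \<open>Im z \<ge> 0\<close> the exponential has
      modulus at most 1.\<close>
    have "path_log c m \<ge> 0" unfolding path_log_def
      by (rule sum_list_nonneg) (auto intro!: ln_ge_zero less_imp_le[OF c])
    then have "cmod (exp (\<i> * complex_of_real (path_log c m - path_log c ?i) * z)) \<le> 1"
      using z by (simp add: path_log_def)
    then show ?thesis
      by (simp add: coef_entire[OF act c0 b F] Real_Vector_Spaces.norm_mult mult_left_le_one_le)
  qed
  fix y :: "('v + 'e) free" assume y: "y \<in> free_algebra"
  obtain K where K: "finite K"
    "\<And>i b. b \<in> carrier A \<Longrightarrow> coef j i (ev y \<otimes> b) = (\<Sum>m\<in>K. entry E j m y * coef m i b)"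
    by (rule coef_mult[OF y, of j]) (rule that)
  have "cmod (coef j ?i (ev y \<otimes> F z)) \<le> (\<Sum>m\<in>K. cmod (entry E j m y) * cmod (coef m ?i (F z)))"
    unfolding K(2)[OF Fc] by (rule order_trans[OF norm_sum]) (simp add: Real_Vector_Spaces.norm_mult)
  also have "\<dots> \<le> (\<Sum>m\<in>K. \<bar>cmod (entry E j m y)\<bar> * \<bar>cmod (coef m ?i b)\<bar>)"
    by (intro sum_mono) (simp add: le mult_left_mono)
  \<comment> \<open>Cauchy-Schwarz pairs row \<open>j\<close> of \<open>ev y\<close> with the column
    of \<open>b\<close> that belongs to \<open>([], v)\<close>.\<close>
  also have "\<dots> \<le> L2_set (\<lambda>m. cmod (entry E j m y)) K * L2_set (\<lambda>m. cmod (coef m ?i b)) K"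
    by (rule L2_set_mult_ineq)
  also have "\<dots> \<le> cnorm A (ev y) * cnorm A b"
  proof (rule mult_mono)
    show "L2_set (\<lambda>m. cmod (entry E j m y)) K \<le> cnorm A (ev y)"
      using entry_row_bessel[OF y K(1), of E j] norm_nonneg[OF ev_closed, of y]
      by (simp add: L2_set_def norm_ev[OF y] real_le_lsqrt)
    show "L2_set (\<lambda>m. cmod (coef m ?i b)) K \<le> cnorm A b"
      using coef_bessel[OF K(1) b] norm_nonneg[OF b] by (simp add: L2_set_def real_le_lsqrt)
  qed (simp_all add: norm_nonneg L2_set_nonneg)
  finally show "cmod (coef j ?i (ev y \<otimes> F z)) \<le> cnorm A (ev y) * cnorm A b" .
next
  have Fc: "F z \<in> carrier A" using F by (simp add: entire_extension_def entire_into_def)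
  fix X x assume X: "\<And>n. cmod (coef j ([], v) (X n \<otimes> F z)) \<le> cnorm A (X n) * cnorm A b"
    "tends X x sequentially"
  show "cmod (coef j ([], v) (x \<otimes> F z)) \<le> cnorm A x * cnorm A b"
  proof (rule LIMSEQ_le)
    show "(\<lambda>n. cmod (coef j ([], v) (X n \<otimes> F z))) \<longlonglongrightarrow> cmod (coef j ([], v) (x \<otimes> F z))"
      by (rule tendsto_norm, rule coef_tendsto, rule tends_mult[OF X(2) tends_const[OF Fc]])
    show "(\<lambda>n. cnorm A (X n) * cnorm A b) \<longlonglongrightarrow> cnorm A x * cnorm A b"
      by (rule tendsto_mult_right, rule tends_norm, rule X)
  qed (use X(1) in simp)
qed

end

section \<open>Extending tracial states to ground states\<close>

text \<open>Finite partial sums are bounded instead of prescribing a total mass; that the extension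
  has norm one comes from \<open>\<tau>\<close> later. The vertex set may be uncountable, so the
  sums are unordered.\<close>

locale subprobability =
  fixes t :: "'v \<Rightarrow> real"
  assumes nonneg: "0 \<le> t v" and sum_le: "finite F \<Longrightarrow> sum t F \<le> 1"
begin

lemma summable_weights: "t summable_on UNIV"
proof (rule nonneg_bdd_above_summable_on)
  show "bdd_above (sum t ` {F. F \<subseteq> UNIV \<and> finite F})"
    by (rule bdd_aboveI[of _ 1]) (auto intro: sum_le)
qed (rule nonneg)

lemma abs_summable_weighted:
  fixes h :: "'v \<Rightarrow> complex"
  assumes "\<And>v. cmod (h v) \<le> K"
  shows "(\<lambda>v. cmod (complex_of_real (t v) * h v)) summable_on UNIV"
  by (rule Infinite_Sum.abs_summable_on_comparison_test'[OF summable_on_cmult_left[OF summable_weights, of K]])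
     (simp add: norm_mult nonneg mult_left_mono assms)

lemma summable_weighted:
  fixes h :: "'v \<Rightarrow> complex"
  assumes "\<And>v. cmod (h v) \<le> K"
  shows "(\<lambda>v. complex_of_real (t v) * h v) summable_on UNIV"
  by (rule Infinite_Sum.abs_summable_summable[OF abs_summable_weighted[OF assms]])

lemma infsum_weighted_le:
  fixes h :: "'v \<Rightarrow> complex"
  assumes h: "\<And>v. cmod (h v) \<le> K"
  shows "cmod (\<Sum>\<^sub>\<infinity>v. complex_of_real (t v) * h v) \<le> K"
proof -
  have K: "0 \<le> K" using order_trans[OF norm_ge_zero h] .
  have "cmod (\<Sum>\<^sub>\<infinity>v. complex_of_real (t v) * h v) \<le> (\<Sum>\<^sub>\<infinity>v. cmod (complex_of_real (t v) * h v))"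
    by (rule norm_infsum_bound[OF abs_summable_weighted[OF h]])
  also have "\<dots> \<le> (\<Sum>\<^sub>\<infinity>v. t v * K)"
    by (rule infsum_mono[OF abs_summable_weighted[OF h] summable_on_cmult_left[OF summable_weights]])
       (simp add: norm_mult nonneg mult_left_mono h)
  also have "\<dots> = infsum t UNIV * K" by (rule infsum_cmult_left')
  also have "\<dots> \<le> 1 * K"
    by (rule mult_right_mono[OF infsum_le_finite_sums[OF summable_weights sum_le] K])
  finally show ?thesis by simp
qed

end

context graph_algebra
begin

text \<open>A weighted sum of the vector functionals at paths of length zero. For regular
  \<open>v\<close> the coefficient is zero because \<open>([], v)\<close> is not valid;
  \<open>restrict\<close> makes the functional extensional.\<close>

definition weighted_functional :: "('v \<Rightarrow> real) \<Rightarrow> (nat \<Rightarrow> ('v + 'e) free) set \<Rightarrow> complex" where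
  "weighted_functional t = restrict (\<lambda>b. \<Sum>\<^sub>\<infinity>v. complex_of_real (t v) * coef ([], v) ([], v) b) (carrier A)"

lemma weighted_functional_contractive:
  assumes "subprobability t"
  shows "contractive (weighted_functional t)"
proof -
  interpret subprobability t by (rule assms)
  note le = contractiveD(3)[OF coef_contractive]
  show ?thesis
    unfolding contractive_def
  proof (intro conjI ballI allI)
    fix x y a assume x: "x \<in> carrier A"
    show "cmod (weighted_functional t x) \<le> cnorm A x"
      using infsum_weighted_le[OF le[OF x]] x by (simp add: weighted_functional_def)
    show "weighted_functional t (a \<odot> x) = a * weighted_functional t x"
      using x infsum_cmult_right'[of a "\<lambda>v. complex_of_real (t v) * coef ([], v) ([], v) x" UNIV]
      by (simp add: weighted_functional_def scale_closed contractiveD(2)[OF coef_contractive] mult.left_commute)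
    assume y: "y \<in> carrier A"
    show "weighted_functional t (x \<oplus> y) = weighted_functional t x + weighted_functional t y"
      using x y infsum_add[OF summable_weighted[OF le[OF x]] summable_weighted[OF le[OF y]]]
      by (simp add: weighted_functional_def contractiveD(1)[OF coef_contractive] distrib_left)
  qed
qed

lemma weighted_functional_positive:
  assumes "subprobability t" "x \<in> carrier A"
  shows "weighted_functional t (adj A x \<otimes> x) \<in> \<real>\<^sub>\<ge>\<^sub>0"
proof -
  interpret subprobability t by (rule assms(1))
  have x: "adj A x \<otimes> x \<in> carrier A" using assms(2) by (simp add: mult_closed adj_closed)
  have "0 \<le> (\<Sum>\<^sub>\<infinity>v. complex_of_real (t v) * coef ([], v) ([], v) (adj A x \<otimes> x))"
    by (rule infsum_nonneg_complex[OF summable_weighted[OF contractiveD(3)[OF coef_contractive x]]])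
       (use coef_positive[OF assms(2)] nonneg in \<open>simp add: less_eq_complex_def complex_nonneg_Reals_iff\<close>)
  then show ?thesis
    using x by (simp add: weighted_functional_def less_eq_complex_def complex_nonneg_Reals_iff)
qed

text \<open>Among the paths of length zero, \<open>p w\<close> fixes only the one at
  \<open>w\<close>, and only for singular \<open>w\<close>. At a regular \<open>w\<close> the value
  is zero, whence the premise.\<close>

lemma weighted_functional_p:
  assumes "\<not> singular_vertex E w \<Longrightarrow> t w = 0"
  shows "weighted_functional t (p w) = complex_of_real (t w)"
proof -
  have p: "p w = ev (free_p w)" by (simp add: vertex_proj_def)
  have "coef ([], v) ([], v) (p w) = (if singular_vertex E v \<and> v = w then 1 else 0)" for v
    unfolding p coef_ev[OF free_gen_closed] by (auto simp: free_gen_def entry_single)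
  then have "weighted_functional t (p w) =
      (\<Sum>\<^sub>\<infinity>v. complex_of_real (t v) * (if singular_vertex E v \<and> v = w then 1 else 0))"
    by (simp add: weighted_functional_def)
  also have "\<dots> = (\<Sum>\<^sub>\<infinity>v\<in>{w}. complex_of_real (t v) * (if singular_vertex E v \<and> v = w then 1 else 0))"
    by (rule infsum_cong_neutral) auto
  finally show ?thesis using assms by auto
qed

text \<open>The bound of \<open>coef_ground_bound\<close> is the same at every vertex, so it
  survives the weighted sum.\<close>

lemma weighted_functional_ground:
  assumes t: "subprobability t" and act: "graph_action E c \<sigma>" and c: "\<And>e. c e > 1"
    and a: "a \<in> carrier A" and b: "b \<in> carrier A"
    and F: "entire_extension A \<sigma> b F" and z: "Im z \<ge> 0"
  shows "cmod (weighted_functional t (a \<otimes> F z)) \<le> cnorm A a * cnorm A b"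
proof -
  interpret subprobability t by (rule t)
  have "F z \<in> carrier A" using F by (simp add: entire_extension_def entire_into_def)
  then show ?thesis
    using infsum_weighted_le[OF coef_ground_bound[OF act c a b F z]] a
    by (simp add: weighted_functional_def mult_closed)
qed

lemma tracial_state_extends:
  assumes act: "graph_action E c \<sigma>" and c: "\<And>e. c e > 1"
    and \<tau>: "tracial_state (vertex_algebra E) \<tau>" and supp: "vertex_support E \<tau> \<subseteq> {v. singular_vertex E v}"
  shows "\<exists>\<phi>. ground_state A \<sigma> \<phi> \<and> restrict \<phi> V = \<tau>"
proof -
  have lin: "\<tau> \<in> extensional V" "\<And>x y. x \<in> V \<Longrightarrow> y \<in> V \<Longrightarrow> \<tau> (x \<oplus> y) = \<tau> x + \<tau> y"
    "\<And>x a. x \<in> V \<Longrightarrow> \<tau> (a \<odot> x) = a * \<tau> x"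
    "\<And>x. x \<in> V \<Longrightarrow> \<tau> (adj A x \<otimes> x) \<in> \<real>\<^sub>\<ge>\<^sub>0"
    "bdd_above {cmod (\<tau> x) |x. x \<in> V \<and> cnorm A x \<le> 1}"
    "Sup {cmod (\<tau> x) |x. x \<in> V \<and> cnorm A x \<le> 1} = 1"
    using \<tau> unfolding tracial_state_def state_def linear_functional_def vertex_algebra_ops by simp_all
  have \<tau>_le: "cmod (\<tau> x) \<le> cnorm A x" if "x \<in> V" for x
    using functional_bound[of V \<tau> x, OF V_subset V_op(2) lin(3,5) that] by (simp add: lin(6))
  \<comment> \<open>The weights are read off on the projections;
    \<open>p v = adj A (p v) \<otimes> p v\<close> makes these values real and nonnegative.\<close>
  define t where "t v = Re (\<tau> (p v))" for v
  have \<tau>p: "\<tau> (p v) = complex_of_real (t v)" "0 \<le> t v" for v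
    using lin(4)[OF p_in_V, of v] by (auto simp: t_def complex_nonneg_Reals_iff complex_eq_iff)
  have \<tau>0: "\<tau> \<zero> = 0" using lin(3)[OF psum_in_V[of "{}"], of 0] by simp
  have psum: "\<tau> (psum F) = complex_of_real (sum t F)" if "finite F" for F
    using that
    by (induction rule: finite_induct) (simp_all add: psum_insert \<tau>0 lin(2) p_in_V psum_in_V \<tau>p)
  \<comment> \<open>Finite partial sums are values of \<open>\<tau>\<close> on the projections
    \<open>psum F\<close>, whose norm is at most 1.\<close>
  interpret T: subprobability t
  proof
    show "0 \<le> t v" for v by (rule \<tau>p)
    show "sum t F \<le> 1" if "finite F" for F
      using \<tau>_le[OF psum_in_V[OF that]] psum_norm_le[OF that] complex_Re_le_cmod[of "\<tau> (psum F)"]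
      by (simp only: psum[OF that] Re_complex_of_real)
  qed
  let ?\<phi> = "weighted_functional t"
  note G = weighted_functional_contractive[OF T.subprobability_axioms]
  have "t v = 0" if "\<not> singular_vertex E v" for v
    using subsetD[OF supp, of v] that by (cases "\<tau> (p v) = 0") (simp_all add: vertex_support_def t_def)
  note \<phi>p = weighted_functional_p[of _ t, OF this]
  have \<phi>0: "?\<phi> \<zero> = 0" using contractiveD(2)[OF G, of \<zero> 0] by simp
  \<comment> \<open>Agreement on the \<open>p v\<close> passes to linear combinations and then, by
    continuity of both functionals, to \<open>V\<close>.\<close>
  have span: "?\<phi> x = \<tau> x" if "x \<in> lin_span A (range p)" for x
    using that
  proof induction
    case (add_scaled x y a)
    then obtain v where x: "x = p v" by blast
    have y: "y \<in> V" by (rule lin_span_subset[OF p_range add_scaled(2)])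
    have "?\<phi> (a \<odot> p v \<oplus> y) = a * ?\<phi> (p v) + ?\<phi> y"
      by (simp add: contractiveD[OF G] scale_closed V_closed[OF y])
    also have "\<dots> = \<tau> (a \<odot> p v \<oplus> y)"
      by (simp add: lin(2,3) V_op(2) p_in_V y \<phi>p \<tau>p add_scaled)
    finally show ?case unfolding x .
  qed (simp add: \<phi>0 \<tau>0)
  have eq: "?\<phi> x = \<tau> x" if x: "x \<in> V" for x
  proof -
    obtain X where X: "\<And>n. X n \<in> lin_span A (range p)" "tends X x sequentially"
      by (rule closed_span_limit[OF p_range x]) (rule that)
    have XV: "X n \<in> V" for n by (rule lin_span_subset[OF p_range X(1)])
    have "(\<lambda>n. \<tau> (X n) - \<tau> x) \<longlonglongrightarrow> 0"
    proof (rule Lim_null_comparison[OF _ tendsD(3)[OF X(2)]], intro always_eventually allI)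
      fix n
      \<comment> \<open>\<open>\<tau>\<close> is additive only on \<open>V\<close>, so the
        difference is rewritten as a sum with both terms in \<open>V\<close>.\<close>
      have m: "(-1) \<odot> x \<in> V" by (rule V_op(2)[OF x])
      have d: "X n \<ominus> x = X n \<oplus> (-1) \<odot> x" by (simp add: a_minus_def scale_minus V_closed[OF x])
      have "\<tau> (X n \<ominus> x) = \<tau> (X n) - \<tau> x" unfolding d by (simp add: lin(2)[OF XV m] lin(3)[OF x])
      then show "cmod (\<tau> (X n) - \<tau> x) \<le> cnorm A (X n \<ominus> x)"
        using \<tau>_le[of "X n \<ominus> x"] V_op(1)[OF XV m] by (simp add: d)
    qed
    then have "(\<lambda>n. \<tau> (X n)) \<longlonglongrightarrow> \<tau> x" by (subst Lim_null)
    from LIMSEQ_unique[OF this] contractive_tendsto[OF G X(2)] show ?thesis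
      by (simp only: span[OF X(1)])
  qed
  have res: "restrict ?\<phi> V = \<tau>"
    by (rule extensionalityI[of _ V]) (simp_all add: eq lin(1))
  let ?B = "{cmod (?\<phi> x) |x. x \<in> carrier A \<and> cnorm A x \<le> 1}"
  let ?C = "{cmod (\<tau> x) |x. x \<in> V \<and> cnorm A x \<le> 1}"
  have le1: "r \<le> 1" if "r \<in> ?B" for r
    using that by (elim CollectE exE conjE) (simp add: order_trans[OF contractiveD(3)[OF G]])
  have bdd: "bdd_above ?B" by (rule bdd_aboveI[of _ 1]) (rule le1)
  \<comment> \<open>The functional extends \<open>\<tau>\<close>, so its norm is at least 1;
    contractivity gives the other bound.\<close>
  have sub: "?C \<subseteq> ?B"
  proof
    fix r assume "r \<in> ?C"
    then obtain x where "r = cmod (\<tau> x)" "x \<in> V" "cnorm A x \<le> 1" by blast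
    then show "r \<in> ?B" by (intro CollectI exI[of _ x]) (simp add: eq V_closed)
  qed
  have mem: "cmod (\<tau> \<zero>) \<in> ?C"
    using psum_in_V[of "{}"] by (intro CollectI exI[of _ \<zero>]) simp
  then have ne: "?C \<noteq> {}" by (metis empty_iff)
  have neB: "?B \<noteq> {}" using subsetD[OF sub mem] by (metis empty_iff)
  have "1 \<le> Sup ?B" using cSup_subset_mono[OF ne bdd sub] by (simp add: lin(6))
  moreover have "Sup ?B \<le> 1"
    by (rule cSup_least[OF neB le1])
  ultimately have Sup: "Sup ?B = 1" by (rule antisym[rotated])
  have ext: "?\<phi> \<in> extensional (carrier A)"
    by (simp add: weighted_functional_def)
  have "state A ?\<phi>"
    unfolding state_def linear_functional_def
    using weighted_functional_positive[OF T.subprobability_axioms] bdd Sup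
    by (simp add: contractiveD[OF G] ext)
  moreover have "\<exists>K. \<forall>z. Im z \<ge> 0 \<longrightarrow> cmod (?\<phi> (a \<otimes> F z)) \<le> K"
    if "a \<in> analytic_elements A \<sigma>" "b \<in> analytic_elements A \<sigma>" "entire_extension A \<sigma> b F" for a b F
    using weighted_functional_ground[OF T.subprobability_axioms act c _ _ that(3)] that(1,2)
    by (intro exI[of _ "cnorm A a * cnorm A b"]) (simp add: analytic_elements_def)
  ultimately have "ground_state A \<sigma> ?\<phi>" unfolding ground_state_def by blast
  with res show ?thesis by (intro exI[of _ ?\<phi>] conjI)
qed

text \<open>A restriction to \<open>V\<close> fixes the values on every \<open>p v\<close>, so
  \<open>ground_state_unique\<close> gives injectivity, and \<open>tracial_state_extends\<close>
  gives surjectivity.\<close>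

lemma ground_state_bij:
  assumes act: "graph_action E c \<sigma>" and c: "\<And>e. c e > 1"
  shows "bij_betw (\<lambda>\<phi>. restrict \<phi> V) {\<phi>. ground_state A \<sigma> \<phi>}
    {\<tau>. tracial_state (vertex_algebra E) \<tau> \<and> vertex_support E \<tau> \<subseteq> {v. singular_vertex E v}}"
proof (rule bij_betwI')
  fix \<phi> \<psi> assume \<phi>: "\<phi> \<in> {\<phi>. ground_state A \<sigma> \<phi>}" and \<psi>: "\<psi> \<in> {\<phi>. ground_state A \<sigma> \<phi>}"
  show "restrict \<phi> V = restrict \<psi> V \<longleftrightarrow> \<phi> = \<psi>"
  proof
    assume eq: "restrict \<phi> V = restrict \<psi> V"
    have "\<phi> (p v) = \<psi> (p v)" for v using fun_cong[OF eq, of "p v"] by (simp add: p_in_V)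
    then show "\<phi> = \<psi>" using \<phi> \<psi> by (intro ground_state_unique[OF c act]) simp_all
  qed simp
next
  fix \<phi> assume "\<phi> \<in> {\<phi>. ground_state A \<sigma> \<phi>}"
  then show "restrict \<phi> V \<in> {\<tau>. tracial_state (vertex_algebra E) \<tau> \<and> vertex_support E \<tau> \<subseteq> {v. singular_vertex E v}}"
    using ground_state_restrict[OF c act, of \<phi>] by simp
next
  fix \<tau> assume "\<tau> \<in> {\<tau>. tracial_state (vertex_algebra E) \<tau> \<and> vertex_support E \<tau> \<subseteq> {v. singular_vertex E v}}"
  then show "\<exists>\<phi>\<in>{\<phi>. ground_state A \<sigma> \<phi>}. \<tau> = restrict \<phi> V"
    using tracial_state_extends[OF act c, of \<tau>] by auto
qed

end

theorem theorem4p4: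
  fixes E :: "('v, 'e) graph" and c :: "'e \<Rightarrow> real"
    and \<sigma> :: "real \<Rightarrow> (nat \<Rightarrow> ('v + 'e) free) set \<Rightarrow> (nat \<Rightarrow> ('v + 'e) free) set"
  assumes "\<And>e. c e > 0"
    and "\<And>e. c e > 1"
    and "graph_action E c \<sigma>"
  shows "bij_betw (\<lambda>\<phi>. restrict \<phi> (carrier (vertex_algebra E)))
           {\<phi>. ground_state (graph_cstar E) \<sigma> \<phi>}
           {\<tau>. tracial_state (vertex_algebra E) \<tau> \<and>
                vertex_support E \<tau> \<subseteq> {v. singular_vertex E v}}"
proof -
  interpret graph_algebra "graph_cstar E" E
    by (rule graph_algebra.intro[OF cstar_algebra_graph]) (simp add: graph_algebra_axioms_def)
  show ?thesis
    using ground_state_bij[OF assms(3,2)] by (simp add: vertex_algebra_ops)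
qed

end
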